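(* Let $\alpha\neq0$. Assume that (eConv), (uUE), (uEquiv), stated in the context, are satisfied for each $u\in\mathcal U$, with $\sup_{u\in\mathcal U}\Delta_u<1$ and $\sup_{u\in\mathcal U}K_u<\infty$. Assume also (uCont), and let $u_n,u\in\mathcal U$ with $u_n(x)\to u(x)$ for every $x\in E$ as $n\to\infty$. Then for each $m\in\mathbb N$ and $x\in E$ $$I_x^{\alpha,2^{-m}}(u_n)=\lambda^{(m),u_n,\alpha}\ \to\ I_x^{\alpha,2^{-m}}(u)=\lambda^{(m),u,\alpha}\quad\text{as } n\to\infty.$$ Furthermore, if additionally the convergence in (eConv) is uniform over the controls $(u_n)$, then $$I_x^{\alpha}(u_n)=\lambda^{u_n,\alpha}\ \to\ I_x^\alpha(u)=\lambda^{u,\alpha}\quad\text{as } n\to\infty.$$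
   Context: Setting. $E$ is a Polish space with Borel $\sigma$-field $\mathcal E$, $U$ is a compact set of control parameters, and $\mathcal U$ is a family of Borel measurable maps $u:E\to U$ (Markov controls), with convergence $u_n\to u$ meaning $u_n(x)\to u(x)$ for each $x\in E$. For each $u\in\mathcal U$, $(X_t^u)_{t\ge 0}$ is a continuous time $E$-valued Markov process with transition operators $P_t^u(x,dy)$ (the control used at time $t$ is $u(X_t^u)$). For $m\in\mathbb N$ and $a\in U$ there is a transition kernel $P^{(m),a}_{2^{-m}}(x,dy)$ on $E$ (discretization step $2^{-m}$), and $(X^{(m),u}_{n2^{-m}})_{n\ge 0}$ is the Markov chain with one-step kernel $P^{(m),u(x)}_{2^{-m}}(x,dy)$; for $t=k2^{-m}$, $P_t^{(m),u}(x,dy)$ denotes its $k$-step kernel. $E_x^u$ denotes expectation for the process started at $x$ under control $u$. The reward $c:E\times U\to\mathbb R$ is bounded, measurable and continuous in the second variable. $B(E)$ is the set of bounded Borel functions on $E$. Functionals. $$I_x^\alpha(u)=\liminf_{t\to\infty}\frac1\alpha\frac1t\ln E_x^u\Big\{e^{\alpha\int_0^tc(X_s^u,u(X_s^u))ds}\Big\},\qquad I_x^{\alpha,h}(u)=\liminf_{n\to\infty}\frac1\alpha\frac1{nh}\ln E_x^u\Big\{e^{\alpha h\sum_{i=0}^{n-1}c(X^{(m),u}_{ih},u(X^{(m),u}_{ih}))}\Big\},\quad h=2^{-m}.$$ Constants. $\lambda^{(m),u,\alpha}$ is the constant for which there is $w^{(m),u,\alpha}\in B(E)$ with, for all $x\in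 E$, $$e^{\alpha w^{(m),u,\alpha}(x)}=E_x^u\Big\{\exp\Big\{\alpha\sum_{i=0}^{2^m-1}2^{-m}\big(c(X^{(m),u}_{i2^{-m}},u(X^{(m),u}_{i2^{-m}}))-\lambda^{(m),u,\alpha}\big)+\alpha w^{(m),u,\alpha}(X_1^{(m),u})\Big\}\Big\},$$ and $\lambda^{u,\alpha}$ is the constant for which there is $w^{u,\alpha}\in B(E)$ with, for all $x\in E$, $$e^{\alpha w^{u,\alpha}(x)}=E_x^u\Big\{\exp\Big\{\alpha\int_0^1\big(c(X_s^u,u(X_s^u))-\lambda^{u,\alpha}\big)ds+\alpha w^{u,\alpha}(X_1^u)\Big\}\Big\}.$$ Conditions. (uUE) For each $u\in\mathcal U$: $\Delta_u:=\sup_{m\in\mathbb N}\sup_{x,x'\in E}\sup_{B\in\mathcal E}\big(P_1^{(m),u}(x,B)-P_1^{(m),u}(x',B)\big)<1$. (uEquiv) For each $u\in\mathcal U$ there is $k\in\mathbb N$ such that $K_u:=\sup_{m\in\mathbb N}\sup_{x,x'\in E}\sup_{B\in\mathcal E}\frac{P_k^{(m),u}(x,B)}{P_k^{(m),u}(x',B)}<\infty$ (i.e. $P_k^{(m),u}(x,B)\le K_uP_k^{(m),u}(x',B)$ always). (eConv) For each $u\in\mathcal U$ and $x\in E$, the measures $\mathcal M_x^{(m),u,\alpha}(B):=E_x^u\{\exp\{\alpha\sum_{i=0}^{2^m-1}2^{-m}c(X^{(m),u}_{i2^{-m}},u(X^{(m),u}_{i2^{-m}}))\}1_B(X_1^{(m),u})\}$,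 $B\in\mathcal E$, converge in variation norm, as $m\to\infty$, to the measure $\mathcal M_x^{u,\alpha}(B):=E_x^u\{\exp\{\alpha\int_0^1c(X_s^u,u(X_s^u))ds\}1_B(X_1^u)\}$. (uCont) For each $m\in\mathbb N$: whenever $u_n\to u$ in $\mathcal U$, then for each $x\in E$, $\|P^{(m),u_n(x)}_{2^{-m}}(x,\cdot)-P^{(m),u(x)}_{2^{-m}}(x,\cdot)\|_V\to0$ as $n\to\infty$. Here $V:E\to[1,\infty)$ is a Borel function and, for a finite signed measure $\nu$, $\|\nu\|_V:=\sup\{|\int_E f\,d\nu|: f \text{ Borel}, |f|\le V\}$.
   Formalization: In (uEquiv) the time k is taken to be the same for all controls u, so that sup over u of K_u is taken at one fixed k; if k may depend on u and be unbounded, the continuity claim is false. *)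

theory Defs
  imports "HOL-Probability.Probability"
begin

primrec kernel_power :: "('e \<Rightarrow> 'e measure) \<Rightarrow> nat \<Rightarrow> ('e::topological_space) \<Rightarrow> 'e measure" where
  "kernel_power K 0 x = return borel x"
| "kernel_power K (Suc n) x = bind (K x) (kernel_power K n)"

definition natural_filtration ::
  "'t::order set \<Rightarrow> 'w measure \<Rightarrow> ('t \<Rightarrow> 'w \<Rightarrow> 'e::topological_space) \<Rightarrow> 't \<Rightarrow> 'w measure" where
  "natural_filtration T M X s =
     sigma (space M) {X r -` A \<inter> space M |r A. r \<in> T \<and> r \<le> s \<and> A \<in> sets borel}"

text \<open>Used with \<open>T = UNIV :: nat set\<close> for chains (\<open>P n\<close> the \<open>n\<close>-step kernel) and
  with \<open>T = {0..} :: real set\<close> for continuous time processes.\<close>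

definition markov_process_from ::
  "'t::{linorder, monoid_add} set \<Rightarrow> ('t \<Rightarrow> 'e \<Rightarrow> 'e measure) \<Rightarrow> 'e::topological_space \<Rightarrow>
     'w measure \<Rightarrow> ('t \<Rightarrow> 'w \<Rightarrow> 'e) \<Rightarrow> bool" where
  "markov_process_from T P x M X \<longleftrightarrow>
     prob_space M \<and>
     (\<forall>t\<in>T. X t \<in> measurable M borel) \<and>
     (AE \<omega> in M. X 0 \<omega> = x) \<and>
     (\<forall>s\<in>T. \<forall>t\<in>T. \<forall>B\<in>sets borel.
        AE \<omega> in M. real_cond_exp M (natural_filtration T M X s)
                     (\<lambda>\<omega>'. indicator B (X (s + t) \<omega>')) \<omega>
                   = measure (P t (X s \<omega>)) B)"

definition bounded_borel :: "('e::topological_space \<Rightarrow> real) set" where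
  "bounded_borel = {f \<in> borel_measurable borel. bounded (range f)}"

text \<open>The \<open>V\<close>-norm of the signed measure \<open>\<mu> - \<nu>\<close>. The supremum runs over those \<open>f\<close> whose
  integral against \<open>\<mu> - \<nu>\<close> is defined. All bounded \<open>f\<close> are among them when \<open>\<mu>\<close> and \<open>\<nu>\<close> are
  finite, so the value is the integral of \<open>V\<close> against the variation measure
  also when \<open>V\<close> itself is not integrable (and may then be infinite). For \<open>V = 1\<close> it is the
  total variation of \<open>\<mu> - \<nu>\<close> on the whole space.\<close>

definition V_norm_diff ::
  "('e::topological_space \<Rightarrow> real) \<Rightarrow> 'e measure \<Rightarrow> 'e measure \<Rightarrow> ereal" where
  "V_norm_diff V \<mu> \<nu> =
     (SUP f\<in>{f \<in> borel_measurable borel.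
               (\<forall>x. \<bar>f x\<bar> \<le> V x) \<and> integrable \<mu> f \<and> integrable \<nu> f}.
        ereal \<bar>(\<integral>x. f x \<partial>\<mu>) - (\<integral>x. f x \<partial>\<nu>)\<bar>)"

definition variation_norm_diff :: "'e::topological_space measure \<Rightarrow> 'e measure \<Rightarrow> ereal" where
  "variation_norm_diff \<mu> \<nu> = V_norm_diff (\<lambda>_. 1) \<mu> \<nu>"

text \<open>\<open>Pd m a\<close> is the kernel of step \<open>1/2^m\<close> under the constant action \<open>a\<close>.\<close>

definition control_kernel ::
  "(nat \<Rightarrow> 'a \<Rightarrow> 'e \<Rightarrow> 'e measure) \<Rightarrow> nat \<Rightarrow> ('e \<Rightarrow> 'a) \<Rightarrow> 'e \<Rightarrow> 'e measure" where
  "control_kernel Pd m u x = Pd m (u x) x"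

text \<open>Transition kernel at the integer time \<open>k\<close>, i.e. after \<open>k * 2^m\<close> steps.\<close>

definition time_kernel ::
  "(nat \<Rightarrow> 'a \<Rightarrow> 'e::topological_space \<Rightarrow> 'e measure) \<Rightarrow> nat \<Rightarrow> ('e \<Rightarrow> 'a) \<Rightarrow> nat \<Rightarrow> 'e \<Rightarrow> 'e measure"
  where
  "time_kernel Pd m u k = kernel_power (control_kernel Pd m u) (k * 2 ^ m)"

definition Delta ::
  "(nat \<Rightarrow> 'a \<Rightarrow> 'e::topological_space \<Rightarrow> 'e measure) \<Rightarrow> ('e \<Rightarrow> 'a) \<Rightarrow> ereal" where
  "Delta Pd u =
     (SUP m. SUP x. SUP x'. SUP B\<in>sets borel.
        ereal (measure (time_kernel Pd m u 1 x) B - measure (time_kernel Pd m u 1 x') B))"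

text \<open>In \<open>ennreal\<close> one has \<open>0 / 0 = 0\<close> and \<open>p / 0 = \<infinity>\<close> for \<open>p > 0\<close>, hence
  \<open>Kbound Pd k u\<close> is the least \<open>K\<close> with \<open>p \<le> K * q\<close> for all the pairs \<open>p\<close>, \<open>q\<close> below.\<close>

definition Kbound ::
  "(nat \<Rightarrow> 'a \<Rightarrow> 'e::topological_space \<Rightarrow> 'e measure) \<Rightarrow> nat \<Rightarrow> ('e \<Rightarrow> 'a) \<Rightarrow> ennreal" where
  "Kbound Pd k u =
     (SUP m. SUP x. SUP x'. SUP B\<in>sets borel.
        emeasure (time_kernel Pd m u k x) B / emeasure (time_kernel Pd m u k x') B)"

definition reward_sum ::
  "('e \<Rightarrow> 'a \<Rightarrow> real) \<Rightarrow> ('e \<Rightarrow> 'a) \<Rightarrow> real \<Rightarrow> (nat \<Rightarrow> 'w \<Rightarrow> 'e) \<Rightarrow> nat \<Rightarrow> 'w \<Rightarrow> real" where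
  "reward_sum c u h Y n \<omega> = (\<Sum>i<n. h * c (Y i \<omega>) (u (Y i \<omega>)))"

definition reward_integral ::
  "('e \<Rightarrow> 'a \<Rightarrow> real) \<Rightarrow> ('e \<Rightarrow> 'a) \<Rightarrow> (real \<Rightarrow> 'w \<Rightarrow> 'e) \<Rightarrow> real \<Rightarrow> 'w \<Rightarrow> real" where
  "reward_integral c u X t \<omega> = (LINT s:{0..t}|lborel. c (X s \<omega>) (u (X s \<omega>)))"

definition I_disc ::
  "real \<Rightarrow> ('e \<Rightarrow> 'a \<Rightarrow> real) \<Rightarrow> ('e \<Rightarrow> 'a) \<Rightarrow> real \<Rightarrow> 'w measure \<Rightarrow> (nat \<Rightarrow> 'w \<Rightarrow> 'e) \<Rightarrow> ereal" where
  "I_disc \<alpha> c u h M Y =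
     liminf (\<lambda>n. ereal (1 / \<alpha> * (1 / (real n * h)) *
                   ln (\<integral>\<omega>. exp (\<alpha> * reward_sum c u h Y n \<omega>) \<partial>M)))"

definition I_cont ::
  "real \<Rightarrow> ('e \<Rightarrow> 'a \<Rightarrow> real) \<Rightarrow> ('e \<Rightarrow> 'a) \<Rightarrow> 'w measure \<Rightarrow> (real \<Rightarrow> 'w \<Rightarrow> 'e) \<Rightarrow> ereal" where
  "I_cont \<alpha> c u M X =
     Liminf at_top (\<lambda>t::real. ereal (1 / \<alpha> * (1 / t) *
                   ln (\<integral>\<omega>. exp (\<alpha> * reward_integral c u X t \<omega>) \<partial>M)))"

text \<open>Below \<open>Q x\<close> is the law under which the process starts at \<open>x\<close>.\<close>

definition mpe_disc ::
  "real \<Rightarrow> ('e::topological_space \<Rightarrow> 'a \<Rightarrow> real) \<Rightarrow> ('e \<Rightarrow> 'a) \<Rightarrow> nat \<Rightarrow> ('e \<Rightarrow> 'w measure) \<Rightarrow>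
     (nat \<Rightarrow> 'w \<Rightarrow> 'e) \<Rightarrow> real \<Rightarrow> bool" where
  "mpe_disc \<alpha> c u m Q Y l \<longleftrightarrow>
     (\<exists>w\<in>bounded_borel. \<forall>x.
        exp (\<alpha> * w x) =
        (\<integral>\<omega>. exp (\<alpha> * (\<Sum>i<2 ^ m. 1 / 2 ^ m * (c (Y i \<omega>) (u (Y i \<omega>)) - l))
                  + \<alpha> * w (Y (2 ^ m) \<omega>)) \<partial>Q x))"

definition lambda_disc ::
  "real \<Rightarrow> ('e::topological_space \<Rightarrow> 'a \<Rightarrow> real) \<Rightarrow> ('e \<Rightarrow> 'a) \<Rightarrow> nat \<Rightarrow> ('e \<Rightarrow> 'w measure) \<Rightarrow>
     (nat \<Rightarrow> 'w \<Rightarrow> 'e) \<Rightarrow> real" where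
  "lambda_disc \<alpha> c u m Q Y = (THE l. mpe_disc \<alpha> c u m Q Y l)"

definition mpe_cont ::
  "real \<Rightarrow> ('e::topological_space \<Rightarrow> 'a \<Rightarrow> real) \<Rightarrow> ('e \<Rightarrow> 'a) \<Rightarrow> ('e \<Rightarrow> 'w measure) \<Rightarrow>
     (real \<Rightarrow> 'w \<Rightarrow> 'e) \<Rightarrow> real \<Rightarrow> bool" where
  "mpe_cont \<alpha> c u Q X l \<longleftrightarrow>
     (\<exists>w\<in>bounded_borel. \<forall>x.
        exp (\<alpha> * w x) =
        (\<integral>\<omega>. exp (\<alpha> * (LINT s:{0..1}|lborel. c (X s \<omega>) (u (X s \<omega>)) - l)
                  + \<alpha> * w (X 1 \<omega>)) \<partial>Q x))"

definition lambda_cont ::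
  "real \<Rightarrow> ('e::topological_space \<Rightarrow> 'a \<Rightarrow> real) \<Rightarrow> ('e \<Rightarrow> 'a) \<Rightarrow> ('e \<Rightarrow> 'w measure) \<Rightarrow>
     (real \<Rightarrow> 'w \<Rightarrow> 'e) \<Rightarrow> real" where
  "lambda_cont \<alpha> c u Q X = (THE l. mpe_cont \<alpha> c u Q X l)"

definition weighted_disc ::
  "real \<Rightarrow> ('e::topological_space \<Rightarrow> 'a \<Rightarrow> real) \<Rightarrow> ('e \<Rightarrow> 'a) \<Rightarrow> nat \<Rightarrow> 'w measure \<Rightarrow>
     (nat \<Rightarrow> 'w \<Rightarrow> 'e) \<Rightarrow> 'e measure" where
  "weighted_disc \<alpha> c u m M Y =
     distr (density M (\<lambda>\<omega>. ennreal (exp (\<alpha> * reward_sum c u (1 / 2 ^ m) Y (2 ^ m) \<omega>))))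
       borel (Y (2 ^ m))"

definition weighted_cont ::
  "real \<Rightarrow> ('e::topological_space \<Rightarrow> 'a \<Rightarrow> real) \<Rightarrow> ('e \<Rightarrow> 'a) \<Rightarrow> 'w measure \<Rightarrow>
     (real \<Rightarrow> 'w \<Rightarrow> 'e) \<Rightarrow> 'e measure" where
  "weighted_cont \<alpha> c u M X =
     distr (density M (\<lambda>\<omega>. ennreal (exp (\<alpha> * reward_integral c u X 1 \<omega>)))) borel (X 1)"

end

theory Submission
  imports Defs
begin

text \<open>
Fix a control. Weighting the paths by the exponential of the reward turns one unit of time into a
positive operator \<open>S\<close> on the bounded Borel functions,
\<open>S f x = E\<^sub>x (exp (\<alpha> * reward over [0, 1]) * f (X\<^sub>1))\<close>. The equation that defines \<open>\<lambda>\<close> says that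
\<open>exp (\<alpha> w)\<close> is a positive eigenfunction of \<open>S\<close> with eigenvalue \<open>exp (\<alpha> \<lambda>)\<close>, and
\<open>E\<^sub>x (exp (\<alpha> * reward over [0, n])) = (S ^^ n) 1 x\<close>. So all claims concern the growth of the iterates of
one operator.

The growth is controlled by a Harnack inequality. As the reward is bounded, the \<open>k\<close>-th
iterate of \<open>S\<close> differs from the transition kernel at time \<open>k\<close> by bounded factors only, and the
equivalence of these kernels gives \<open>(S ^^ k) f x \<le> L * (S ^^ k) f x'\<close> for all \<open>f \<ge> 0\<close>. The
constant \<open>L\<close> is the same for all controls and all step sizes. It has two consequences.
First, the iterates contract quotients of positive functions (Birkhoff, \<open>ratio_contraction\<close>), so the
normalized iterates of \<open>1\<close> converge to an eigenfunction (\<open>eigenfunction_exists\<close>). Secondly, an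
eigenfunction oscillates by the factor \<open>L\<close> at most, hence
\<open>\<bar>ln ((S ^^ n) 1 x) - n \<alpha> \<lambda>\<bar> \<le> ln L\<close> (\<open>eigenvalue_growth\<close>). This estimate yields the uniqueness of
\<open>\<lambda>\<close> and the equality of \<open>\<lambda>\<close> with the growth functional from every starting point. It also yields the
continuity: \<open>\<lambda>\<close> is known up to \<open>ln L / \<bar>n \<alpha>\<bar>\<close> from the \<open>n\<close>-th iterate, so it is
enough that, for each fixed \<open>n\<close>, the \<open>n\<close>-th iterates converge pointwise (\<open>growth_rate_tendsto\<close>).

To pass from one step to \<open>n\<close> steps, the convergence of operators is formulated along bounded pointwise
convergent sequences of functions (\<open>op_converge\<close>), a notion stable under composition. For the
chains it follows from the continuity of the one-step kernels in the control. For the processes in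
continuous time the convergence of the weighted measures gives \<open>op_converge\<close> from the chain
operators to the process operator, which transfers the Harnack inequality with the same \<open>L\<close>
(\<open>harnack_operator_limit\<close>), and its uniformity over the controls allows the two limits to be
interchanged (\<open>op_converge_uniform_approximation\<close>).

There remains the identity between the expectation and the iterates of \<open>S\<close> in continuous time.
The Markov property is given by the conditional laws at single times, and the paths are only
jointly measurable. Therefore the exponential of the additive functional is expanded
into its powers, whose expectations are iterated integrals of the transition kernels
(\<open>dyson_expectation\<close>); summation gives \<open>process_op_conditional\<close>, and an induction backwards in
time gives \<open>process_expectation\<close>.
\<close>

section \<open>Positive operators on bounded Borel functions\<close>

lemma bounded_borel_iff:
  "f \<in> bounded_borel \<longleftrightarrow> f \<in> borel_measurable borel \<and> (\<exists>C. \<forall>x. \<bar>f x\<bar> \<le> C)"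
  by (auto simp: bounded_borel_def bounded_iff)

lemma bounded_borelI:
  "f \<in> borel_measurable borel \<Longrightarrow> (\<And>x. \<bar>f x\<bar> \<le> C) \<Longrightarrow> f \<in> bounded_borel"
  by (auto simp: bounded_borel_iff)

lemma bounded_borel_measurable [measurable_dest]:
  "f \<in> bounded_borel \<Longrightarrow> f \<in> borel_measurable borel"
  by (simp add: bounded_borel_def)

lemma bounded_borelE:
  assumes "f \<in> bounded_borel"
  obtains C where "0 < C" "\<And>x. \<bar>f x\<bar> \<le> C"
proof -
  obtain C where "\<And>x. \<bar>f x\<bar> \<le> C" using assms by (auto simp: bounded_borel_iff)
  then have "\<And>x. \<bar>f x\<bar> \<le> max C 1" by (meson max.coboundedI1)
  then show ?thesis by (intro that[of "max C 1"]) auto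
qed

lemma const_bounded_borel [simp]: "(\<lambda>_. a) \<in> bounded_borel"
  by (rule bounded_borelI[of _ "\<bar>a\<bar>"]) auto

lemma bounded_borel_add:
  assumes "f \<in> bounded_borel" "g \<in> bounded_borel"
  shows "(\<lambda>x. f x + g x) \<in> bounded_borel"
proof -
  obtain C D where "\<And>x. \<bar>f x\<bar> \<le> C" "\<And>x. \<bar>g x\<bar> \<le> D"
    using assms by (meson bounded_borelE)
  with assms show ?thesis
    by (intro bounded_borelI[of _ "C + D"]) (auto intro!: order_trans[OF abs_triangle_ineq] add_mono)
qed

lemma bounded_borel_mult:
  assumes "f \<in> bounded_borel" "g \<in> bounded_borel"
  shows "(\<lambda>x. f x * g x) \<in> bounded_borel"
proof -
  obtain C D where C: "\<And>x. \<bar>f x\<bar> \<le> C" "0 < C" and D: "\<And>x. \<bar>g x\<bar> \<le> D"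
    using assms by (meson bounded_borelE)
  with assms show ?thesis
    by (intro bounded_borelI[of _ "C * D"]) (auto simp: abs_mult intro!: mult_mono)
qed

lemma bounded_borel_cmult:
  "f \<in> bounded_borel \<Longrightarrow> (\<lambda>x. a * f x) \<in> bounded_borel"
  using bounded_borel_mult[of "\<lambda>_. a" f] by simp

lemma bounded_borel_diff:
  assumes "f \<in> bounded_borel" "g \<in> bounded_borel"
  shows "(\<lambda>x. f x - g x) \<in> bounded_borel"
  using bounded_borel_add[OF assms(1) bounded_borel_cmult[OF assms(2), of "-1"]] by simp

lemma bounded_borel_exp:
  assumes "f \<in> bounded_borel"
  shows "(\<lambda>x. exp (a * f x)) \<in> bounded_borel"
proof -
  obtain C where C: "\<And>x. \<bar>f x\<bar> \<le> C" using assms by (meson bounded_borelE)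
  have "a * f x \<le> \<bar>a\<bar> * C" for x
    using mult_left_mono[OF C[of x], of "\<bar>a\<bar>"] abs_ge_self[of "a * f x"] by (simp add: abs_mult)
  then show ?thesis using assms
    by (intro bounded_borelI[of _ "exp (\<bar>a\<bar> * C)"]) auto
qed

text \<open>The weighted kernels of both the chains and the processes act on bounded functions in
  this way. Continuity is asked for bounded pointwise convergence, because this
  mode of convergence preserves measurability and is all that dominated convergence needs.\<close>

locale positive_operator =
  fixes S :: "('e::topological_space \<Rightarrow> real) \<Rightarrow> 'e \<Rightarrow> real" and A :: real
  assumes closed: "f \<in> bounded_borel \<Longrightarrow> S f \<in> bounded_borel"
    and lin: "\<lbrakk>f \<in> bounded_borel; g \<in> bounded_borel\<rbrakk> \<Longrightarrow>
               S (\<lambda>x. p * f x + q * g x) x = p * S f x + q * S g x"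
    and pos: "\<lbrakk>f \<in> bounded_borel; \<And>y. 0 \<le> f y\<rbrakk> \<Longrightarrow> 0 \<le> S f x"
    and one_lower: "exp (- A) \<le> S (\<lambda>_. 1) x"
    and one_upper: "S (\<lambda>_. 1) x \<le> exp A"
    and cont: "\<lbrakk>\<And>n. fs n \<in> bounded_borel; \<And>n y. \<bar>fs n y\<bar> \<le> C; \<And>y. (\<lambda>n. fs n y) \<longlonglongrightarrow> f y\<rbrakk>
               \<Longrightarrow> (\<lambda>n. S (fs n) x) \<longlonglongrightarrow> S f x"
begin

lemma scale: "f \<in> bounded_borel \<Longrightarrow> S (\<lambda>x. p * f x) x = p * S f x"
  using lin[of f f p 0 x] by simp

lemma mono:
  assumes "f \<in> bounded_borel" "g \<in> bounded_borel" "\<And>y. f y \<le> g y"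
  shows "S f x \<le> S g x"
  using pos[OF bounded_borel_diff[OF assms(2,1)], of x] lin[OF assms(2,1), of 1 "-1" x] assms(3)
  by simp

lemma abs_le:
  assumes f: "f \<in> bounded_borel" and C: "\<And>y. \<bar>f y\<bar> \<le> C"
  shows "\<bar>S f x\<bar> \<le> exp A * C"
proof -
  have C0: "0 \<le> C" using C[of undefined] by linarith
  have "S f x \<le> S (\<lambda>_. C * 1) x"
    using C by (intro mono f) (auto simp: abs_le_iff)
  also have "\<dots> = C * S (\<lambda>_. 1) x" by (rule scale) simp
  also have "\<dots> \<le> C * exp A" using one_upper C0 by (rule mult_left_mono)
  finally have 1: "S f x \<le> C * exp A" .
  have "- C * S (\<lambda>_. 1) x = S (\<lambda>_. - C * 1) x" by (rule scale[symmetric]) simp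
  also have "\<dots> \<le> S f x"
    using C by (intro mono f) (auto simp: abs_le_iff minus_le_iff)
  finally have "- (C * S (\<lambda>_. 1) x) \<le> S f x" by simp
  moreover have "C * S (\<lambda>_. 1) x \<le> C * exp A" using one_upper C0 by (rule mult_left_mono)
  ultimately show ?thesis using 1 by (simp add: abs_le_iff mult.commute)
qed

lemma positive_operator_funpow: "positive_operator (S ^^ n) (real n * A)"
proof (induction n)
  case 0
  show ?case by unfold_locales auto
next
  case (Suc n)
  interpret T: positive_operator "S ^^ n" "real n * A" by (rule Suc)
  have comp: "(S ^^ Suc n) f = S ((S ^^ n) f)" for f by simp
  show ?case unfolding comp
  proof unfold_locales
    fix f g :: "'e \<Rightarrow> real" and p q x
    assume f: "f \<in> bounded_borel" and g: "g \<in> bounded_borel"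
    have "(S ^^ n) (\<lambda>x. p * f x + q * g x) = (\<lambda>x. p * (S ^^ n) f x + q * (S ^^ n) g x)"
      by (rule ext) (rule T.lin[OF f g])
    then show "S ((S ^^ n) (\<lambda>x. p * f x + q * g x)) x = p * S ((S ^^ n) f) x + q * S ((S ^^ n) g) x"
      using lin[OF T.closed[OF f] T.closed[OF g]] by simp
  next
    fix x
    have "exp (- (real n * A)) * exp (-A) \<le> exp (- (real n * A)) * S (\<lambda>_. 1) x"
      by (intro mult_left_mono one_lower) simp
    also have "\<dots> = S (\<lambda>_. exp (- (real n * A)) * 1) x" by (rule scale[symmetric]) simp
    also have "\<dots> \<le> S ((S ^^ n) (\<lambda>_. 1)) x"
      by (rule mono) (auto simp: T.closed intro: order_trans[OF _ T.one_lower])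
    finally show "exp (- (real (Suc n) * A)) \<le> S ((S ^^ n) (\<lambda>_. 1)) x"
      by (simp add: exp_add[symmetric] algebra_simps)
    have "S ((S ^^ n) (\<lambda>_. 1)) x \<le> S (\<lambda>_. exp (real n * A) * 1) x"
      by (rule mono) (auto simp: T.closed intro: order_trans[OF T.one_upper])
    also have "\<dots> = exp (real n * A) * S (\<lambda>_. 1) x" by (rule scale) simp
    also have "\<dots> \<le> exp (real n * A) * exp A"
      by (intro mult_left_mono one_upper) simp
    finally show "S ((S ^^ n) (\<lambda>_. 1)) x \<le> exp (real (Suc n) * A)"
      by (simp add: exp_add[symmetric] algebra_simps)
  next
    fix fs :: "nat \<Rightarrow> 'e \<Rightarrow> real" and C f x
    assume *: "\<And>n. fs n \<in> bounded_borel" "\<And>n y. \<bar>fs n y\<bar> \<le> C" "\<And>y. (\<lambda>n. fs n y) \<longlonglongrightarrow> f y"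
    show "(\<lambda>i. S ((S ^^ n) (fs i)) x) \<longlonglongrightarrow> S ((S ^^ n) f) x"
      by (rule cont[of _ "exp (real n * A) * C"])
        (auto intro: T.closed * T.abs_le T.cont[of fs C f])
  qed (auto intro!: closed T.closed pos T.pos)
qed

lemma funpow_commute: "(S ^^ n) ((S ^^ j) f) = (S ^^ (n + j)) f"
  by (simp add: funpow_add)

lemma funpow_eigen:
  assumes g: "g \<in> bounded_borel" and e: "\<And>x. S g x = \<rho> * g x"
  shows "(S ^^ n) g x = \<rho> ^ n * g x"
proof (induction n arbitrary: x)
  case (Suc n)
  have "(S ^^ n) g = (\<lambda>x. \<rho> ^ n * g x)" using Suc by auto
  then have "(S ^^ Suc n) g x = S (\<lambda>x. \<rho> ^ n * g x) x" by simp
  also have "\<dots> = \<rho> ^ Suc n * g x" by (simp add: scale g e)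
  finally show ?case .
qed simp

end

section \<open>The Harnack inequality and the principal eigenvalue\<close>

text \<open>By the Harnack inequality, all functions \<open>(S ^^ k) f\<close> with \<open>f \<ge> 0\<close> are
  comparable to constants, with one constant for all of them. It is inherited by the
  later iterates since \<open>(S ^^ (k + j)) f = (S ^^ k) ((S ^^ j) f)\<close>.\<close>

locale harnack_operator = positive_operator +
  fixes k :: nat and L :: real
  assumes harnack_k: "\<lbrakk>f \<in> bounded_borel; \<And>y. 0 \<le> f y\<rbrakk> \<Longrightarrow> (S ^^ k) f x \<le> L * (S ^^ k) f x'"
begin

lemma harnack:
  assumes "k \<le> n" "f \<in> bounded_borel" "\<And>y. 0 \<le> f y"
  shows "(S ^^ n) f x \<le> L * (S ^^ n) f x'"
proof -
  interpret T: positive_operator "S ^^ (n - k)" "real (n - k) * A" by (rule positive_operator_funpow)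
  have "(S ^^ n) f = (S ^^ k) ((S ^^ (n - k)) f)" using assms(1) by (simp add: funpow_commute)
  then show ?thesis using harnack_k[OF T.closed T.pos] assms by simp
qed

lemma power_one_pos: "0 < (S ^^ n) (\<lambda>_. 1) x"
proof -
  interpret T: positive_operator "S ^^ n" "real n * A" by (rule positive_operator_funpow)
  show ?thesis using T.one_lower[of x] by (meson exp_gt_zero less_le_trans)
qed

lemma L_ge_1: "1 \<le> L"
proof -
  have "(S ^^ k) (\<lambda>_. 1) x \<le> L * (S ^^ k) (\<lambda>_. 1) x" for x
    by (rule harnack_k) auto
  then show ?thesis using power_one_pos[of k] by simp
qed

text \<open>Birkhoff's contraction, in an elementary form. Write \<open>\<phi>\<close> for the quotient of the images
  and apply the Harnack inequality to \<open>f - m g\<close> and to \<open>M g - f\<close>: this gives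
  \<open>sup \<phi> - m \<le> L\<^sup>2 (inf \<phi> - m)\<close> and \<open>M - inf \<phi> \<le> L\<^sup>2 (M - sup \<phi>)\<close>. Adding the two bounds
  the new width \<open>sup \<phi> - inf \<phi>\<close> by \<open>(L\<^sup>2 - 1) / (L\<^sup>2 + 1)\<close> times the old one.\<close>

lemma ratio_contraction:
  assumes f: "f \<in> bounded_borel" and g: "g \<in> bounded_borel" and g0: "\<And>x. 0 \<le> g x"
    and G0: "\<And>x. 0 < (S ^^ k) g x"
    and lo: "\<And>x. m * g x \<le> f x" and up: "\<And>x. f x \<le> M * g x"
  shows "\<exists>m' M'. m \<le> m' \<and> (\<forall>x. m' * (S ^^ k) g x \<le> (S ^^ k) f x \<and> (S ^^ k) f x \<le> M' * (S ^^ k) g x)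
           \<and> M' - m' \<le> (L\<^sup>2 - 1) / (L\<^sup>2 + 1) * (M - m)"
proof -
  interpret T: positive_operator "S ^^ k" "real k * A" by (rule positive_operator_funpow)
  define F G where "F = (S ^^ k) f" and "G = (S ^^ k) g"
  define \<phi> where "\<phi> x = F x / G x" for x
  have Gp: "0 < G x" for x using G0 by (simp add: G_def)
  have Gh: "G x' \<le> L * G x" for x x' unfolding G_def by (rule harnack_k[OF g g0])
  \<comment> \<open>numerator and denominator contribute one factor \<open>L\<close> each\<close>
  have bump: "h x / G x \<le> L\<^sup>2 * (h x' / G x')"
    if h: "\<And>x x'. h x \<le> L * h x'" "\<And>x. 0 \<le> h x" for h :: "'a \<Rightarrow> real" and x x'
  proof -
    have "h x * G x' \<le> (L * h x') * (L * G x)"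
      using h Gh[of x' x] L_ge_1 by (intro mult_mono) (auto intro: less_imp_le[OF Gp])
    then show ?thesis using Gp[of x] Gp[of x']
      by (simp add: field_simps power2_eq_square)
  qed
  have l: "(S ^^ k) (\<lambda>x. 1 * f x + (- m) * g x) x = F x - m * G x" for x
    using T.lin[OF f g, of 1 "-m" x] by (simp add: F_def G_def)
  have u: "(S ^^ k) (\<lambda>x. (- 1) * f x + M * g x) x = M * G x - F x" for x
    using T.lin[OF f g, of "-1" M x] by (simp add: F_def G_def)
  have lb: "(\<lambda>x. 1 * f x + (- m) * g x) \<in> bounded_borel"
    by (intro bounded_borel_add bounded_borel_cmult f g)
  have ub: "(\<lambda>x. (- 1) * f x + M * g x) \<in> bounded_borel"
    by (intro bounded_borel_add bounded_borel_cmult f g)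
  have l0: "0 \<le> F x - m * G x" for x
    using T.pos[OF lb, of x] lo unfolding l by simp
  have u0: "0 \<le> M * G x - F x" for x
    using T.pos[OF ub, of x] up unfolding u by simp
  have lh: "F x - m * G x \<le> L * (F x' - m * G x')" for x x'
    using harnack_k[OF lb, of x x'] lo unfolding l by simp
  have uh: "M * G x - F x \<le> L * (M * G x' - F x')" for x x'
    using harnack_k[OF ub, of x x'] up unfolding u by simp
  have lo': "\<phi> x - m \<le> L\<^sup>2 * (\<phi> x' - m)" for x x'
    using bump[of "\<lambda>x. F x - m * G x" x x', OF lh l0] Gp[of x] Gp[of x']
    by (simp add: \<phi>_def diff_divide_distrib)
  have up': "M - \<phi> x \<le> L\<^sup>2 * (M - \<phi> x')" for x x'
    using bump[of "\<lambda>x. M * G x - F x" x x', OF uh u0] Gp[of x] Gp[of x']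
    by (simp add: \<phi>_def diff_divide_distrib)
  have rng: "m \<le> \<phi> x" "\<phi> x \<le> M" for x
    using l0[of x] u0[of x] Gp[of x] by (auto simp: \<phi>_def field_simps)
  define m' M' where "m' = (INF x. \<phi> x)" and "M' = (SUP x. \<phi> x)"
  have bdd: "bdd_below (range \<phi>)" "bdd_above (range \<phi>)"
    using rng by (auto intro!: bdd_belowI2 bdd_aboveI2)
  have m'l: "m' \<le> \<phi> x" and M'u: "\<phi> x \<le> M'" for x
    unfolding m'_def M'_def using bdd by (auto intro: cINF_lower cSUP_upper)
  have mm: "m \<le> m'" unfolding m'_def using rng by (intro cINF_greatest) auto
  have MM: "M' \<le> M" unfolding M'_def using rng by (intro cSUP_least) auto
  have L2: "0 < L\<^sup>2" using L_ge_1 by simp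
  have "M' - m \<le> L\<^sup>2 * (\<phi> x' - m)" for x'
  proof -
    have "M' \<le> m + L\<^sup>2 * (\<phi> x' - m)" unfolding M'_def
      using lo' by (intro cSUP_least) (auto simp: algebra_simps)
    then show ?thesis by simp
  qed
  then have "(M' - m) / L\<^sup>2 + m \<le> \<phi> x'" for x'
    using L2 by (simp add: field_simps)
  then have "(M' - m) / L\<^sup>2 + m \<le> m'" unfolding m'_def by (intro cINF_greatest) auto
  then have 1: "M' - m \<le> L\<^sup>2 * (m' - m)" using L2 by (simp add: field_simps)
  have "M - m' \<le> L\<^sup>2 * (M - \<phi> x')" for x'
  proof -
    have "M - L\<^sup>2 * (M - \<phi> x') \<le> m'" unfolding m'_def
      using up' by (intro cINF_greatest) (auto simp: algebra_simps)
    then show ?thesis by simp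
  qed
  then have "\<phi> x' \<le> M - (M - m') / L\<^sup>2" for x'
    using L2 by (simp add: field_simps)
  then have "M' \<le> M - (M - m') / L\<^sup>2" unfolding M'_def by (intro cSUP_least) auto
  then have 2: "M - m' \<le> L\<^sup>2 * (M - M')" using L2 by (simp add: field_simps)
  have "(L\<^sup>2 + 1) * (M' - m') \<le> (L\<^sup>2 - 1) * (M - m)"
    using add_mono[OF 1 2] by (simp add: algebra_simps)
  moreover have "0 < L\<^sup>2 + 1" using L2 by linarith
  ultimately have "M' - m' \<le> (L\<^sup>2 - 1) * (M - m) / (L\<^sup>2 + 1)"
    by (subst pos_le_divide_eq) (simp_all add: mult.commute)
  then have "M' - m' \<le> (L\<^sup>2 - 1) / (L\<^sup>2 + 1) * (M - m)" by simp
  moreover have "m' * G x \<le> F x" "F x \<le> M' * G x" for x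
    using m'l[of x] M'u[of x] Gp[of x] by (auto simp: \<phi>_def field_simps)
  ultimately show ?thesis using mm unfolding F_def G_def by blast
qed

definition \<theta> :: real where "\<theta> = (L\<^sup>2 - 1) / (L\<^sup>2 + 1)"

lemma \<theta>_bounds: "0 \<le> \<theta>" "\<theta> < 1"
proof -
  have "1 \<le> L\<^sup>2" using L_ge_1 by simp
  then show "0 \<le> \<theta>" "\<theta> < 1" by (auto simp: \<theta>_def field_simps)
qed

text \<open>The relative width \<open>(M - m) / m\<close> is bounded uniformly in \<open>j\<close> after the first \<open>k\<close> steps,
  which makes the normalized iterates of \<open>1\<close> a Cauchy sequence.\<close>

lemma iterate_ratio:
  "\<exists>m M. 0 < m \<and> M - m \<le> L\<^sup>2 * \<theta> ^ q * m \<and>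
     (\<forall>x. m * (S ^^ (Suc q * k)) (\<lambda>_. 1) x \<le> (S ^^ (Suc q * k + j)) (\<lambda>_. 1) x \<and>
          (S ^^ (Suc q * k + j)) (\<lambda>_. 1) x \<le> M * (S ^^ (Suc q * k)) (\<lambda>_. 1) x)"
proof (induction q)
  case 0
  define F G where "F = (S ^^ (k + j)) (\<lambda>_. 1)" and "G = (S ^^ k) (\<lambda>_. 1)"
  have Fp: "0 < F x" and Gp: "0 < G x" for x by (auto simp: F_def G_def power_one_pos)
  have Fh: "F x \<le> L * F x'" for x x' unfolding F_def by (rule harnack) auto
  have Gh: "G x \<le> L * G x'" for x x' unfolding G_def by (rule harnack) auto
  define \<phi> where "\<phi> x = F x / G x" for x
  have \<phi>h: "\<phi> x \<le> L\<^sup>2 * \<phi> x'" for x x'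
  proof -
    have "F x * G x' \<le> (L * F x') * (L * G x)"
      using Fh[of x x'] Gh[of x' x] Fp[of x'] Gp[of x'] L_ge_1 by (intro mult_mono) auto
    then show ?thesis using Gp[of x] Gp[of x']
      by (simp add: \<phi>_def field_simps power2_eq_square)
  qed
  have \<phi>p: "0 < \<phi> x" for x using Fp Gp by (simp add: \<phi>_def)
  have L2: "0 < L\<^sup>2" using L_ge_1 by simp
  define m where "m = (INF x. \<phi> x)"
  have ml: "m \<le> \<phi> x" for x unfolding m_def
    by (intro cINF_lower bdd_belowI2[of _ 0]) (auto intro: less_imp_le \<phi>p)
  have lm: "\<phi> x / L\<^sup>2 \<le> m" for x unfolding m_def
    using \<phi>h L2 by (intro cINF_greatest) (auto simp: field_simps)
  have "0 < m" using lm[of undefined] \<phi>p[of undefined] L2 by (meson divide_pos_pos less_le_trans)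
  moreover have "m * G x \<le> F x" "F x \<le> L\<^sup>2 * m * G x" for x
    using ml[of x] lm[of x] Gp[of x] L2 by (auto simp: \<phi>_def field_simps)
  ultimately show ?case
    by (intro exI[of _ m] exI[of _ "L\<^sup>2 * m"]) (auto simp: F_def G_def)
next
  case (Suc q)
  then obtain m M where m: "0 < m" and w: "M - m \<le> L\<^sup>2 * \<theta> ^ q * m"
    and b: "\<And>x. m * (S ^^ (Suc q * k)) (\<lambda>_. 1) x \<le> (S ^^ (Suc q * k + j)) (\<lambda>_. 1) x"
      "\<And>x. (S ^^ (Suc q * k + j)) (\<lambda>_. 1) x \<le> M * (S ^^ (Suc q * k)) (\<lambda>_. 1) x"
    by blast
  have cl: "(S ^^ n) (\<lambda>_. 1) \<in> bounded_borel" for n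
    by (rule positive_operator.closed[OF positive_operator_funpow]) simp
  have e: "(S ^^ k) ((S ^^ (Suc q * k + i)) (\<lambda>_. 1)) = (S ^^ (Suc (Suc q) * k + i)) (\<lambda>_. 1)" for i
    unfolding funpow_commute by (simp add: algebra_simps)
  have "\<exists>m' M'. m \<le> m' \<and>
      (\<forall>x. m' * (S ^^ k) ((S ^^ (Suc q * k + 0)) (\<lambda>_. 1)) x \<le> (S ^^ k) ((S ^^ (Suc q * k + j)) (\<lambda>_. 1)) x \<and>
           (S ^^ k) ((S ^^ (Suc q * k + j)) (\<lambda>_. 1)) x \<le> M' * (S ^^ k) ((S ^^ (Suc q * k + 0)) (\<lambda>_. 1)) x)
      \<and> M' - m' \<le> (L\<^sup>2 - 1) / (L\<^sup>2 + 1) * (M - m)"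
  proof (rule ratio_contraction)
    show "0 < (S ^^ k) ((S ^^ (Suc q * k + 0)) (\<lambda>_. 1)) x" for x
      unfolding e by (rule power_one_pos)
  qed (use b in \<open>auto simp: cl intro: less_imp_le[OF power_one_pos] simp del: funpow.simps mult_Suc\<close>)
  then obtain m' M' where m': "m \<le> m'" "M' - m' \<le> \<theta> * (M - m)"
    and b': "\<And>x. m' * (S ^^ (Suc (Suc q) * k)) (\<lambda>_. 1) x \<le> (S ^^ (Suc (Suc q) * k + j)) (\<lambda>_. 1) x"
      "\<And>x. (S ^^ (Suc (Suc q) * k + j)) (\<lambda>_. 1) x \<le> M' * (S ^^ (Suc (Suc q) * k)) (\<lambda>_. 1) x"
    unfolding e \<theta>_def by auto
  have "\<theta> * (M - m) \<le> \<theta> * (L\<^sup>2 * \<theta> ^ q * m)" using w \<theta>_bounds by (intro mult_left_mono)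
  also have "\<dots> \<le> \<theta> * (L\<^sup>2 * \<theta> ^ q * m')" using m' \<theta>_bounds by (intro mult_left_mono) auto
  finally have "M' - m' \<le> L\<^sup>2 * \<theta> ^ Suc q * m'" using m'(2) by (simp add: algebra_simps)
  then show ?case using m m'(1) b' by (intro exI[of _ m'] exI[of _ M']) auto
qed

lemma power_one_closed: "(S ^^ n) (\<lambda>_. 1) \<in> bounded_borel"
  by (rule positive_operator.closed[OF positive_operator_funpow]) simp

text \<open>\<open>undefined\<close> stands for an arbitrary reference point.\<close>

definition normalized_power :: "nat \<Rightarrow> 'a \<Rightarrow> real" where
  "normalized_power n x = (S ^^ n) (\<lambda>_. 1) x / (S ^^ n) (\<lambda>_. 1) undefined"

lemma normalized_power_bounds:
  assumes "k \<le> n"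
  shows "1 / L \<le> normalized_power n x" "normalized_power n x \<le> L"
proof -
  have "0 < L" using L_ge_1 by simp
  then show "1 / L \<le> normalized_power n x" "normalized_power n x \<le> L"
    using harnack[OF assms, of "\<lambda>_. 1" x undefined] harnack[OF assms, of "\<lambda>_. 1" undefined x]
      power_one_pos[of n undefined]
    by (auto simp: normalized_power_def field_simps)
qed

text \<open>The quotient of two normalized iterates is a quotient of two values of the ratio in
  \<open>iterate_ratio\<close>, hence lies between \<open>m / M\<close> and \<open>M / m\<close>.\<close>

lemma normalized_power_close:
  assumes "Suc q * k \<le> n"
  shows "\<bar>normalized_power n x - normalized_power (Suc q * k) x\<bar> \<le> L ^ 3 * \<theta> ^ q"
proof -
  obtain j where n: "n = Suc q * k + j" using assms le_Suc_ex by blast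
  obtain m M where m: "0 < m" and w: "M - m \<le> L\<^sup>2 * \<theta> ^ q * m"
    and b: "\<And>x. m * (S ^^ (Suc q * k)) (\<lambda>_. 1) x \<le> (S ^^ n) (\<lambda>_. 1) x"
      "\<And>x. (S ^^ n) (\<lambda>_. 1) x \<le> M * (S ^^ (Suc q * k)) (\<lambda>_. 1) x"
    using iterate_ratio[of q j] n by blast
  define F where "F = (S ^^ n) (\<lambda>_. 1)"
  define G where "G = (S ^^ (Suc q * k)) (\<lambda>_. 1)"
  define x0 :: 'a where "x0 = undefined"
  have Fp: "0 < F y" and Gp: "0 < G y" for y unfolding F_def G_def by (rule power_one_pos)+
  have b: "m * G y \<le> F y" "F y \<le> M * G y" for y using b by (auto simp: F_def G_def)
  have mM: "m \<le> M" using b[of x] Gp[of x] by (meson mult_le_cancel_right_pos order_trans)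
  have Gr: "0 < G x / G x0" "G x / G x0 \<le> L"
    using normalized_power_bounds(2)[of "Suc q * k" x] Gp[of x] Gp[of x0]
    by (auto simp: normalized_power_def G_def x0_def)
  have "F x / F x0 \<le> (M * G x) / (m * G x0)"
    using b[of x] b[of x0] Fp[of x0] Gp[of x0] Gp[of x] m mM by (intro frac_le) auto
  moreover have "(m * G x) / (M * G x0) \<le> F x / F x0"
    using b[of x] b[of x0] Fp[of x] Fp[of x0] Gp[of x0] Gp[of x] m mM by (intro frac_le) auto
  moreover have "(M / m - 1) * (G x / G x0) = (M * G x) / (m * G x0) - G x / G x0"
    "(1 - m / M) * (G x / G x0) = G x / G x0 - (m * G x) / (M * G x0)"
    by (simp_all add: left_diff_distrib diff_divide_distrib)
  ultimately have u: "F x / F x0 - G x / G x0 \<le> (M / m - 1) * (G x / G x0)"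
    and l: "G x / G x0 - F x / F x0 \<le> (1 - m / M) * (G x / G x0)"
    by linarith+
  have e: "M / m - 1 \<le> L\<^sup>2 * \<theta> ^ q" "0 \<le> M / m - 1"
    using w m mM by (auto simp: field_simps)
  have "1 - m / M \<le> M / m - 1"
  proof -
    have "m * (2 * M) \<le> m * m + M * M" using zero_le_power2[of "M - m"]
      by (simp add: power2_eq_square algebra_simps)
    then show ?thesis using m mM by (simp add: field_simps)
  qed
  then have "(1 - m / M) * (G x / G x0) \<le> (M / m - 1) * (G x / G x0)"
    using Gr by (intro mult_right_mono) auto
  moreover have "(M / m - 1) * (G x / G x0) \<le> (L\<^sup>2 * \<theta> ^ q) * L"
    using e Gr by (intro mult_mono) auto
  moreover have "(L\<^sup>2 * \<theta> ^ q) * L = L ^ 3 * \<theta> ^ q" by (simp add: power2_eq_square power3_eq_cube)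
  ultimately have "\<bar>F x / F x0 - G x / G x0\<bar> \<le> L ^ 3 * \<theta> ^ q" using u l by linarith
  then show ?thesis by (simp add: normalized_power_def F_def G_def x0_def)
qed

lemma normalized_power_Cauchy: "Cauchy (\<lambda>n. normalized_power n x)"
proof (rule metric_CauchyI)
  fix e :: real assume e: "0 < e"
  have "(\<lambda>q. L ^ 3 * \<theta> ^ q) \<longlonglongrightarrow> L ^ 3 * 0"
    using \<theta>_bounds by (intro tendsto_mult tendsto_const LIMSEQ_realpow_zero) auto
  then have "eventually (\<lambda>q. L ^ 3 * \<theta> ^ q < e / 2) sequentially"
    using e by (intro order_tendstoD(2)) auto
  then obtain q where q: "L ^ 3 * \<theta> ^ q < e / 2" by (auto simp: eventually_sequentially)
  have "dist (normalized_power m x) (normalized_power n x) < e"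
    if "Suc q * k \<le> m" "Suc q * k \<le> n" for m n
    using normalized_power_close[OF that(1), of x] normalized_power_close[OF that(2), of x] q
    by (simp add: dist_real_def abs_le_iff abs_less_iff)
  then show "\<exists>M. \<forall>m\<ge>M. \<forall>n\<ge>M. dist (normalized_power m x) (normalized_power n x) < e" by blast
qed

text \<open>The operator maps each normalized iterate to a multiple of the next one, and the factor is the
  value of the image at the reference point. The limit of these factors is the eigenvalue.\<close>

theorem eigenfunction_exists:
  "\<exists>\<rho> w. 0 < \<rho> \<and> w \<in> bounded_borel \<and> (\<forall>x. S (\<lambda>y. exp (w y)) x = \<rho> * exp (w x))"
proof -
  define \<psi> where "\<psi> x = lim (\<lambda>n. normalized_power n x)" for x
  have lim: "(\<lambda>n. normalized_power n x) \<longlonglongrightarrow> \<psi> x" for x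
    unfolding \<psi>_def using normalized_power_Cauchy[of x]
    by (simp add: Cauchy_convergent_iff convergent_LIMSEQ_iff)
  have L: "1 \<le> L" by (rule L_ge_1)
  have lo: "1 / L \<le> \<psi> x" for x
    by (rule LIMSEQ_le_const[OF lim]) (auto intro!: exI[of _ k] normalized_power_bounds)
  have up: "\<psi> x \<le> L" for x
    by (rule LIMSEQ_le_const2[OF lim]) (auto intro!: exI[of _ k] normalized_power_bounds)
  have Lp: "0 < 1 / L" using L by simp
  have p: "0 < \<psi> x" for x using lo[of x] Lp by linarith
  have ncl: "normalized_power n \<in> bounded_borel" for n
    using bounded_borel_cmult[OF power_one_closed[of n], of "1 / (S ^^ n) (\<lambda>_. 1) undefined"]
    by (simp add: normalized_power_def[abs_def])
  have meas: "\<psi> \<in> borel_measurable borel"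
    by (rule borel_measurable_LIMSEQ_real[OF lim]) (use ncl in \<open>auto simp: bounded_borel_def\<close>)
  have Sn: "S (normalized_power n) x
      = S (normalized_power n) undefined * normalized_power (Suc n) x" for n x
  proof -
    have s: "S (normalized_power n) x = 1 / (S ^^ n) (\<lambda>_. 1) undefined * (S ^^ Suc n) (\<lambda>_. 1) x" for x
      using scale[OF power_one_closed[of n], of "1 / (S ^^ n) (\<lambda>_. 1) undefined" x]
      by (simp add: normalized_power_def[abs_def])
    show ?thesis unfolding s using power_one_pos[of "Suc n" undefined]
      by (simp add: normalized_power_def del: funpow.simps)
  qed
  have Slim: "(\<lambda>n. S (normalized_power (n + k)) x) \<longlonglongrightarrow> S \<psi> x" for x
  proof (rule cont)
    show "\<bar>normalized_power (n + k) y\<bar> \<le> L" for n y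
      using normalized_power_bounds[of "n + k" y] Lp L unfolding abs_le_iff by linarith
  qed (auto simp: ncl intro: LIMSEQ_ignore_initial_segment[OF lim])
  define \<rho> where "\<rho> = S \<psi> undefined"
  have "(\<lambda>n. S (normalized_power (n + k)) undefined * normalized_power (n + Suc k) x) \<longlonglongrightarrow> \<rho> * \<psi> x" for x
    unfolding \<rho>_def by (intro tendsto_mult Slim LIMSEQ_ignore_initial_segment lim)
  then have eig: "S \<psi> x = \<rho> * \<psi> x" for x
    using Slim[of x] Sn[of "_ + k" x] by (intro LIMSEQ_unique[OF Slim]) simp
  have \<psi>b: "\<psi> \<in> bounded_borel"
  proof (rule bounded_borelI[OF meas])
    show "\<bar>\<psi> x\<bar> \<le> L" for x using up[of x] p[of x] by linarith
  qed
  have "0 < \<rho>"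
  proof -
    have "0 < 1 / L * exp (- A)" using Lp by simp
    also have "\<dots> \<le> 1 / L * S (\<lambda>_. 1) undefined"
      using Lp one_lower by (intro mult_left_mono) auto
    also have "\<dots> = S (\<lambda>_. 1 / L * 1) undefined" by (rule scale[symmetric]) simp
    also have "\<dots> \<le> S \<psi> undefined" using lo by (intro mono \<psi>b) auto
    finally show ?thesis by (simp add: \<rho>_def)
  qed
  moreover have "(\<lambda>x. ln (\<psi> x)) \<in> bounded_borel"
  proof (rule bounded_borelI)
    show "\<bar>ln (\<psi> x)\<bar> \<le> ln L" for x
    proof -
      have "ln (1 / L) \<le> ln (\<psi> x)" using lo[of x] Lp p[of x] by simp
      moreover have "ln (\<psi> x) \<le> ln L" using up[of x] p[of x] L by simp
      ultimately show ?thesis using L by (simp add: ln_div abs_le_iff)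
    qed
  qed (use meas in measurable)
  ultimately show ?thesis using eig p
    by (intro exI[of _ \<rho>] exI[of _ "\<lambda>x. ln (\<psi> x)"]) auto
qed

text \<open>The Harnack constant bounds the oscillation of every positive eigenfunction. Hence the
  growth of the iterates determines the eigenvalue, at a speed depending on \<open>L\<close> only.\<close>

lemma eigenvalue_growth:
  assumes \<rho>: "0 < \<rho>" and w: "w \<in> bounded_borel" and e: "\<And>x. S (\<lambda>y. exp (w y)) x = \<rho> * exp (w x)"
  shows "\<bar>ln ((S ^^ n) (\<lambda>_. 1) x) - real n * ln \<rho>\<bar> \<le> ln L"
proof -
  interpret T: positive_operator "S ^^ n" "real n * A" by (rule positive_operator_funpow)
  have g: "(\<lambda>x. exp (w x)) \<in> bounded_borel" using bounded_borel_exp[OF w, of 1] by simp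
  have pow: "(S ^^ n) (\<lambda>x. exp (w x)) x = \<rho> ^ n * exp (w x)" for n x
    by (rule funpow_eigen[OF g e])
  have osc: "exp (w y) \<le> L * exp (w z)" for y z
  proof -
    have "\<rho> ^ k * exp (w y) \<le> L * (\<rho> ^ k * exp (w z))"
      using harnack_k[OF g, of y z] unfolding pow by simp
    then show ?thesis using \<rho> by (simp add: mult.left_commute)
  qed
  have Lp: "0 < L" using L_ge_1 by simp
  have "\<rho> ^ n * exp (w x) \<le> (S ^^ n) (\<lambda>_. L * exp (w x) * 1) x"
    unfolding pow[symmetric] by (rule T.mono) (auto simp: osc g)
  also have "\<dots> = L * exp (w x) * (S ^^ n) (\<lambda>_. 1) x" by (rule T.scale) simp
  finally have 1: "\<rho> ^ n \<le> L * (S ^^ n) (\<lambda>_. 1) x" by (simp add: mult.commute)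
  have "exp (w x) * (S ^^ n) (\<lambda>_. 1) x = (S ^^ n) (\<lambda>_. exp (w x) * 1) x"
    by (rule T.scale[symmetric]) simp
  also have "\<dots> \<le> (S ^^ n) (\<lambda>y. L * exp (w y)) x"
    by (rule T.mono) (auto simp: osc g bounded_borel_cmult)
  also have "\<dots> = L * (\<rho> ^ n * exp (w x))" by (subst T.scale[OF g]) (simp add: pow)
  finally have 2: "(S ^^ n) (\<lambda>_. 1) x \<le> L * \<rho> ^ n" by simp
  have p: "0 < (S ^^ n) (\<lambda>_. 1) x" by (rule power_one_pos)
  have "ln (\<rho> ^ n) \<le> ln (L * (S ^^ n) (\<lambda>_. 1) x)" using 1 p Lp \<rho> by simp
  moreover have "ln ((S ^^ n) (\<lambda>_. 1) x) \<le> ln (L * \<rho> ^ n)" using 2 p Lp \<rho> by simp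
  ultimately show ?thesis using p Lp \<rho> by (simp add: ln_mult ln_realpow abs_le_iff)
qed

end

text \<open>For fixed \<open>j\<close> both rates are determined up to \<open>D / j\<close> by the sequences at \<open>j\<close>, so only the
  convergence for one large \<open>j\<close> at a time is used.\<close>

lemma growth_rate_tendsto:
  fixes r :: "nat \<Rightarrow> real"
  assumes D: "\<And>n j. \<bar>a n j - real j * r n\<bar> \<le> D" "\<And>j. \<bar>b j - real j * s\<bar> \<le> D"
    and lim: "\<And>j. (\<lambda>n. a n j) \<longlonglongrightarrow> b j"
  shows "r \<longlonglongrightarrow> s"
proof (rule LIMSEQ_I)
  fix e :: real assume e: "0 < e"
  obtain j :: nat where j: "(2 * D + 1) / e < real j" using reals_Archimedean2 by blast
  have D0: "0 \<le> D" using D(2)[of 0] by linarith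
  then have jp: "0 < real j" using j e by (meson divide_pos_pos less_trans add_nonneg_pos mult_nonneg_nonneg zero_le_numeral zero_less_one)
  have je: "2 * D + 1 < real j * e" using j e by (simp add: field_simps)
  obtain n0 where n0: "\<And>n. n0 \<le> n \<Longrightarrow> \<bar>a n j - b j\<bar> < 1"
    using LIMSEQ_D[OF lim[of j], of 1] by auto
  have "norm (r n - s) < e" if "n0 \<le> n" for n
  proof -
    have "\<bar>real j * r n - real j * s\<bar> < real j * e"
      using D(1)[of n j] D(2)[of j] n0[OF that] je by linarith
    then have "real j * \<bar>r n - s\<bar> < real j * e"
      using jp by (simp add: abs_mult right_diff_distrib[symmetric])
    then show ?thesis using jp by simp
  qed
  then show "\<exists>no. \<forall>n\<ge>no. norm (r n - s) < e" by blast
qed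

lemma growth_rate_unique:
  fixes r s :: real
  assumes "\<And>j. \<bar>b j - real j * r\<bar> \<le> D" "\<And>j. \<bar>b j - real j * s\<bar> \<le> D"
  shows "r = s"
  using growth_rate_tendsto[of "\<lambda>_. b" "\<lambda>_. r" D b s] assms
  by (simp add: tendsto_const_iff)

section \<open>Convergence of positive operators\<close>

text \<open>The functions vary together with the operators, so that the relation passes to compositions
  and thus to the iterates.\<close>

definition op_converge ::
  "(nat \<Rightarrow> ('e::topological_space \<Rightarrow> real) \<Rightarrow> 'e \<Rightarrow> real) \<Rightarrow> (('e \<Rightarrow> real) \<Rightarrow> 'e \<Rightarrow> real) \<Rightarrow> bool" where
  "op_converge Ss S \<longleftrightarrow>
     (\<forall>fs f C x. (\<forall>n. fs n \<in> bounded_borel) \<longrightarrow> (\<forall>n y. \<bar>fs n y\<bar> \<le> C) \<longrightarrow>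
        (\<forall>y. (\<lambda>n. fs n y) \<longlonglongrightarrow> f y) \<longrightarrow> (\<lambda>n. Ss n (fs n) x) \<longlonglongrightarrow> S f x)"

lemma op_convergeD:
  assumes "op_converge Ss S" "\<And>n. fs n \<in> bounded_borel" "\<And>n y. \<bar>fs n y\<bar> \<le> C"
    "\<And>y. (\<lambda>n. fs n y) \<longlonglongrightarrow> f y"
  shows "(\<lambda>n. Ss n (fs n) x) \<longlonglongrightarrow> S f x"
  using assms unfolding op_converge_def by blast

lemma op_converge_funpow:
  assumes conv: "op_converge Ss S" and Ss: "\<And>n. positive_operator (Ss n) A"
  shows "op_converge (\<lambda>n. Ss n ^^ j) (S ^^ j)"
proof (induction j)
  case 0
  show ?case by (auto simp: op_converge_def)
next
  case (Suc j)
  show ?case unfolding op_converge_def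
  proof safe
    fix fs :: "nat \<Rightarrow> 'a \<Rightarrow> real" and f C x
    assume *: "\<forall>n. fs n \<in> bounded_borel" "\<forall>n y. \<bar>fs n y\<bar> \<le> C" "\<forall>y. (\<lambda>n. fs n y) \<longlonglongrightarrow> f y"
    have T: "positive_operator (Ss n ^^ j) (real j * A)" for n
      by (rule positive_operator.positive_operator_funpow[OF Ss])
    have "(\<lambda>n. Ss n ((Ss n ^^ j) (fs n)) x) \<longlonglongrightarrow> S ((S ^^ j) f) x"
    proof (rule op_convergeD[OF conv])
      show "(Ss n ^^ j) (fs n) \<in> bounded_borel" for n
        using * by (intro positive_operator.closed[OF T]) auto
      show "\<bar>(Ss n ^^ j) (fs n) y\<bar> \<le> exp (real j * A) * C" for n y
        using * by (intro positive_operator.abs_le[OF T]) auto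
      show "(\<lambda>n. (Ss n ^^ j) (fs n) y) \<longlonglongrightarrow> (S ^^ j) f y" for y
        using * by (intro op_convergeD[OF Suc]) auto
    qed
    then show "(\<lambda>n. (Ss n ^^ Suc j) (fs n) x) \<longlonglongrightarrow> (S ^^ Suc j) f x" by simp
  qed
qed

lemma op_converge_funpow_apply:
  assumes conv: "op_converge Ss S" and Ss: "\<And>n. positive_operator (Ss n) A"
    and f: "f \<in> bounded_borel"
  shows "(\<lambda>n. (Ss n ^^ j) f x) \<longlonglongrightarrow> (S ^^ j) f x"
proof -
  obtain C where "\<And>y. \<bar>f y\<bar> \<le> C" using f by (meson bounded_borelE)
  then show ?thesis
    using f by (intro op_convergeD[OF op_converge_funpow[OF conv Ss], of "\<lambda>_. f" C]) auto
qed

text \<open>Both sides of the Harnack inequality converge, and \<open>L\<close> is the same for all indices. As the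
  equivalence of kernels is assumed for the chains, this is how the processes in
  continuous time receive the inequality.\<close>

lemma harnack_operator_limit:
  assumes conv: "op_converge Ss S" and Ss: "\<And>n. harnack_operator (Ss n) A k L"
    and S: "positive_operator S A"
  shows "harnack_operator S A k L"
proof -
  interpret S: positive_operator S A by (rule S)
  have po: "positive_operator (Ss n) A" for n using Ss by (simp add: harnack_operator_def)
  show ?thesis
  proof unfold_locales
    fix f :: "'a \<Rightarrow> real" and x x' assume f: "f \<in> bounded_borel" "\<And>y. 0 \<le> f y"
    show "(S ^^ k) f x \<le> L * (S ^^ k) f x'"
      by (rule LIMSEQ_le[OF op_converge_funpow_apply[OF conv po f(1)]
            tendsto_mult_left[OF op_converge_funpow_apply[OF conv po f(1)]]])
        (use harnack_operator.harnack_k[OF Ss f] in auto)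
  qed
qed

text \<open>The three steps \<open>Rs n \<approx> Ss m n \<rightarrow> S m \<approx> R\<close>: the first approximation is uniform in \<open>n\<close>, so \<open>m\<close>
  can be fixed before \<open>n\<close> tends to infinity.\<close>

lemma op_converge_uniform_approximation:
  assumes conv: "\<And>m. op_converge (\<lambda>n. Ss m n) (S m)"
    and Sinf: "op_converge S R"
    and unif: "\<And>x. (\<epsilon> x) \<longlonglongrightarrow> (0::ereal)"
    and close: "\<And>m n f C x. f \<in> bounded_borel \<Longrightarrow> (\<And>y. \<bar>f y\<bar> \<le> C) \<Longrightarrow>
                  ereal \<bar>Rs n f x - Ss m n f x\<bar> \<le> ereal C * \<epsilon> x m"
  shows "op_converge Rs R"
  unfolding op_converge_def
proof safe
  fix fs :: "nat \<Rightarrow> 'a \<Rightarrow> real" and f C x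
  assume fs: "\<forall>n. fs n \<in> bounded_borel" and C: "\<forall>n y. \<bar>fs n y\<bar> \<le> C"
    and lim: "\<forall>y. (\<lambda>n. fs n y) \<longlonglongrightarrow> f y"
  have fC: "\<bar>f y\<bar> \<le> C" for y
    by (rule LIMSEQ_le_const2[OF tendsto_rabs[OF lim[rule_format]]]) (use C in auto)
  have f: "f \<in> bounded_borel"
  proof (rule bounded_borelI[OF _ fC])
    show "f \<in> borel_measurable borel"
      by (rule borel_measurable_LIMSEQ_real[OF lim[rule_format]]) (use fs in \<open>auto simp: bounded_borel_def\<close>)
  qed
  show "(\<lambda>n. Rs n (fs n) x) \<longlonglongrightarrow> R f x"
  proof (rule LIMSEQ_I)
    fix e :: real assume e: "0 < e"
    have "(\<lambda>m. ereal C * \<epsilon> x m) \<longlonglongrightarrow> ereal C * 0" by (intro tendsto_cmult_ereal unif) auto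
    then have "eventually (\<lambda>m. ereal C * \<epsilon> x m < ereal (e / 3)) sequentially"
      using e by (intro order_tendstoD(2)) auto
    moreover have Slim: "(\<lambda>m. S m f x) \<longlonglongrightarrow> R f x"
      using f fC by (intro op_convergeD[OF Sinf, of "\<lambda>_. f" C]) auto
    have "eventually (\<lambda>m. norm (S m f x - R f x) < e / 3) sequentially"
      using tendstoD[OF Slim, of "e / 3"] e by (simp add: dist_norm)
    ultimately have "eventually (\<lambda>m. ereal C * \<epsilon> x m < ereal (e / 3) \<and> norm (S m f x - R f x) < e / 3) sequentially"
      by (rule eventually_conj)
    then obtain m where m: "ereal C * \<epsilon> x m < ereal (e / 3)" "norm (S m f x - R f x) < e / 3"
      by (auto simp: eventually_sequentially)
    have Sslim: "(\<lambda>n. Ss m n (fs n) x) \<longlonglongrightarrow> S m f x"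
      using fs C lim by (intro op_convergeD[OF conv]) auto
    obtain n0 where n0: "\<And>n. n0 \<le> n \<Longrightarrow> norm (Ss m n (fs n) x - S m f x) < e / 3"
      using LIMSEQ_D[OF Sslim, of "e / 3"] e by auto
    have "norm (Rs n (fs n) x - R f x) < e" if "n0 \<le> n" for n
    proof -
      have "ereal \<bar>Rs n (fs n) x - Ss m n (fs n) x\<bar> \<le> ereal C * \<epsilon> x m"
        using fs C by (intro close) auto
      then have "\<bar>Rs n (fs n) x - Ss m n (fs n) x\<bar> < e / 3"
        using m(1) by (metis ereal_less_le less_ereal.simps(1) order_le_less_trans)
      then show ?thesis using n0[OF that] m unfolding real_norm_def by linarith
    qed
    then show "\<exists>no. \<forall>n\<ge>no. norm (Rs n (fs n) x - R f x) < e" by blast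
  qed
qed

text \<open>If the operators differ little on all functions of given bound, the variation of the
  arguments is left to the continuity of the limit.\<close>

lemma op_converge_perturb:
  assumes S: "positive_operator S A" and \<delta>: "\<And>x. (\<delta> x) \<longlonglongrightarrow> (0::ereal)"
    and close: "\<And>n f C x. f \<in> bounded_borel \<Longrightarrow> (\<And>y. \<bar>f y\<bar> \<le> C) \<Longrightarrow>
                  ereal \<bar>Ss n f x - S f x\<bar> \<le> ereal C * \<delta> x n"
  shows "op_converge Ss S"
  unfolding op_converge_def
proof safe
  fix fs :: "nat \<Rightarrow> 'a \<Rightarrow> real" and f C x
  assume fs: "\<forall>n. fs n \<in> bounded_borel" and C: "\<forall>n y. \<bar>fs n y\<bar> \<le> C"
    and lim: "\<forall>y. (\<lambda>n. fs n y) \<longlonglongrightarrow> f y"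
  have "(\<lambda>n. ereal \<bar>Ss n (fs n) x - S (fs n) x\<bar>) \<longlonglongrightarrow> 0"
  proof (rule tendsto_sandwich[of "\<lambda>_. 0" _ _ "\<lambda>n. ereal C * \<delta> x n"])
    show "(\<lambda>n. ereal C * \<delta> x n) \<longlonglongrightarrow> 0"
      using tendsto_cmult_ereal[OF _ \<delta>[of x], of "ereal C"] by simp
  qed (use fs C in \<open>auto intro!: close always_eventually\<close>)
  then have "(\<lambda>n. \<bar>Ss n (fs n) x - S (fs n) x\<bar>) \<longlonglongrightarrow> 0" by (simp add: zero_ereal_def)
  then have "(\<lambda>n. Ss n (fs n) x - S (fs n) x) \<longlonglongrightarrow> 0" by (rule tendsto_rabs_zero_cancel)
  moreover have "(\<lambda>n. S (fs n) x) \<longlonglongrightarrow> S f x"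
    using fs C lim by (intro positive_operator.cont[OF S]) auto
  ultimately have "(\<lambda>n. (Ss n (fs n) x - S (fs n) x) + S (fs n) x) \<longlonglongrightarrow> 0 + S f x"
    by (rule tendsto_add)
  then show "(\<lambda>n. Ss n (fs n) x) \<longlonglongrightarrow> S f x" by simp
qed

lemma integral_diff_le_V_norm_diff:
  assumes "finite_measure \<mu>" "finite_measure \<nu>" "sets \<mu> = sets borel" "sets \<nu> = sets borel"
    and V: "\<And>x. 1 \<le> V x" and f: "f \<in> bounded_borel" and C: "\<And>y. \<bar>f y\<bar> \<le> C"
  shows "ereal \<bar>(\<integral>x. f x \<partial>\<mu>) - (\<integral>x. f x \<partial>\<nu>)\<bar> \<le> ereal C * V_norm_diff V \<mu> \<nu>"
proof (cases "C = 0")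
  case True
  then show ?thesis using C by (simp add: zero_ereal_def[symmetric])
next
  case False
  then have C0: "0 < C" using C[of undefined] by linarith
  define g where "g x = f x / C" for x
  have gm: "g \<in> borel_measurable borel" using f by (auto simp: g_def[abs_def] bounded_borel_def)
  have g1: "\<bar>g x\<bar> \<le> 1" for x using C[of x] C0 by (simp add: g_def)
  have int: "integrable N g" if "finite_measure N" "sets N = sets borel" for N
  proof -
    have "g \<in> borel_measurable N" using gm by (simp cong: measurable_cong_sets add: that(2))
    then show ?thesis using g1 by (intro finite_measure.integrable_const_bound[OF that(1), of _ 1]) auto
  qed
  have "ereal \<bar>(\<integral>x. g x \<partial>\<mu>) - (\<integral>x. g x \<partial>\<nu>)\<bar> \<le> V_norm_diff V \<mu> \<nu>"
    unfolding V_norm_diff_def using gm g1 V int assms(1-4)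
    by (intro SUP_upper) (auto intro: order_trans)
  then have "ereal C * ereal \<bar>(\<integral>x. g x \<partial>\<mu>) - (\<integral>x. g x \<partial>\<nu>)\<bar> \<le> ereal C * V_norm_diff V \<mu> \<nu>"
    using C0 by (intro ereal_mult_left_mono) auto
  moreover have "C * \<bar>(\<integral>x. g x \<partial>\<mu>) - (\<integral>x. g x \<partial>\<nu>)\<bar> = \<bar>(\<integral>x. f x \<partial>\<mu>) - (\<integral>x. f x \<partial>\<nu>)\<bar>"
    using C0 by (simp add: g_def diff_divide_distrib[symmetric])
  ultimately show ?thesis by simp
qed

text \<open>Bounded functions are integrable against finite measures, so continuity is dominated
  convergence; the bounds on the mass are those on the image of \<open>1\<close>.\<close>

lemma positive_operator_kernel:
  fixes N :: "'e::topological_space \<Rightarrow> 'e measure"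
  assumes fin: "\<And>x. finite_measure (N x)" and sets: "\<And>x. sets (N x) = sets borel"
    and meas: "\<And>f. f \<in> bounded_borel \<Longrightarrow> (\<lambda>x. \<integral>y. f y \<partial>N x) \<in> borel_measurable borel"
    and lo: "\<And>x. exp (- A) \<le> measure (N x) UNIV" and up: "\<And>x. measure (N x) UNIV \<le> exp A"
  shows "positive_operator (\<lambda>f x. \<integral>y. f y \<partial>N x) A"
proof -
  have sp: "space (N x) = UNIV" for x using sets_eq_imp_space_eq[OF sets[of x]] by simp
  have fm: "f \<in> borel_measurable (N x)" if "f \<in> bounded_borel" for f x
    using that measurable_cong_sets[OF sets[of x] refl] by (auto simp: bounded_borel_def)
  have int: "integrable (N x) f" if f: "f \<in> bounded_borel" for f x
  proof -
    obtain C where "\<And>y. \<bar>f y\<bar> \<le> C" using f by (meson bounded_borelE)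
    then show ?thesis
      by (intro finite_measure.integrable_const_bound[OF fin, of _ C] fm[OF f]) auto
  qed
  have int': "integrable (N x) (\<lambda>_. a::real)" for x a
    by (rule finite_measure.integrable_const[OF fin])
  show ?thesis
  proof
    fix f :: "'e \<Rightarrow> real" assume f: "f \<in> bounded_borel"
    obtain C where C: "\<And>y. \<bar>f y\<bar> \<le> C" "0 < C" using f by (meson bounded_borelE)
    show "(\<lambda>x. \<integral>y. f y \<partial>N x) \<in> bounded_borel"
    proof (rule bounded_borelI[OF meas[OF f]])
      fix x
      have "\<bar>\<integral>y. f y \<partial>N x\<bar> \<le> (\<integral>y. \<bar>f y\<bar> \<partial>N x)" by (rule integral_abs_bound)
      also have "\<dots> \<le> (\<integral>y. C \<partial>N x)"
        by (intro integral_mono integrable_abs int f int' C)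
      also have "\<dots> = C * measure (N x) UNIV" by (simp add: sp)
      also have "\<dots> \<le> C * exp A" using up C by (intro mult_left_mono) auto
      finally show "\<bar>\<integral>y. f y \<partial>N x\<bar> \<le> C * exp A" .
    qed
  next
    fix fs :: "nat \<Rightarrow> 'e \<Rightarrow> real" and C f x
    assume fs: "\<And>n. fs n \<in> bounded_borel" and C: "\<And>n y. \<bar>fs n y\<bar> \<le> C"
      and lim: "\<And>y. (\<lambda>n. fs n y) \<longlonglongrightarrow> f y"
    have "f \<in> borel_measurable borel"
      by (rule borel_measurable_LIMSEQ_real[OF lim]) (use fs in \<open>auto simp: bounded_borel_def\<close>)
    then have "f \<in> borel_measurable (N x)" using measurable_cong_sets[OF sets[of x] refl] by auto
    then show "(\<lambda>n. \<integral>y. fs n y \<partial>N x) \<longlonglongrightarrow> (\<integral>y. f y \<partial>N x)"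
      by (rule integral_dominated_convergence[where w="\<lambda>_. C"]) (use C lim in \<open>auto intro: fm fs int'\<close>)
  qed (use lo up in \<open>auto simp: sp int integral_nonneg_AE\<close>)
qed

text \<open>The equations that define \<open>lambda_disc\<close> and \<open>lambda_cont\<close> take this form when \<open>S\<close> is the
  operator of the weighted chain or process over one unit of time: the constant \<open>l\<close> leaves
  the expectation as a factor.\<close>

definition eigen_rate ::
  "real \<Rightarrow> (('e::topological_space \<Rightarrow> real) \<Rightarrow> 'e \<Rightarrow> real) \<Rightarrow> real \<Rightarrow> bool" where
  "eigen_rate \<alpha> S l \<longleftrightarrow>
     (\<exists>w\<in>bounded_borel. \<forall>x. exp (\<alpha> * w x) = exp (- (\<alpha> * l)) * S (\<lambda>y. exp (\<alpha> * w y)) x)"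

context harnack_operator
begin

lemma eigen_rate_growth:
  assumes "eigen_rate \<alpha> S l"
  shows "\<bar>ln ((S ^^ n) (\<lambda>_. 1) x) - real n * (\<alpha> * l)\<bar> \<le> ln L"
proof -
  obtain w where w: "w \<in> bounded_borel"
    and e: "\<And>x. exp (\<alpha> * w x) = exp (- (\<alpha> * l)) * S (\<lambda>y. exp (\<alpha> * w y)) x"
    using assms by (auto simp: eigen_rate_def)
  have e': "S (\<lambda>y. exp (\<alpha> * w y)) x = exp (\<alpha> * l) * exp (\<alpha> * w x)" for x
    unfolding e[of x] by (simp add: exp_minus)
  show ?thesis
    using eigenvalue_growth[OF _ bounded_borel_cmult[OF w, of \<alpha>] e', of n x] by simp
qed

lemma ex1_eigen_rate:
  assumes \<alpha>: "\<alpha> \<noteq> 0"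
  shows "\<exists>!l. eigen_rate \<alpha> S l"
proof -
  obtain \<rho> w where \<rho>: "0 < \<rho>" and w: "w \<in> bounded_borel"
    and e: "\<And>x. S (\<lambda>y. exp (w y)) x = \<rho> * exp (w x)"
    using eigenfunction_exists by blast
  have "(\<lambda>x. w x / \<alpha>) \<in> bounded_borel" using bounded_borel_cmult[OF w, of "1 / \<alpha>"] by simp
  then have "eigen_rate \<alpha> S (ln \<rho> / \<alpha>)"
    unfolding eigen_rate_def using \<alpha> \<rho> e
    by (intro bexI[of _ "\<lambda>x. w x / \<alpha>"]) (auto simp: exp_minus)
  moreover have "l = l'" if "eigen_rate \<alpha> S l" "eigen_rate \<alpha> S l'" for l l'
  proof -
    have "\<alpha> * l = \<alpha> * l'"
      by (rule growth_rate_unique[OF eigen_rate_growth[OF that(1)] eigen_rate_growth[OF that(2)]])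
    then show ?thesis using \<alpha> by simp
  qed
  ultimately show ?thesis by blast
qed

end

text \<open>The bound \<open>ln L\<close> in \<open>eigen_rate_growth\<close> does not depend on \<open>n\<close>; the growth rates therefore
  converge as soon as the iterates do.\<close>

lemma eigen_rate_tendsto:
  assumes \<alpha>: "\<alpha> \<noteq> 0"
    and Ss: "\<And>n. harnack_operator (Ss n) A k L" and S: "harnack_operator S A k L"
    and conv: "op_converge Ss S"
    and l: "\<And>n. eigen_rate \<alpha> (Ss n) (l n)" "eigen_rate \<alpha> S l'"
  shows "l \<longlonglongrightarrow> l'"
proof -
  have po: "positive_operator (Ss n) A" for n using Ss by (simp add: harnack_operator_def)
  have "(\<lambda>n. \<alpha> * l n) \<longlonglongrightarrow> \<alpha> * l'"
  proof (rule growth_rate_tendsto)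
    fix x :: 'a
    show "\<bar>ln ((Ss n ^^ j) (\<lambda>_. 1) undefined) - real j * (\<alpha> * l n)\<bar> \<le> ln L" for n j
      by (rule harnack_operator.eigen_rate_growth[OF Ss l(1)])
    show "\<bar>ln ((S ^^ j) (\<lambda>_. 1) undefined) - real j * (\<alpha> * l')\<bar> \<le> ln L" for j
      by (rule harnack_operator.eigen_rate_growth[OF S l(2)])
    show "(\<lambda>n. ln ((Ss n ^^ j) (\<lambda>_. 1) undefined)) \<longlonglongrightarrow> ln ((S ^^ j) (\<lambda>_. 1) undefined)" for j
      using harnack_operator.power_one_pos[OF S, of j undefined]
      by (intro tendsto_ln op_converge_funpow_apply[OF conv po]) auto
  qed
  then have "(\<lambda>n. 1 / \<alpha> * (\<alpha> * l n)) \<longlonglongrightarrow> 1 / \<alpha> * (\<alpha> * l')" by (rule tendsto_mult_left)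
  then show ?thesis using \<alpha> by simp
qed

lemma Liminf_linear_growth:
  assumes \<alpha>: "\<alpha> \<noteq> 0" and F: "F \<noteq> bot" and \<tau>: "filterlim \<tau> at_top F"
    and D: "eventually (\<lambda>i. \<bar>a i - \<tau> i * (\<alpha> * l)\<bar> \<le> D) F"
  shows "Liminf F (\<lambda>i. ereal (1 / \<alpha> * (1 / \<tau> i) * a i)) = ereal l"
proof -
  have pos: "eventually (\<lambda>i. 0 < \<tau> i) F" using \<tau> by (simp add: filterlim_at_top_dense)
  have "((\<lambda>i. \<bar>D / \<alpha>\<bar> / \<tau> i) \<longlongrightarrow> 0) F"
    by (rule real_tendsto_divide_at_top[OF tendsto_const \<tau>])
  then have "((\<lambda>i. 1 / \<alpha> * (1 / \<tau> i) * a i - l) \<longlongrightarrow> 0) F"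
  proof (rule Lim_null_comparison[rotated])
    show "eventually (\<lambda>i. norm (1 / \<alpha> * (1 / \<tau> i) * a i - l) \<le> \<bar>D / \<alpha>\<bar> / \<tau> i) F"
      using pos D
    proof eventually_elim
      case (elim i)
      have "1 / \<alpha> * (1 / \<tau> i) * a i - l = (a i - \<tau> i * (\<alpha> * l)) / (\<alpha> * \<tau> i)"
        using \<alpha> elim(1) by (simp add: field_simps)
      then have "norm (1 / \<alpha> * (1 / \<tau> i) * a i - l) = \<bar>a i - \<tau> i * (\<alpha> * l)\<bar> / (\<bar>\<alpha>\<bar> * \<tau> i)"
        using elim(1) by (simp add: abs_mult)
      also have "\<dots> \<le> \<bar>D\<bar> / (\<bar>\<alpha>\<bar> * \<tau> i)"
        using elim \<alpha> by (intro divide_right_mono) auto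
      also have "\<dots> = \<bar>D / \<alpha>\<bar> / \<tau> i" by simp
      finally show ?case .
    qed
  qed
  then have "((\<lambda>i. 1 / \<alpha> * (1 / \<tau> i) * a i) \<longlongrightarrow> l) F" by (simp add: LIM_zero_iff)
  then show ?thesis by (intro lim_imp_Liminf F) simp
qed

lemma abs_ln_diff_le:
  fixes p q :: real
  assumes "0 < q" "exp (- A) * q \<le> p" "p \<le> exp A * q"
  shows "\<bar>ln p - ln q\<bar> \<le> A"
proof -
  have p: "0 < p" using assms(1,2) by (meson exp_gt_zero less_le_trans mult_pos_pos)
  have "ln (exp (- A) * q) \<le> ln p" using assms p by simp
  moreover have "ln p \<le> ln (exp A * q)" using assms p by simp
  ultimately show ?thesis using assms(1) by (simp add: ln_mult abs_le_iff)
qed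

section \<open>The Markov property for bounded functions\<close>

lemma space_natural_filtration [simp]: "space (natural_filtration T M X s) = space M"
  by (simp add: natural_filtration_def space_measure_of_conv)

lemma sets_natural_filtration:
  "sets (natural_filtration T M X s) =
     sigma_sets (space M) {X r -` A \<inter> space M |r A. r \<in> T \<and> r \<le> s \<and> A \<in> sets borel}"
  unfolding natural_filtration_def by (rule sets_measure_of) auto

lemma subalgebra_natural_filtration:
  assumes "\<And>t. t \<in> T \<Longrightarrow> X t \<in> measurable M borel"
  shows "subalgebra M (natural_filtration T M X s)"
  unfolding subalgebra_def sets_natural_filtration using assms
  by (auto intro!: sets.sigma_sets_subset)

lemma measurable_natural_filtration:
  assumes "r \<in> T" "r \<le> s"
  shows "X r \<in> measurable (natural_filtration T M X s) borel"
  by (rule measurableI) (use assms in \<open>auto simp: sets_natural_filtration\<close>)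

lemma natural_filtration_mono:
  assumes "s \<le> t"
  shows "measurable (natural_filtration T M X s) N \<subseteq> measurable (natural_filtration T M X t) N"
  using assms by (intro measurable_mono)
    (auto simp: sets_natural_filtration intro!: sigma_sets_mono', blast intro: order_trans)

text \<open>Against a nonnegative weight \<open>Z\<close> from the past, both sides are integrals of \<open>f\<close> against
  finite measures, and the defining property says that these measures agree on every Borel set.\<close>

lemma markov_process_from_integral_nonneg:
  assumes mp: "markov_process_from T P x M X" and T: "s \<in> T" "t \<in> T" "s + t \<in> T"
    and P: "P t \<in> measurable borel (prob_algebra borel)"
    and Z: "Z \<in> borel_measurable (natural_filtration T M X s)"
    and C: "\<And>\<omega>. 0 \<le> Z \<omega>" "\<And>\<omega>. Z \<omega> \<le> C" and f: "f \<in> bounded_borel"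
  shows "(\<integral>\<omega>. Z \<omega> * f (X (s + t) \<omega>) \<partial>M) = (\<integral>\<omega>. Z \<omega> * (\<integral>y. f y \<partial>P t (X s \<omega>)) \<partial>M)"
proof -
  interpret prob_space M using mp by (simp add: markov_process_from_def)
  have X: "X r \<in> measurable M borel" if "r \<in> T" for r
    using mp that by (simp add: markov_process_from_def)
  have [measurable]: "X s \<in> measurable M borel" "X (s + t) \<in> measurable M borel"
    using X T by auto
  define F where "F = natural_filtration T M X s"
  have sub: "subalgebra M F" unfolding F_def using X by (rule subalgebra_natural_filtration)
  interpret S: finite_measure_subalgebra M F by unfold_locales (rule sub)
  have ZF: "Z \<in> borel_measurable F" using Z by (simp add: F_def)
  then have [measurable]: "Z \<in> borel_measurable M" by (rule measurable_from_subalg[OF sub])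
  have P'[measurable]: "P t \<in> measurable borel (subprob_algebra borel)"
    by (rule measurable_prob_algebraD[OF P])
  have Pp: "prob_space (P t y)" "sets (P t y) = sets borel" for y
    using measurable_space[OF P, of y] by (auto simp: space_prob_algebra)
  have intZ: "integrable M (\<lambda>\<omega>. Z \<omega> * g \<omega>)" if [measurable]: "g \<in> borel_measurable M"
    and "\<And>\<omega>. \<bar>g \<omega>\<bar> \<le> D" for g D
  proof (rule integrable_const_bound[of _ "C * D"])
    show "AE \<omega> in M. norm (Z \<omega> * g \<omega>) \<le> C * D"
      using C that(2) by (auto simp: abs_mult intro!: mult_mono intro: order_trans[OF C(1) C(2)])
  qed simp
  have base: "(\<integral>\<omega>. Z \<omega> * indicator B (X (s + t) \<omega>) \<partial>M) = (\<integral>\<omega>. Z \<omega> * measure (P t (X s \<omega>)) B \<partial>M)"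
    if B[measurable]: "B \<in> sets borel" for B
  proof -
    have "(\<integral>\<omega>. Z \<omega> * indicator B (X (s + t) \<omega>) \<partial>M)
        = (\<integral>\<omega>. Z \<omega> * real_cond_exp M F (\<lambda>\<omega>'. indicator B (X (s + t) \<omega>')) \<omega> \<partial>M)"
      by (rule S.real_cond_exp_intg(2)[symmetric, OF _ ZF])
        (auto intro!: intZ[of _ 1] simp: indicator_def)
    also have "\<dots> = (\<integral>\<omega>. Z \<omega> * measure (P t (X s \<omega>)) B \<partial>M)"
    proof (rule integral_cong_AE)
      have "AE \<omega> in M. real_cond_exp M F (\<lambda>\<omega>'. indicator B (X (s + t) \<omega>')) \<omega> = measure (P t (X s \<omega>)) B"
        using mp T B by (simp add: markov_process_from_def F_def)
      then show "AE \<omega> in M. Z \<omega> * real_cond_exp M F (\<lambda>\<omega>'. indicator B (X (s + t) \<omega>')) \<omega>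
          = Z \<omega> * measure (P t (X s \<omega>)) B" by eventually_elim simp
    qed measurable
    finally show ?thesis .
  qed
  define \<mu> where "\<mu> = density M (\<lambda>\<omega>. ennreal (Z \<omega>))"
  have [measurable_cong]: "sets \<mu> = sets M" by (simp add: \<mu>_def)
  have \<mu>_fin: "finite_measure \<mu>"
  proof (rule finite_measureI)
    have "emeasure \<mu> (space \<mu>) = (\<integral>\<^sup>+\<omega>. ennreal (Z \<omega>) \<partial>M)"
      by (simp add: \<mu>_def emeasure_density cong: nn_integral_cong)
    also have "\<dots> \<le> (\<integral>\<^sup>+\<omega>. ennreal C \<partial>M)"
      using C by (intro nn_integral_mono) (auto intro: ennreal_leI)
    finally show "emeasure \<mu> (space \<mu>) \<noteq> \<infinity>" by (auto simp: emeasure_space_1 top_unique)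
  qed
  have \<mu>_int: "(\<integral>\<omega>. g \<omega> \<partial>\<mu>) = (\<integral>\<omega>. Z \<omega> * g \<omega> \<partial>M)" if "g \<in> borel_measurable M" for g :: "'c \<Rightarrow> real"
    unfolding \<mu>_def using that C(1) by (subst integral_density) auto
  define \<mu>1 where "\<mu>1 = distr \<mu> borel (X (s + t))"
  define \<mu>2 where "\<mu>2 = bind (distr \<mu> borel (X s)) (P t)"
  have sne: "space (distr \<mu> borel (X s)) \<noteq> {}" by simp
  have Psub: "P t \<in> measurable (distr \<mu> borel (X s)) (subprob_algebra borel)" by simp
  have "\<mu>1 = \<mu>2"
  proof (rule measure_eqI)
    show "sets \<mu>1 = sets \<mu>2"
      unfolding \<mu>1_def \<mu>2_def using sets_bind[OF sets_kernel[OF Psub] sne] by simp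
  next
    fix B assume "B \<in> sets \<mu>1"
    then have B[measurable]: "B \<in> sets borel" by (simp add: \<mu>1_def)
    have "emeasure \<mu>1 B = (\<integral>\<^sup>+\<omega>. indicator B (X (s + t) \<omega>) \<partial>\<mu>)"
      unfolding \<mu>1_def
      by (subst emeasure_distr) (auto simp: nn_integral_indicator[symmetric] simp del: nn_integral_indicator intro!: nn_integral_cong split: split_indicator)
    also have "\<dots> = (\<integral>\<^sup>+\<omega>. ennreal (Z \<omega> * indicator B (X (s + t) \<omega>)) \<partial>M)"
      unfolding \<mu>_def by (subst nn_integral_density) (auto intro!: nn_integral_cong split: split_indicator)
    also have "\<dots> = ennreal (\<integral>\<omega>. Z \<omega> * indicator B (X (s + t) \<omega>) \<partial>M)"
      using C by (intro nn_integral_eq_integral intZ[of _ 1]) (auto simp: indicator_def)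
    also have "\<dots> = ennreal (\<integral>\<omega>. Z \<omega> * measure (P t (X s \<omega>)) B \<partial>M)" by (simp only: base[OF B])
    also have "\<dots> = (\<integral>\<^sup>+\<omega>. ennreal (Z \<omega> * measure (P t (X s \<omega>)) B) \<partial>M)"
      using C Pp by (intro nn_integral_eq_integral[symmetric] intZ[of _ 1]) (auto simp: prob_space.prob_le_1)
    also have "\<dots> = (\<integral>\<^sup>+\<omega>. emeasure (P t (X s \<omega>)) B \<partial>\<mu>)"
      unfolding \<mu>_def using C Pp
      by (subst nn_integral_density)
        (auto intro!: nn_integral_cong simp: ennreal_mult finite_measure.emeasure_eq_measure prob_space.finite_measure)
    also have "\<dots> = emeasure \<mu>2 B"
      unfolding \<mu>2_def by (subst emeasure_bind[OF sne Psub B]) (simp add: nn_integral_distr)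
    finally show "emeasure \<mu>1 B = emeasure \<mu>2 B" .
  qed
  obtain D where D: "\<And>y. \<bar>f y\<bar> \<le> D" using f by (meson bounded_borelE)
  have [measurable]: "f \<in> borel_measurable borel" using f by (simp add: bounded_borel_def)
  have "(\<integral>\<omega>. Z \<omega> * f (X (s + t) \<omega>) \<partial>M) = (\<integral>y. f y \<partial>\<mu>1)"
    unfolding \<mu>1_def by (subst integral_distr) (auto simp: \<mu>_int)
  also have "\<dots> = (\<integral>y. \<integral>z. f z \<partial>P t y \<partial>distr \<mu> borel (X s))"
    unfolding \<open>\<mu>1 = \<mu>2\<close> \<mu>2_def
  proof (rule integral_bind[where K=borel and B=D and B'=1])
    show "finite_measure (distr \<mu> borel (X s))"
      by (rule finite_measure.finite_measure_distr[OF \<mu>_fin]) simp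
  qed (use D Pp in \<open>auto simp: prob_space.emeasure_space_1\<close>)
  also have "\<dots> = (\<integral>\<omega>. (\<integral>z. f z \<partial>P t (X s \<omega>)) \<partial>\<mu>)"
    by (rule integral_distr) measurable
  also have "\<dots> = (\<integral>\<omega>. Z \<omega> * (\<integral>y. f y \<partial>P t (X s \<omega>)) \<partial>M)" by (rule \<mu>_int) measurable
  finally show ?thesis .
qed

lemma prob_kernel_integral_bounded_borel:
  assumes P: "P \<in> measurable borel (prob_algebra borel)" and f: "f \<in> bounded_borel"
    and C: "\<And>y. \<bar>f y\<bar> \<le> C"
  shows "(\<lambda>x. \<integral>y. f y \<partial>P x) \<in> bounded_borel" "\<bar>\<integral>y. f y \<partial>P x\<bar> \<le> C"
proof -
  have [measurable]: "f \<in> borel_measurable borel" using f by (simp add: bounded_borel_def)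
  have [measurable]: "P \<in> measurable borel (subprob_algebra borel)" by (rule measurable_prob_algebraD[OF P])
  have b: "\<bar>\<integral>y. f y \<partial>P x\<bar> \<le> C" for x
  proof -
    interpret prob_space "P x" using measurable_space[OF P, of x] by (simp add: space_prob_algebra)
    have sP: "sets (P x) = sets borel" using measurable_space[OF P, of x] by (simp add: space_prob_algebra)
    have [measurable]: "f \<in> borel_measurable (P x)" using measurable_cong_sets[OF sP refl] by auto
    have "\<bar>\<integral>y. f y \<partial>P x\<bar> \<le> (\<integral>y. \<bar>f y\<bar> \<partial>P x)" by (rule integral_abs_bound)
    also have "\<dots> \<le> (\<integral>y. C \<partial>P x)"
      using C by (intro integral_mono integrable_abs integrable_const integrable_const_bound[of f C]) auto
    also have "\<dots> = C" by (simp add: prob_space)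
    finally show ?thesis .
  qed
  then show "\<bar>\<integral>y. f y \<partial>P x\<bar> \<le> C" .
  show "(\<lambda>x. \<integral>y. f y \<partial>P x) \<in> bounded_borel" by (rule bounded_borelI[OF _ b]) measurable
qed

lemma markov_process_from_integral:
  assumes mp: "markov_process_from T P x M X" and T: "s \<in> T" "t \<in> T" "s + t \<in> T"
    and P: "P t \<in> measurable borel (prob_algebra borel)"
    and Z: "Z \<in> borel_measurable (natural_filtration T M X s)"
    and C: "\<And>\<omega>. \<bar>Z \<omega>\<bar> \<le> C" and f: "f \<in> bounded_borel"
  shows "(\<integral>\<omega>. Z \<omega> * f (X (s + t) \<omega>) \<partial>M) = (\<integral>\<omega>. Z \<omega> * (\<integral>y. f y \<partial>P t (X s \<omega>)) \<partial>M)"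
proof -
  interpret prob_space M using mp by (simp add: markov_process_from_def)
  have X: "X r \<in> measurable M borel" if "r \<in> T" for r
    using mp that by (simp add: markov_process_from_def)
  have [measurable]: "X s \<in> measurable M borel" "X (s + t) \<in> measurable M borel"
    using X T by auto
  have Z'[measurable]: "Z \<in> borel_measurable M"
    by (rule measurable_from_subalg[OF subalgebra_natural_filtration Z]) (rule X)
  obtain D where D: "\<And>y. \<bar>f y\<bar> \<le> D" using f by (meson bounded_borelE)
  have [measurable]: "f \<in> borel_measurable borel" using f by (simp add: bounded_borel_def)
  note Pf = prob_kernel_integral_bounded_borel[OF P f D]
  then have [measurable]: "(\<lambda>x. \<integral>y. f y \<partial>P t x) \<in> borel_measurable borel"
    by (simp add: bounded_borel_def)
  have int: "integrable M (\<lambda>\<omega>. Y \<omega> * g \<omega>)" if [measurable]: "Y \<in> borel_measurable M" "g \<in> borel_measurable M"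
    and "\<And>\<omega>. \<bar>Y \<omega>\<bar> \<le> 2 * C" "\<And>\<omega>. \<bar>g \<omega>\<bar> \<le> D" for Y g
  proof (rule integrable_const_bound[of _ "2 * C * D"])
    show "AE \<omega> in M. norm (Y \<omega> * g \<omega>) \<le> 2 * C * D"
      using that(3,4) C[of undefined] by (auto simp: abs_mult intro!: mult_mono)
  qed simp
  have C0: "0 \<le> C" using C[of undefined] by linarith
  \<comment> \<open>a bounded \<open>Z\<close> is the difference of the nonnegative weights \<open>Z + C\<close> and \<open>C\<close>\<close>
  have Zb: "\<bar>Z \<omega> + C\<bar> \<le> 2 * C" "\<bar>C\<bar> \<le> 2 * C" "0 \<le> Z \<omega> + C" "Z \<omega> + C \<le> 2 * C" for \<omega>
    using C[of \<omega>] C0 by auto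
  have split: "(\<integral>\<omega>. Z \<omega> * g \<omega> \<partial>M) = (\<integral>\<omega>. (Z \<omega> + C) * g \<omega> \<partial>M) - (\<integral>\<omega>. C * g \<omega> \<partial>M)"
    if [measurable]: "g \<in> borel_measurable M" and "\<And>\<omega>. \<bar>g \<omega>\<bar> \<le> D" for g
  proof -
    have "integrable M (\<lambda>\<omega>. (Z \<omega> + C) * g \<omega>)" "integrable M (\<lambda>\<omega>. C * g \<omega>)"
      using Zb that by (intro int; simp)+
    then have "(\<integral>\<omega>. (Z \<omega> + C) * g \<omega> \<partial>M) - (\<integral>\<omega>. C * g \<omega> \<partial>M)
        = (\<integral>\<omega>. (Z \<omega> + C) * g \<omega> - C * g \<omega> \<partial>M)"
      by (rule Bochner_Integration.integral_diff[symmetric])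
    then show ?thesis by (simp add: algebra_simps)
  qed
  have 1: "(\<integral>\<omega>. (Z \<omega> + C) * f (X (s + t) \<omega>) \<partial>M) = (\<integral>\<omega>. (Z \<omega> + C) * (\<integral>y. f y \<partial>P t (X s \<omega>)) \<partial>M)"
    using Z Zb by (intro markov_process_from_integral_nonneg[OF mp T P _ _ _ f, where C="2 * C"]) auto
  have 2: "(\<integral>\<omega>. C * f (X (s + t) \<omega>) \<partial>M) = (\<integral>\<omega>. C * (\<integral>y. f y \<partial>P t (X s \<omega>)) \<partial>M)"
    using Zb C0 by (intro markov_process_from_integral_nonneg[OF mp T P _ _ _ f, where C="2 * C"]) auto
  show ?thesis
    using split[of "\<lambda>\<omega>. f (X (s + t) \<omega>)"] split[of "\<lambda>\<omega>. \<integral>y. f y \<partial>P t (X s \<omega>)"] D Pf(2) 1 2 by simp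
qed

lemma markov_process_from_start:
  assumes mp: "markov_process_from T P x M X" and 0: "0 \<in> T" and f: "f \<in> bounded_borel"
  shows "(\<integral>\<omega>. f (X 0 \<omega>) \<partial>M) = f x"
proof -
  interpret prob_space M using mp by (simp add: markov_process_from_def)
  have [measurable]: "X 0 \<in> measurable M borel" using mp 0 by (simp add: markov_process_from_def)
  have [measurable]: "f \<in> borel_measurable borel" using f by (simp add: bounded_borel_def)
  have "AE \<omega> in M. X 0 \<omega> = x" using mp by (simp add: markov_process_from_def)
  then have "(\<integral>\<omega>. f (X 0 \<omega>) \<partial>M) = (\<integral>\<omega>. f x \<partial>M)" by (intro integral_cong_AE) auto
  then show ?thesis by (simp add: prob_space)
qed

section \<open>Weighted chains\<close>

text \<open>The weight of a step is determined by its starting point, so it stands in front of the integral.\<close>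

definition weighted_step ::
  "real \<Rightarrow> ('e::topological_space \<Rightarrow> real) \<Rightarrow> ('e \<Rightarrow> 'e measure) \<Rightarrow> ('e \<Rightarrow> real) \<Rightarrow> 'e \<Rightarrow> real" where
  "weighted_step h b \<kappa> f x = exp (h * b x) * (\<integral>y. f y \<partial>\<kappa> x)"

lemma prob_algebraD:
  assumes "\<kappa> \<in> measurable borel (prob_algebra borel)"
  shows "prob_space (\<kappa> x)" "sets (\<kappa> x) = sets borel" "\<kappa> \<in> measurable borel (subprob_algebra borel)"
    "space (\<kappa> x) = space borel"
  using measurable_space[OF assms, of x] measurable_prob_algebraD[OF assms]
  by (auto simp: space_prob_algebra dest: sets_eq_imp_space_eq)

lemma positive_operator_prob_kernel:
  assumes \<kappa>: "\<kappa> \<in> measurable borel (prob_algebra borel)"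
  shows "positive_operator (\<lambda>f x. \<integral>y. f y \<partial>\<kappa> x) 0"
proof (rule positive_operator_kernel)
  note [measurable] = prob_algebraD(3)[OF \<kappa>]
  show "finite_measure (\<kappa> x)" for x by (rule prob_space.finite_measure[OF prob_algebraD(1)[OF \<kappa>]])
  have "measure (\<kappa> x) UNIV = 1" for x
    using prob_space.prob_space[OF prob_algebraD(1)[OF \<kappa>, of x]] prob_algebraD(4)[OF \<kappa>, of x] by simp
  then show "exp (- 0) \<le> measure (\<kappa> x) UNIV" "measure (\<kappa> x) UNIV \<le> exp 0" for x by simp_all
qed (use prob_algebraD[OF \<kappa>] prob_kernel_integral_bounded_borel[OF \<kappa>] in
      \<open>auto elim!: bounded_borelE intro: bounded_borel_measurable\<close>)

lemma exp_weight_bounds: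
  fixes h A t :: real
  assumes "0 \<le> h" "\<bar>t\<bar> \<le> A"
  shows "exp (- (h * A)) \<le> exp (h * t)" "exp (h * t) \<le> exp (h * A)"
  using mult_left_mono[of "- A" t h] mult_left_mono[of t A h] assms by (auto simp: abs_le_iff)

lemma positive_operator_weighted_step:
  fixes \<kappa> :: "'e::topological_space \<Rightarrow> 'e measure"
  assumes \<kappa>: "\<kappa> \<in> measurable borel (prob_algebra borel)" and h: "0 \<le> h"
    and b: "b \<in> bounded_borel" and A: "\<And>x. \<bar>b x\<bar> \<le> A"
  shows "positive_operator (weighted_step h b \<kappa>) (h * A)"
proof -
  interpret K: positive_operator "\<lambda>f x. \<integral>y. f y \<partial>\<kappa> x" 0 by (rule positive_operator_prob_kernel[OF \<kappa>])
  have e: "exp (- (h * A)) \<le> exp (h * b x)" "exp (h * b x) \<le> exp (h * A)" for x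
    using exp_weight_bounds[OF h A[of x]] by auto
  have one: "(\<integral>y. 1 \<partial>\<kappa> x) = (1::real)" for x
    using K.one_lower[of x] K.one_upper[of x] by simp
  show ?thesis unfolding weighted_step_def[abs_def]
  proof
    fix f g :: "'e \<Rightarrow> real" and p q :: real and x assume fg: "f \<in> bounded_borel" "g \<in> bounded_borel"
    show "exp (h * b x) * (\<integral>y. p * f y + q * g y \<partial>\<kappa> x)
        = p * (exp (h * b x) * (\<integral>y. f y \<partial>\<kappa> x)) + q * (exp (h * b x) * (\<integral>y. g y \<partial>\<kappa> x))"
      using K.lin[OF fg, where p=p and q=q and x=x] by (simp add: algebra_simps)
  next
    show "exp (- (h * A)) \<le> exp (h * b x) * (\<integral>y. 1 \<partial>\<kappa> x)" for x unfolding one using e by simp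
    show "exp (h * b x) * (\<integral>y. 1 \<partial>\<kappa> x) \<le> exp (h * A)" for x unfolding one using e by simp
  qed (auto intro!: bounded_borel_mult bounded_borel_exp b K.closed mult_nonneg_nonneg K.pos
      tendsto_mult_left K.cont)
qed

lemma kernel_power_measurable:
  assumes \<kappa>: "\<kappa> \<in> measurable borel (prob_algebra borel)"
  shows "kernel_power \<kappa> n \<in> measurable borel (prob_algebra borel)"
proof (induction n)
  case 0
  have "kernel_power \<kappa> 0 = return borel" by (auto simp: fun_eq_iff)
  then show ?case by simp
next
  case (Suc n)
  have "kernel_power \<kappa> (Suc n) = (\<lambda>x. \<kappa> x \<bind> kernel_power \<kappa> n)" by (auto simp: fun_eq_iff)
  then show ?case using measurable_bind_prob_space[OF \<kappa> Suc] by simp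
qed

lemma integral_kernel_power_Suc:
  assumes \<kappa>: "\<kappa> \<in> measurable borel (prob_algebra borel)" and f: "f \<in> bounded_borel"
  shows "(\<integral>y. f y \<partial>kernel_power \<kappa> (Suc n) x) = (\<integral>y. \<integral>z. f z \<partial>kernel_power \<kappa> n y \<partial>\<kappa> x)"
proof -
  obtain D where D: "\<And>y. \<bar>f y\<bar> \<le> D" using f by (meson bounded_borelE)
  note K = prob_algebraD[OF kernel_power_measurable[OF \<kappa>, of n]]
  have "f \<in> borel_measurable borel" using f by (simp add: bounded_borel_def)
  moreover have "kernel_power \<kappa> n \<in> measurable (\<kappa> x) (subprob_algebra borel)"
    using K(3) measurable_cong_sets[OF prob_algebraD(2)[OF \<kappa>, of x] refl] by auto
  ultimately show ?thesis unfolding kernel_power.simps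
    using D K(1) prob_space.finite_measure[OF prob_algebraD(1)[OF \<kappa>]]
    by (intro integral_bind[where K=borel and B=D and B'=1]) (auto simp: prob_space.emeasure_space_1)
qed

lemma kernel_power_Suc_0:
  assumes \<kappa>: "\<kappa> \<in> measurable borel (prob_algebra borel)"
  shows "kernel_power \<kappa> (Suc 0) x = \<kappa> x"
proof -
  have "kernel_power \<kappa> 0 = return (\<kappa> x)"
    by (rule ext) (simp add: return_cong[OF prob_algebraD(2)[OF \<kappa>]])
  then show ?thesis using bind_return''[of "\<kappa> x" "\<kappa> x"] by simp
qed

text \<open>The weights of the steps \<open>0, \<dots>, n\<close> all belong to the past of time \<open>n\<close>, so conditioning on it
  replaces \<open>f (Y (n + 1))\<close> by its one-step mean and absorbs the last weight into one more
  application of the operator.\<close>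

lemma chain_expectation:
  assumes mp: "markov_process_from UNIV (kernel_power \<kappa>) x M Y"
    and \<kappa>: "\<kappa> \<in> measurable borel (prob_algebra borel)" and h: "0 \<le> h"
    and b: "b \<in> bounded_borel" and f: "f \<in> bounded_borel"
  shows "(\<integral>\<omega>. exp (\<Sum>i<n. h * b (Y i \<omega>)) * f (Y n \<omega>) \<partial>M) = (weighted_step h b \<kappa> ^^ n) f x"
  using f
proof (induction n arbitrary: f)
  case 0
  then show ?case using markov_process_from_start[OF mp] by simp
next
  case (Suc n)
  obtain A where A: "\<And>y. \<bar>b y\<bar> \<le> A" using b by (meson bounded_borelE)
  interpret T: positive_operator "weighted_step h b \<kappa>" "h * A"
    by (rule positive_operator_weighted_step[OF \<kappa> h b A])
  have [measurable]: "b \<in> borel_measurable borel" using b by (simp add: bounded_borel_def)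
  define Z where "Z \<omega> = exp (\<Sum>i<Suc n. h * b (Y i \<omega>))" for \<omega>
  have "Z \<in> borel_measurable (natural_filtration UNIV M Y n)"
  proof -
    have [measurable]: "Y i \<in> measurable (natural_filtration UNIV M Y n) borel" if "i < Suc n" for i
      using that by (intro measurable_natural_filtration) auto
    show ?thesis unfolding Z_def by measurable
  qed
  moreover have "\<bar>Z \<omega>\<bar> \<le> exp (\<Sum>i<Suc n. h * A)" for \<omega>
  proof -
    have "(\<Sum>i<Suc n. h * b (Y i \<omega>)) \<le> (\<Sum>i<Suc n. h * A)"
      using A h by (intro sum_mono mult_left_mono) (auto simp: abs_le_iff)
    then show ?thesis unfolding Z_def by simp
  qed
  ultimately have "(\<integral>\<omega>. Z \<omega> * f (Y (n + 1) \<omega>) \<partial>M) = (\<integral>\<omega>. Z \<omega> * (\<integral>y. f y \<partial>kernel_power \<kappa> 1 (Y n \<omega>)) \<partial>M)"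
    by (intro markov_process_from_integral[OF mp _ _ _ kernel_power_measurable[OF \<kappa>] _ _ Suc.prems]) auto
  also have "\<dots> = (\<integral>\<omega>. exp (\<Sum>i<n. h * b (Y i \<omega>)) * weighted_step h b \<kappa> f (Y n \<omega>) \<partial>M)"
    by (rule Bochner_Integration.integral_cong)
      (auto simp: Z_def exp_add weighted_step_def kernel_power_Suc_0[OF \<kappa>] simp del: kernel_power.simps)
  also have "\<dots> = (weighted_step h b \<kappa> ^^ n) (weighted_step h b \<kappa> f) x"
    by (rule Suc.IH[OF T.closed[OF Suc.prems]])
  finally show ?case by (simp add: Z_def funpow_swap1)
qed

lemma weighted_step_power_bounds:
  assumes \<kappa>: "\<kappa> \<in> measurable borel (prob_algebra borel)" and h: "0 \<le> h"
    and b: "b \<in> bounded_borel" and A: "\<And>x. \<bar>b x\<bar> \<le> A"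
    and f: "f \<in> bounded_borel" "\<And>x. 0 \<le> f x"
  shows "(weighted_step h b \<kappa> ^^ n) f x \<le> exp (real n * (h * A)) * (\<integral>y. f y \<partial>kernel_power \<kappa> n x)"
    and "exp (- (real n * (h * A))) * (\<integral>y. f y \<partial>kernel_power \<kappa> n x) \<le> (weighted_step h b \<kappa> ^^ n) f x"
proof -
  interpret K: positive_operator "\<lambda>f x. \<integral>y. f y \<partial>\<kappa> x" 0 by (rule positive_operator_prob_kernel[OF \<kappa>])
  have e: "exp (- (h * A)) \<le> exp (h * b x)" "exp (h * b x) \<le> exp (h * A)" for x
    using exp_weight_bounds[OF h A[of x]] by auto
  let ?T = "weighted_step h b \<kappa>"
  let ?k = "\<lambda>n x. \<integral>y. f y \<partial>kernel_power \<kappa> n x"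
  have Tcl: "(?T ^^ n) f \<in> bounded_borel" for n
    by (rule positive_operator.closed[OF positive_operator.positive_operator_funpow[OF
          positive_operator_weighted_step[OF \<kappa> h b A]] f(1)])
  obtain D where D: "\<And>y. \<bar>f y\<bar> \<le> D" using f by (meson bounded_borelE)
  have kcl: "?k n \<in> bounded_borel" for n
    by (rule prob_kernel_integral_bounded_borel[OF kernel_power_measurable[OF \<kappa>] f(1) D])
  have k0: "0 \<le> ?k n x" for n x using f(2) by (intro integral_nonneg_AE) auto
  have "(?T ^^ n) f x \<le> exp (real n * (h * A)) * ?k n x \<and>
     exp (- (real n * (h * A))) * ?k n x \<le> (?T ^^ n) f x"
  proof (induction n arbitrary: x)
    case 0
    have "f \<in> borel_measurable borel" using f by (simp add: bounded_borel_def)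
    then have "?k 0 x = f x" by (simp add: integral_return)
    then show ?case by simp
  next
    case (Suc n)
    have T: "(?T ^^ Suc n) f x = exp (h * b x) * (\<integral>y. (?T ^^ n) f y \<partial>\<kappa> x)"
      by (simp add: weighted_step_def)
    have k: "?k (Suc n) x = (\<integral>y. ?k n y \<partial>\<kappa> x)" by (rule integral_kernel_power_Suc[OF \<kappa> f(1)])
    have kk: "0 \<le> (\<integral>y. ?k n y \<partial>\<kappa> x)" by (intro integral_nonneg_AE) (simp add: k0)
    have "(\<integral>y. (?T ^^ n) f y \<partial>\<kappa> x) \<le> (\<integral>y. exp (real n * (h * A)) * ?k n y \<partial>\<kappa> x)"
      using Suc by (intro K.mono Tcl bounded_borel_cmult kcl) auto
    also have "\<dots> = exp (real n * (h * A)) * (\<integral>y. ?k n y \<partial>\<kappa> x)" by simp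
    finally have "(?T ^^ Suc n) f x \<le> exp (h * A) * (exp (real n * (h * A)) * (\<integral>y. ?k n y \<partial>\<kappa> x))"
      unfolding T using e(2)[of x] kk f(2)
      by (intro mult_mono) (auto intro!: integral_nonneg_AE Tcl
         positive_operator.pos[OF positive_operator.positive_operator_funpow[OF
          positive_operator_weighted_step[OF \<kappa> h b A]] f(1)])
    moreover have "exp (- (real n * (h * A))) * (\<integral>y. ?k n y \<partial>\<kappa> x)
        = (\<integral>y. exp (- (real n * (h * A))) * ?k n y \<partial>\<kappa> x)" by simp
    moreover have "\<dots> \<le> (\<integral>y. (?T ^^ n) f y \<partial>\<kappa> x)"
      using Suc by (intro K.mono Tcl bounded_borel_cmult kcl) auto
    ultimately have "exp (- (h * A)) * (exp (- (real n * (h * A))) * (\<integral>y. ?k n y \<partial>\<kappa> x)) \<le> (?T ^^ Suc n) f x"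
      unfolding T using e(1)[of x] kk by (intro mult_mono) auto
    moreover have "exp (real (Suc n) * (h * A)) = exp (h * A) * exp (real n * (h * A))"
      "exp (- (real (Suc n) * (h * A))) = exp (- (h * A)) * exp (- (real n * (h * A)))"
      unfolding exp_add[symmetric] by (simp_all add: algebra_simps)
    ultimately show ?case
      using \<open>(?T ^^ Suc n) f x \<le> _\<close> unfolding k by (simp only: mult.assoc)
  qed
  then show "(?T ^^ n) f x \<le> exp (real n * (h * A)) * ?k n x"
    "exp (- (real n * (h * A))) * ?k n x \<le> (?T ^^ n) f x" by auto
qed

lemma integral_le_of_emeasure_le:
  assumes \<mu>: "finite_measure \<mu>" "sets \<mu> = sets borel" and \<nu>: "finite_measure \<nu>" "sets \<nu> = sets borel"
    and le: "\<And>B. B \<in> sets borel \<Longrightarrow> emeasure \<mu> B \<le> ennreal K * emeasure \<nu> B" and K: "0 \<le> K"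
    and f: "f \<in> bounded_borel" "\<And>x. 0 \<le> f x"
  shows "(\<integral>x. f x \<partial>\<mu>) \<le> K * (\<integral>x. f x \<partial>\<nu>)"
proof -
  obtain D where D: "\<And>y. \<bar>f y\<bar> \<le> D" using f by (meson bounded_borelE)
  have int: "integrable N f" if "finite_measure N" "sets N = sets borel" for N
  proof -
    have "f \<in> borel_measurable N" using f(1) by (simp add: bounded_borel_def that(2) cong: measurable_cong_sets)
    then show ?thesis using D by (intro finite_measure.integrable_const_bound[OF that(1), of _ D]) auto
  qed
  have "\<mu> \<le> scale_measure (ennreal K) \<nu>"
    using \<mu>(2) \<nu>(2) le by (subst le_measure) auto
  then have "(\<integral>\<^sup>+x. ennreal (f x) \<partial>\<mu>) \<le> (\<integral>\<^sup>+x. ennreal (f x) \<partial>scale_measure (ennreal K) \<nu>)"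
    using \<mu>(2) \<nu>(2) by (intro nn_integral_mono_measure) auto
  also have "\<dots> = ennreal K * (\<integral>\<^sup>+x. ennreal (f x) \<partial>\<nu>)"
    using f(1) \<nu>(2) by (intro nn_integral_scale_measure) (auto simp: bounded_borel_def cong: measurable_cong_sets)
  finally have "ennreal (\<integral>x. f x \<partial>\<mu>) \<le> ennreal K * ennreal (\<integral>x. f x \<partial>\<nu>)"
    using f(2) by (simp add: nn_integral_eq_integral int \<mu> \<nu>)
  then have "ennreal (\<integral>x. f x \<partial>\<mu>) \<le> ennreal (K * (\<integral>x. f x \<partial>\<nu>))"
    using K f(2) by (simp add: ennreal_mult integral_nonneg_AE)
  then show ?thesis using K f(2) by (subst (asm) ennreal_le_iff) (auto intro!: mult_nonneg_nonneg integral_nonneg_AE)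
qed

lemma Kbound_emeasure_le:
  assumes fin: "Kbound Pd k v < \<infinity>" and \<kappa>: "control_kernel Pd m v \<in> measurable borel (prob_algebra borel)"
    and B: "B \<in> sets borel"
  shows "emeasure (time_kernel Pd m v k x) B \<le> Kbound Pd k v * emeasure (time_kernel Pd m v k x') B"
proof -
  let ?p = "emeasure (time_kernel Pd m v k x) B" and ?q = "emeasure (time_kernel Pd m v k x') B"
  have "?p / ?q \<le> Kbound Pd k v"
    unfolding Kbound_def
    by (rule SUP_upper2[where i=m, OF UNIV_I], rule SUP_upper2[where i=x, OF UNIV_I],
        rule SUP_upper2[where i=x', OF UNIV_I], rule SUP_upper2[OF B order_refl])
  have q1: "?q \<le> 1"
  proof -
    have "prob_space (time_kernel Pd m v k x')"
      unfolding time_kernel_def by (rule prob_algebraD(1)[OF kernel_power_measurable[OF \<kappa>]])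
    then show ?thesis by (simp add: prob_space.measure_le_1)
  qed
  show ?thesis
  proof (cases "?q = 0")
    case True
    \<comment> \<open>a positive number divided by zero would make the supremum infinite\<close>
    have "?p = 0"
    proof (rule ccontr)
      assume "?p \<noteq> 0"
      then have "?p / ?q = \<infinity>" using True by (simp add: ennreal_divide_eq_top_iff divide_ennreal_def ennreal_mult_top)
      then show False using \<open>?p / ?q \<le> Kbound Pd k v\<close> fin by simp
    qed
    then show ?thesis by simp
  next
    case False
    have "?p = ?p / ?q * ?q"
      using False q1 by (simp add: ennreal_divide_times ennreal_mult_divide_eq mult_divide_eq_ennreal le_less_trans[OF q1])
    also have "\<dots> \<le> Kbound Pd k v * ?q" using \<open>?p / ?q \<le> Kbound Pd k v\<close> by (rule mult_right_mono) simp
    finally show ?thesis .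
  qed
qed

text \<open>Weighting changes the \<open>k\<close>-fold transition kernel by factors between \<open>exp (- k A)\<close> and
  \<open>exp (k A)\<close> only, so the equivalence constant of the kernel yields a Harnack constant
  which is the same for all step sizes.\<close>

lemma harnack_operator_weighted_step:
  assumes \<kappa>: "control_kernel Pd m v \<in> measurable borel (prob_algebra borel)"
    and b: "b \<in> bounded_borel" and A: "\<And>x. \<bar>b x\<bar> \<le> A"
    and K: "Kbound Pd k v \<le> ennreal K" "0 \<le> K"
  shows "harnack_operator (weighted_step (1 / 2 ^ m) b (control_kernel Pd m v) ^^ 2 ^ m) A k (K * exp (2 * real k * A))"
proof -
  define \<kappa>' where "\<kappa>' = control_kernel Pd m v"
  define h :: real where "h = 1 / 2 ^ m"
  have h: "0 \<le> h" "real (2 ^ m) * h = 1" by (auto simp: h_def)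
  let ?T = "weighted_step h b \<kappa>'"
  note \<kappa>' = \<kappa>[folded \<kappa>'_def]
  have A': "real (2 ^ m) * (h * A) = A" using h(2) by (simp only: mult.assoc[symmetric] mult_1)
  have kA: "real (k * 2 ^ m) * (h * A) = real k * A" unfolding of_nat_mult mult.assoc A' ..
  interpret positive_operator "?T ^^ 2 ^ m" A
    using positive_operator.positive_operator_funpow[OF positive_operator_weighted_step[OF \<kappa>' h(1) b A], of "2 ^ m"]
    unfolding A' .
  have "harnack_operator (?T ^^ 2 ^ m) A k (K * exp (2 * real k * A))"
  proof
    fix f :: "'a \<Rightarrow> real" and x x' assume f: "f \<in> bounded_borel" "\<And>y. 0 \<le> f y"
    have pw: "(?T ^^ 2 ^ m) ^^ k = ?T ^^ (k * 2 ^ m)" by (simp add: funpow_mult mult.commute)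
    note bd = weighted_step_power_bounds[OF \<kappa>' h(1) b A f, of "k * 2 ^ m", unfolded kA]
    let ?I = "\<lambda>x. \<integral>y. f y \<partial>kernel_power \<kappa>' (k * 2 ^ m) x"
    note kp = prob_algebraD[OF kernel_power_measurable[OF \<kappa>', of "k * 2 ^ m"]]
    have fin: "Kbound Pd k v < \<infinity>" using K(1) by (auto intro: le_less_trans)
    have "?I x \<le> K * ?I x'"
    proof (rule integral_le_of_emeasure_le)
      fix B :: "'a set" assume B: "B \<in> sets borel"
      have "emeasure (kernel_power \<kappa>' (k * 2 ^ m) x) B \<le> Kbound Pd k v * emeasure (kernel_power \<kappa>' (k * 2 ^ m) x') B"
        using Kbound_emeasure_le[OF fin \<kappa> B, of x x'] by (simp add: time_kernel_def \<kappa>'_def)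
      also have "\<dots> \<le> ennreal K * emeasure (kernel_power \<kappa>' (k * 2 ^ m) x') B"
        using K(1) by (rule mult_right_mono) simp
      finally show "emeasure (kernel_power \<kappa>' (k * 2 ^ m) x) B \<le> ennreal K * emeasure (kernel_power \<kappa>' (k * 2 ^ m) x') B" .
    qed (use kp K(2) f in \<open>auto intro: prob_space.finite_measure\<close>)
    then have "(?T ^^ (k * 2 ^ m)) f x \<le> exp (real k * A) * (K * ?I x')"
      using bd(1)[of x] by (meson exp_ge_zero mult_left_mono order_trans)
    also have "\<dots> = K * exp (2 * real k * A) * (exp (- (real k * A)) * ?I x')"
    proof -
      have "exp (real k * A) = exp (2 * real k * A) * exp (- (real k * A))"
        unfolding exp_add[symmetric] by simp
      then show ?thesis by (simp only: mult_ac)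
    qed
    also have "\<dots> \<le> K * exp (2 * real k * A) * (?T ^^ (k * 2 ^ m)) f x'"
      using bd(2)[of x'] K(2) by (intro mult_left_mono) auto
    finally show "((?T ^^ 2 ^ m) ^^ k) f x \<le> K * exp (2 * real k * A) * ((?T ^^ 2 ^ m) ^^ k) f x'"
      unfolding pw .
  qed
  then show ?thesis by (simp add: h_def \<kappa>'_def)
qed

lemma op_converge_weighted_step:
  assumes \<kappa>: "\<And>n. \<kappa>s n \<in> measurable borel (prob_algebra borel)" "\<kappa> \<in> measurable borel (prob_algebra borel)"
    and V: "\<And>x. 1 \<le> V x" and conv: "\<And>x. (\<lambda>n. V_norm_diff V (\<kappa>s n x) (\<kappa> x)) \<longlonglongrightarrow> 0"
    and b: "\<And>x. (\<lambda>n. bs n x) \<longlonglongrightarrow> b x"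
  shows "op_converge (\<lambda>n. weighted_step h (bs n) (\<kappa>s n)) (weighted_step h b \<kappa>)"
proof -
  have "op_converge (\<lambda>n f x. \<integral>y. f y \<partial>\<kappa>s n x) (\<lambda>f x. \<integral>y. f y \<partial>\<kappa> x)"
  proof (rule op_converge_perturb[OF positive_operator_prob_kernel[OF \<kappa>(2)] conv])
    fix n f C x assume "f \<in> bounded_borel" "\<And>y::'a. \<bar>f y\<bar> \<le> C"
    then show "ereal \<bar>(\<integral>y. f y \<partial>\<kappa>s n x) - (\<integral>y. f y \<partial>\<kappa> x)\<bar> \<le> ereal C * V_norm_diff V (\<kappa>s n x) (\<kappa> x)"
      using prob_algebraD(1,2)[OF \<kappa>(1)[of n], of x] prob_algebraD(1,2)[OF \<kappa>(2), of x] V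
      by (intro integral_diff_le_V_norm_diff) (auto intro: prob_space.finite_measure)
  qed
  then show ?thesis unfolding op_converge_def weighted_step_def[abs_def]
    by (auto intro!: tendsto_intros b)
qed

section \<open>Powers of an additive functional\<close>

lemma abs_integral_le:
  fixes f g :: "'a \<Rightarrow> real"
  assumes g: "integrable M g" and le: "\<And>x. x \<in> space M \<Longrightarrow> \<bar>f x\<bar> \<le> g x"
  shows "\<bar>\<integral>x. f x \<partial>M\<bar> \<le> (\<integral>x. g x \<partial>M)"
proof (cases "integrable M f")
  case True
  have "\<bar>\<integral>x. f x \<partial>M\<bar> \<le> (\<integral>x. \<bar>f x\<bar> \<partial>M)" by (rule integral_abs_bound)
  also have "\<dots> \<le> (\<integral>x. g x \<partial>M)" using True g le by (intro integral_mono) auto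
  finally show ?thesis .
next
  case False
  have "0 \<le> (\<integral>x. g x \<partial>M)"
    using le by (intro integral_nonneg_AE AE_I2) (meson abs_ge_zero order_trans)
  then show ?thesis using False by (simp add: not_integrable_integral_eq)
qed

lemma (in pair_sigma_finite) Fubini_dominated:
  fixes K :: "'a \<Rightarrow> 'b \<Rightarrow> real"
  assumes K[measurable]: "(\<lambda>(x, y). K x y) \<in> borel_measurable (M1 \<Otimes>\<^sub>M M2)"
    and f: "integrable M1 f" and g: "integrable M2 g"
    and le: "\<And>x y. x \<in> space M1 \<Longrightarrow> y \<in> space M2 \<Longrightarrow> \<bar>K x y\<bar> \<le> f x * g y"
  shows "(\<integral>y. (\<integral>x. K x y \<partial>M1) \<partial>M2) = (\<integral>x. (\<integral>y. K x y \<partial>M2) \<partial>M1)"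
proof (rule Fubini_integral)
  have m2: "(\<lambda>y. K x y) \<in> borel_measurable M2" if "x \<in> space M1" for x
    using measurable_Pair2[OF K that] by simp
  have i2: "integrable M2 (K x)" if "x \<in> space M1" for x
    by (rule Bochner_Integration.integrable_bound[of _ "\<lambda>y. f x * g y"])
      (use that g le m2[OF that] in \<open>auto intro!: AE_I2 order_trans[OF le abs_ge_self]\<close>)
  show "integrable (M1 \<Otimes>\<^sub>M M2) (\<lambda>(x, y). K x y)"
  proof (rule Fubini_integrable)
    show "AE x in M1. integrable M2 (\<lambda>y. case (x, y) of (x, y) \<Rightarrow> K x y)" using i2 by auto
    show "integrable M1 (\<lambda>x. \<integral>y. norm (case (x, y) of (x, y) \<Rightarrow> K x y) \<partial>M2)"
    proof (rule Bochner_Integration.integrable_bound[of _ "\<lambda>x. f x * (\<integral>y. g y \<partial>M2)"])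
      show "(\<lambda>x. \<integral>y. norm (case (x, y) of (x, y) \<Rightarrow> K x y) \<partial>M2) \<in> borel_measurable M1" by measurable
      show "AE x in M1. norm (\<integral>y. norm (case (x, y) of (x, y) \<Rightarrow> K x y) \<partial>M2)
          \<le> norm (f x * (\<integral>y. g y \<partial>M2))"
      proof (rule AE_I2)
        fix x assume x: "x \<in> space M1"
        have "\<bar>\<integral>y. \<bar>K x y\<bar> \<partial>M2\<bar> \<le> (\<integral>y. f x * g y \<partial>M2)"
          using g le[OF x] by (intro abs_integral_le) auto
        then show "norm (\<integral>y. norm (case (x, y) of (x, y) \<Rightarrow> K x y) \<partial>M2) \<le> norm (f x * (\<integral>y. g y \<partial>M2))"
          by simp
      qed
    qed (use f in auto)
  qed measurable
qed

definition tail_integral :: "(real \<Rightarrow> real) \<Rightarrow> real \<Rightarrow> real" where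
  "tail_integral f s = (\<integral>q. indicator {s<..} q * f q \<partial>lborel)"

lemma tail_integral_measurable [measurable]:
  assumes [measurable]: "f \<in> borel_measurable borel"
  shows "tail_integral f \<in> borel_measurable borel"
proof -
  have "tail_integral f = (\<lambda>s. \<integral>q. (if s < q then f q else 0) \<partial>lborel)"
    unfolding tail_integral_def by (intro ext Bochner_Integration.integral_cong) auto
  then show ?thesis by simp
qed

lemma tail_integral_abs_le:
  assumes "integrable lborel f"
  shows "\<bar>tail_integral f s\<bar> \<le> (\<integral>q. \<bar>f q\<bar> \<partial>lborel)"
  unfolding tail_integral_def using assms by (intro abs_integral_le) (auto simp: indicator_def)

lemma integrable_mult_tail_integral_power:
  assumes f: "integrable lborel f" and g: "integrable lborel g"
  shows "integrable lborel (\<lambda>r. f r * tail_integral g r ^ j)"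
proof -
  have [measurable]: "f \<in> borel_measurable borel" "g \<in> borel_measurable borel" using f g by auto
  define C where "C = (\<integral>q. \<bar>g q\<bar> \<partial>lborel)"
  have C: "\<bar>tail_integral g r ^ j\<bar> \<le> C ^ j" for r
    using tail_integral_abs_le[OF g, of r] by (simp add: power_abs C_def power_mono)
  have C0: "0 \<le> C ^ j" using C[of 0] by linarith
  show ?thesis
  proof (rule Bochner_Integration.integrable_bound[of _ "\<lambda>r. C ^ j * f r"])
    show "AE r in lborel. norm (f r * tail_integral g r ^ j) \<le> norm (C ^ j * f r)"
      using C C0 by (auto simp: abs_mult mult.commute intro!: mult_left_mono AE_I2)
  qed (use f in auto)
qed

text \<open>Integration by parts, by Fubini: the product is a double integral over \<open>(r, q)\<close>, which is cut along
  the diagonal.\<close>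

lemma tail_integral_mult:
  assumes f: "integrable lborel f" and g: "integrable lborel g"
  shows "tail_integral f s * tail_integral g s
    = tail_integral (\<lambda>r. f r * tail_integral g r + g r * tail_integral f r) s"
proof -
  have [measurable]: "f \<in> borel_measurable borel" "g \<in> borel_measurable borel" using f g by auto
  define F where "F r = indicator {s<..} r * f r" for r
  define G where "G r = indicator {s<..} r * g r" for r
  have F: "integrable lborel F" unfolding F_def[abs_def]
    by (rule Bochner_Integration.integrable_bound[OF f]) (auto simp: indicator_def)
  have G: "integrable lborel G" unfolding G_def[abs_def]
    by (rule Bochner_Integration.integrable_bound[OF g]) (auto simp: indicator_def)
  have [measurable]: "F \<in> borel_measurable borel" "G \<in> borel_measurable borel" using F G by auto
  have iG: "integrable lborel (\<lambda>q. indicator B q * G q)" if "B \<in> sets borel" for B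
    using that by (intro Bochner_Integration.integrable_bound[OF G]) (auto simp: indicator_def)
  have split: "(\<integral>q. G q \<partial>lborel) = tail_integral G r + (\<integral>q. indicator {..r} q * G q \<partial>lborel)" for r
  proof -
    have "tail_integral G r + (\<integral>q. indicator {..r} q * G q \<partial>lborel)
        = (\<integral>q. indicator {r<..} q * G q + indicator {..r} q * G q \<partial>lborel)"
      unfolding tail_integral_def by (rule Bochner_Integration.integral_add[symmetric]) (rule iG, simp)+
    also have "\<dots> = (\<integral>q. G q \<partial>lborel)"
      by (rule Bochner_Integration.integral_cong) (auto simp: indicator_def)
    finally show ?thesis ..
  qed
  have tG: "F r * tail_integral G r = indicator {s<..} r * (f r * tail_integral g r)" for r
    unfolding F_def tail_integral_def G_def
    by (cases "s < r") (auto intro!: Bochner_Integration.integral_cong simp: indicator_def)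
  have tF: "G r * tail_integral F r = indicator {s<..} r * (g r * tail_integral f r)" for r
    unfolding F_def tail_integral_def G_def
    by (cases "s < r") (auto intro!: Bochner_Integration.integral_cong simp: indicator_def)
  have swap: "(\<integral>r. F r * (\<integral>q. indicator {..r} q * G q \<partial>lborel) \<partial>lborel) = (\<integral>q. G q * tail_integral F q \<partial>lborel)"
  proof -
    have "(\<integral>r. F r * (\<integral>q. indicator {..r} q * G q \<partial>lborel) \<partial>lborel)
        = (\<integral>r. (\<integral>q. (if q \<le> r then 1 else 0) * (F r * G q) \<partial>lborel) \<partial>lborel)"
    proof (rule Bochner_Integration.integral_cong[OF refl])
      fix r
      have "F r * (\<integral>q. indicator {..r} q * G q \<partial>lborel) = (\<integral>q. F r * (indicator {..r} q * G q) \<partial>lborel)"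
        by simp
      also have "\<dots> = (\<integral>q. (if q \<le> r then 1 else 0) * (F r * G q) \<partial>lborel)"
        by (rule Bochner_Integration.integral_cong) (auto simp: indicator_def)
      finally show "F r * (\<integral>q. indicator {..r} q * G q \<partial>lborel) = \<dots>" .
    qed
    also have "\<dots> = (\<integral>q. (\<integral>r. (if q \<le> r then 1 else 0) * (F r * G q) \<partial>lborel) \<partial>lborel)"
      by (rule lborel_pair.Fubini_dominated[of _ "\<lambda>q. \<bar>G q\<bar>" "\<lambda>r. \<bar>F r\<bar>"])
        (use F G in \<open>auto simp: abs_mult\<close>)
    also have "\<dots> = (\<integral>q. G q * tail_integral F q \<partial>lborel)"
    proof (rule Bochner_Integration.integral_cong[OF refl])
      fix q
      have "(\<integral>r. (if q \<le> r then 1 else 0) * (F r * G q) \<partial>lborel)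
          = (\<integral>r. G q * (indicator {q<..} r * F r) \<partial>lborel)"
      proof (rule integral_cong_AE)
        show "AE r in lborel. (if q \<le> r then 1 else 0) * (F r * G q) = G q * (indicator {q<..} r * F r)"
          using AE_lborel_singleton[of q] by eventually_elim (auto simp: indicator_def)
      qed measurable
      then show "(\<integral>r. (if q \<le> r then 1 else 0) * (F r * G q) \<partial>lborel) = G q * tail_integral F q"
        by (simp add: tail_integral_def)
    qed
    finally show ?thesis .
  qed
  have i1: "integrable lborel (\<lambda>r. F r * tail_integral G r)" "integrable lborel (\<lambda>r. G r * tail_integral F r)"
    using integrable_mult_tail_integral_power[OF F G, of 1] integrable_mult_tail_integral_power[OF G F, of 1]
    by auto
  have i2: "integrable lborel (\<lambda>r. F r * (\<integral>q. indicator {..r} q * G q \<partial>lborel))"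
  proof -
    have "F r * (\<integral>q. indicator {..r} q * G q \<partial>lborel) = F r * (\<integral>q. G q \<partial>lborel) - F r * tail_integral G r" for r
      by (simp only: split[of r] right_diff_distrib[symmetric] add_diff_cancel_left')
    then show ?thesis using F i1 by simp
  qed
  have "tail_integral f s * tail_integral g s = (\<integral>r. F r * (\<integral>q. G q \<partial>lborel) \<partial>lborel)"
    by (simp add: tail_integral_def F_def G_def)
  also have "\<dots> = (\<integral>r. F r * tail_integral G r + F r * (\<integral>q. indicator {..r} q * G q \<partial>lborel) \<partial>lborel)"
  proof (rule Bochner_Integration.integral_cong[OF refl])
    show "F r * (\<integral>q. G q \<partial>lborel) = F r * tail_integral G r + F r * (\<integral>q. indicator {..r} q * G q \<partial>lborel)" for r
      by (simp only: split[of r] distrib_left)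
  qed
  also have "\<dots> = (\<integral>r. F r * tail_integral G r \<partial>lborel) + (\<integral>r. G r * tail_integral F r \<partial>lborel)"
    unfolding swap[symmetric] by (rule Bochner_Integration.integral_add[OF i1(1) i2])
  also have "\<dots> = (\<integral>r. F r * tail_integral G r + G r * tail_integral F r \<partial>lborel)"
    by (rule Bochner_Integration.integral_add[symmetric, OF i1])
  also have "\<dots> = tail_integral (\<lambda>r. f r * tail_integral g r + g r * tail_integral f r) s"
    unfolding tG tF tail_integral_def[of "\<lambda>r. f r * tail_integral g r + g r * tail_integral f r"]
    by (simp add: algebra_simps)
  finally show ?thesis .
qed

lemma tail_integral_cmult: "tail_integral (\<lambda>r. c * f r) s = c * tail_integral f s"
  unfolding tail_integral_def by (subst integral_mult_right_zero[symmetric]) (simp add: mult.left_commute)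

text \<open>The chain rule for the power; \<open>f\<close> is merely integrable, so it is obtained from the product rule by
  induction.\<close>

lemma tail_integral_power:
  assumes f: "integrable lborel f"
  shows "tail_integral f s ^ Suc j = real (Suc j) * tail_integral (\<lambda>r. f r * tail_integral f r ^ j) s"
proof (induction j arbitrary: s)
  case 0
  show ?case by simp
next
  case (Suc j)
  let ?g = "\<lambda>r. real (Suc j) * (f r * tail_integral f r ^ j)"
  have g: "integrable lborel ?g" using integrable_mult_tail_integral_power[OF f f, of j] by simp
  have Tg: "tail_integral ?g r = tail_integral f r ^ Suc j" for r
    unfolding Suc tail_integral_cmult ..
  have "tail_integral f s ^ Suc (Suc j) = tail_integral f s * tail_integral ?g s"
    unfolding Tg by simp
  also have "\<dots> = tail_integral (\<lambda>r. f r * tail_integral ?g r + ?g r * tail_integral f r) s"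
    by (rule tail_integral_mult[OF f g])
  also have "(\<lambda>r. f r * tail_integral ?g r + ?g r * tail_integral f r)
      = (\<lambda>r. real (Suc (Suc j)) * (f r * tail_integral f r ^ Suc j))"
    unfolding Tg by (auto simp: algebra_simps)
  finally show ?case unfolding tail_integral_cmult .
qed

section \<open>Weighted processes in continuous time\<close>

lemma integral_measurable_parametric_kernel:
  fixes f :: "'a \<Rightarrow> 'b \<Rightarrow> real"
  assumes f: "(\<lambda>(x, y). f x y) \<in> borel_measurable (M \<Otimes>\<^sub>M N)"
    and L: "L \<in> measurable M (subprob_algebra N)"
  shows "(\<lambda>x. \<integral>y. f x y \<partial>L x) \<in> borel_measurable M"
proof -
  have "(\<lambda>x. \<integral>z. (case z of (x, y) \<Rightarrow> f x y) \<partial>distr (L x) (M \<Otimes>\<^sub>M N) (Pair x)) \<in> borel_measurable M"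
    by (rule measurable_compose[OF measurable_distr2[OF _ L] integral_measurable_subprob_algebra[OF f]]) simp
  also have "?this \<longleftrightarrow> ?thesis"
  proof (rule measurable_cong)
    fix x assume x: "x \<in> space M"
    then have "Pair x \<in> measurable (L x) (M \<Otimes>\<^sub>M N)"
      by (simp add: subprob_measurableD(3)[OF L])
    then show "(\<integral>z. (case z of (x, y) \<Rightarrow> f x y) \<partial>distr (L x) (M \<Otimes>\<^sub>M N) (Pair x)) = (\<integral>y. f x y \<partial>L x)"
      by (simp add: integral_distr[OF _ f])
  qed
  finally show ?thesis .
qed

text \<open>The terms of the Dyson series of the semigroup perturbed by the potential \<open>b\<close>. By the Markov property,
  \<open>dyson P b g j t x\<close> is the mean of \<open>(\<integral> b (X\<^sub>r) dr)\<^sup>j / j! * g (X\<^sub>t)\<close> from \<open>x\<close>. Cutting the times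
  off at \<open>0\<close> makes the terms jointly measurable on the whole line.\<close>

primrec dyson ::
  "(real \<Rightarrow> 'e::topological_space \<Rightarrow> 'e measure) \<Rightarrow> ('e \<Rightarrow> real) \<Rightarrow> ('e \<Rightarrow> real) \<Rightarrow> nat \<Rightarrow> real \<Rightarrow> 'e \<Rightarrow> real" where
  "dyson P b g 0 t x = (\<integral>y. g y \<partial>P (max 0 t) x)"
| "dyson P b g (Suc j) t x =
     (\<integral>r. indicator {0<..t} r * (\<integral>y. b y * dyson P b g j (t - r) y \<partial>P (max 0 r) x) \<partial>lborel)"

text \<open>The additive functional of \<open>b\<close> over the times between \<open>s\<close> and \<open>e\<close> is the tail integral of this
  function at \<open>s\<close>; the endpoint \<open>e\<close> is built into the integrand, the starting point stays variable.\<close>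

definition path_weight :: "(real \<Rightarrow> 'w \<Rightarrow> 'e) \<Rightarrow> ('e \<Rightarrow> real) \<Rightarrow> real \<Rightarrow> 'w \<Rightarrow> real \<Rightarrow> real" where
  "path_weight X b e \<omega> r = indicator {0<..e} r * b (X (max 0 r) \<omega>)"

locale weighted_process =
  fixes P :: "real \<Rightarrow> 'e::topological_space \<Rightarrow> 'e measure" and Q :: "'e \<Rightarrow> 'w measure"
    and X :: "real \<Rightarrow> 'w \<Rightarrow> 'e" and b :: "'e \<Rightarrow> real" and A :: real
  assumes P_kernel:
      "(\<lambda>(t, x). P t x) \<in> measurable (restrict_space borel {0..} \<Otimes>\<^sub>M borel) (prob_algebra borel)"
    and X_measurable: "\<And>x. (\<lambda>(t, \<omega>). X t \<omega>) \<in> measurable (restrict_space borel {0..} \<Otimes>\<^sub>M Q x) borel"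
    and X_markov: "\<And>x. markov_process_from {0..} P x (Q x) X"
    and b: "b \<in> bounded_borel" and A: "\<And>x. \<bar>b x\<bar> \<le> A"
begin

abbreviation path_integral :: "real \<Rightarrow> 'w \<Rightarrow> real \<Rightarrow> real" where
  "path_integral e \<omega> \<equiv> tail_integral (path_weight X b e \<omega>)"

abbreviation past :: "'e \<Rightarrow> real \<Rightarrow> 'w measure" where
  "past x s \<equiv> natural_filtration {0..} (Q x) X s"

lemma A0: "0 \<le> A" using A[of undefined] by linarith

lemma b_measurable [measurable]: "b \<in> borel_measurable borel"
  using b by (simp add: bounded_borel_def)

lemma prob_Q: "prob_space (Q x)"
  using X_markov[of x] by (simp add: markov_process_from_def)

lemma P_measurable: "0 \<le> t \<Longrightarrow> P t \<in> measurable borel (prob_algebra borel)"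
  using measurable_Pair2[OF P_kernel, of t] by (simp add: space_restrict_space)

lemma max_restrict [measurable]: "(\<lambda>t::real. max 0 t) \<in> measurable borel (restrict_space borel {0..})"
  by (rule measurable_restrict_space2) auto

lemma P_joint: "(\<lambda>z. P (max 0 (fst z)) (snd z)) \<in> measurable (borel \<Otimes>\<^sub>M borel) (subprob_algebra borel)"
proof -
  have "(\<lambda>z. (max 0 (fst z), snd z)) \<in> measurable (borel \<Otimes>\<^sub>M borel) (restrict_space borel {0::real..} \<Otimes>\<^sub>M (borel :: 'e measure))"
    by measurable
  from measurable_compose[OF this measurable_prob_algebraD[OF P_kernel]] show ?thesis by simp
qed

lemma P_joint': "\<lbrakk>f \<in> borel_measurable N; g \<in> measurable N borel\<rbrakk> \<Longrightarrow>
    (\<lambda>z. P (max 0 (f z)) (g z)) \<in> measurable N (subprob_algebra borel)"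
  using measurable_compose[OF measurable_Pair P_joint, of f N g] by simp

lemma X_joint: "(\<lambda>z. X (max 0 (fst z)) (snd z)) \<in> measurable (borel \<Otimes>\<^sub>M Q x) borel"
proof -
  have "(\<lambda>z. (max 0 (fst z), snd z)) \<in> measurable (borel \<Otimes>\<^sub>M Q x) (restrict_space borel {0::real..} \<Otimes>\<^sub>M Q x)"
    by measurable
  from measurable_compose[OF this X_measurable[of x]] show ?thesis by simp
qed

lemma X_joint': "\<lbrakk>f \<in> borel_measurable N; g \<in> measurable N (Q x)\<rbrakk> \<Longrightarrow>
    (\<lambda>z. X (max 0 (f z)) (g z)) \<in> measurable N borel"
  using measurable_compose[OF measurable_Pair X_joint, of f N g x] by simp

lemma X_time: "0 \<le> t \<Longrightarrow> X t \<in> measurable (Q x) borel"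
  using X_markov[of x] by (simp add: markov_process_from_def)

lemma dyson_measurable:
  assumes g: "g \<in> bounded_borel"
  shows "(\<lambda>z. dyson P b g j (fst z) (snd z)) \<in> borel_measurable (borel \<Otimes>\<^sub>M borel)"
proof (induction j)
  case 0
  have [measurable]: "g \<in> borel_measurable borel" using g by (simp add: bounded_borel_def)
  show ?case unfolding dyson.simps
    by (rule measurable_compose[OF P_joint integral_measurable_subprob_algebra]) measurable
next
  case (Suc j)
  have [measurable]: "(\<lambda>w :: ((real \<times> 'e) \<times> real) \<times> 'e. dyson P b g j (fst (fst (fst w)) - snd (fst w)) (snd w))
      \<in> borel_measurable (((borel \<Otimes>\<^sub>M borel) \<Otimes>\<^sub>M borel) \<Otimes>\<^sub>M borel)"
    by (rule measurable_compose[OF measurable_Pair Suc, simplified]) measurable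
  have "(\<lambda>z :: (real \<times> 'e) \<times> real. \<integral>y. b y * dyson P b g j (fst (fst z) - snd z) y \<partial>P (max 0 (snd z)) (snd (fst z)))
      \<in> borel_measurable ((borel \<Otimes>\<^sub>M borel) \<Otimes>\<^sub>M borel)"
    by (rule integral_measurable_parametric_kernel[where N=borel])
      (unfold split_beta', measurable, rule P_joint', measurable)
  then have [measurable]: "(\<lambda>(z :: real \<times> 'e, r :: real). \<integral>y. b y * dyson P b g j (fst z - r) y \<partial>P (max 0 r) (snd z))
      \<in> borel_measurable ((borel \<Otimes>\<^sub>M borel) \<Otimes>\<^sub>M lborel)"
    by (simp add: split_beta' cong: measurable_cong_sets sets_pair_measure_cong)
  have "(\<lambda>z. dyson P b g (Suc j) (fst z) (snd z)) = (\<lambda>z. \<integral>r. (if 0 < r \<and> r \<le> fst z then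
      \<integral>y. b y * dyson P b g j (fst z - r) y \<partial>P (max 0 r) (snd z) else 0) \<partial>lborel)"
    unfolding dyson.simps by (intro ext Bochner_Integration.integral_cong) auto
  then show ?case by simp
qed

text \<open>For \<open>t \<le> 1\<close> the integrals run over intervals of length at most \<open>1\<close> and contribute no factor
  beyond the bound of \<open>b\<close>.\<close>

lemma dyson_section:
  assumes g: "g \<in> bounded_borel" and B: "\<And>y. \<bar>g y\<bar> \<le> B"
  shows "t \<le> 1 \<Longrightarrow> \<bar>dyson P b g j t x\<bar> \<le> B * A ^ j"
    and "t \<le> 1 \<Longrightarrow> dyson P b g j t \<in> bounded_borel"
proof -
  have m: "dyson P b g j t \<in> borel_measurable borel" for j t
    using measurable_compose[OF _ dyson_measurable[OF g], of "\<lambda>x. (t, x)" borel j] by simp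
  have B0: "0 \<le> B" using B[of undefined] by linarith
  have bd: "\<bar>dyson P b g j t x\<bar> \<le> B * A ^ j" if "t \<le> 1" for j t x
    using that
  proof (induction j arbitrary: t x)
    case 0
    show ?case using prob_kernel_integral_bounded_borel(2)[OF P_measurable g B, of "max 0 t"] by simp
  next
    case (Suc j)
    have AB: "0 \<le> A * (B * A ^ j)" using A0 B0 by simp
    have in_le: "\<bar>\<integral>y. b y * dyson P b g j (t - r) y \<partial>P (max 0 r) x\<bar> \<le> A * (B * A ^ j)" if "0 < r" for r
    proof (rule prob_kernel_integral_bounded_borel(2))
      show "P (max 0 r) \<in> measurable borel (prob_algebra borel)" by (rule P_measurable) simp
      have dj: "\<bar>dyson P b g j (t - r) y\<bar> \<le> B * A ^ j" for y using Suc that by (intro Suc.IH) auto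
      then show "\<bar>b y * dyson P b g j (t - r) y\<bar> \<le> A * (B * A ^ j)" for y
        using A A0 B0 by (auto simp: abs_mult intro!: mult_mono)
      show "(\<lambda>y. b y * dyson P b g j (t - r) y) \<in> bounded_borel"
        by (intro bounded_borel_mult b bounded_borelI[OF m dj])
    qed
    have "\<bar>dyson P b g (Suc j) t x\<bar> \<le> (\<integral>r. indicator {0<..t} r * (A * (B * A ^ j)) \<partial>lborel)"
      unfolding dyson.simps
    proof (rule abs_integral_le)
      show "integrable lborel (\<lambda>r. indicator {0<..t} r * (A * (B * A ^ j)))"
        by (intro integrable_mult_left integrable_real_indicator; cases "0 \<le> t") auto
    qed (use in_le in \<open>auto simp: indicator_def\<close>)
    also have "\<dots> = measure lborel {0<..t} * (A * (B * A ^ j))" by simp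
    also have "\<dots> \<le> 1 * (A * (B * A ^ j))"
      using Suc.prems AB by (intro mult_right_mono) (cases "0 \<le> t"; simp)+
    finally show ?case by (simp add: mult.left_commute mult.assoc)
  qed
  then show "t \<le> 1 \<Longrightarrow> \<bar>dyson P b g j t x\<bar> \<le> B * A ^ j" .
  show "t \<le> 1 \<Longrightarrow> dyson P b g j t \<in> bounded_borel" by (rule bounded_borelI[OF m bd])
qed

lemma path_weight_joint:
  "(\<lambda>z. path_weight X b e (snd z) (fst z)) \<in> borel_measurable (borel \<Otimes>\<^sub>M Q x)"
proof -
  note [measurable] = X_joint[of x]
  have "(\<lambda>z. path_weight X b e (snd z) (fst z)) = (\<lambda>z. if 0 < fst z \<and> fst z \<le> e then b (X (max 0 (fst z)) (snd z)) else 0)"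
    by (auto simp: path_weight_def fun_eq_iff)
  then show ?thesis by simp
qed

lemma path_weight_abs_le: "\<bar>path_weight X b e \<omega> r\<bar> \<le> A * indicator {0<..e} r"
  using A by (simp add: path_weight_def indicator_def)

lemma path_weight_integrable:
  assumes "\<omega> \<in> space (Q x)"
  shows "integrable lborel (path_weight X b e \<omega>)"
proof (rule Bochner_Integration.integrable_bound)
  show "integrable lborel (\<lambda>r. A * indicator {0<..e} r)"
    by (intro integrable_mult_right integrable_real_indicator; cases "0 \<le> e") auto
  show "path_weight X b e \<omega> \<in> borel_measurable lborel"
    using measurable_compose[OF measurable_Pair2'[OF assms] path_weight_joint] by simp
qed (use path_weight_abs_le in \<open>auto intro!: AE_I2 order_trans[OF path_weight_abs_le]\<close>)

lemma tail_path_weight_abs_le: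
  assumes "0 \<le> s" "s \<le> e"
  shows "\<bar>path_integral e \<omega> s\<bar> \<le> A * (e - s)"
proof -
  have "\<bar>path_integral e \<omega> s\<bar> \<le> (\<integral>r. A * indicator {s<..e} r \<partial>lborel)"
    unfolding tail_integral_def
  proof (rule abs_integral_le)
    show "integrable lborel (\<lambda>r. A * indicator {s<..e} r)"
      using assms by (intro integrable_mult_right integrable_real_indicator) auto
    show "\<bar>indicator {s<..} r * path_weight X b e \<omega> r\<bar> \<le> A * indicator {s<..e} r" for r
      using path_weight_abs_le[of e \<omega> r] assms by (auto simp: indicator_def split: if_splits)
  qed
  also have "\<dots> = A * (e - s)" using assms by simp
  finally show ?thesis .
qed

lemma tail_path_weight_joint:
  "(\<lambda>z. path_integral e (snd z) (fst z)) \<in> borel_measurable (borel \<Otimes>\<^sub>M Q x)"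
proof -
  have [measurable]: "(\<lambda>w. path_weight X b e (snd (fst w)) (snd w)) \<in> borel_measurable ((borel \<Otimes>\<^sub>M Q x) \<Otimes>\<^sub>M lborel)"
    by (rule measurable_compose[OF measurable_Pair path_weight_joint, of snd _ "\<lambda>w. snd (fst w)", simplified]) measurable
  have "(\<lambda>z. path_integral e (snd z) (fst z))
      = (\<lambda>z. \<integral>q. (if fst z < q then path_weight X b e (snd z) q else 0) \<partial>lborel)"
    unfolding tail_integral_def by (intro ext Bochner_Integration.integral_cong) auto
  then show ?thesis by simp
qed

lemma tail_path_weight_measurable:
  "(\<lambda>\<omega>. path_integral e \<omega> s) \<in> borel_measurable (Q x)"
  using measurable_compose[OF measurable_Pair tail_path_weight_joint, of "\<lambda>_. s" "Q x" "\<lambda>\<omega>. \<omega>" x e] by simp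

lemma filtration_measurable_Q:
  "Z \<in> borel_measurable (past x s) \<Longrightarrow> Z \<in> borel_measurable (Q x)"
  by (rule measurable_from_subalg[OF subalgebra_natural_filtration]) (auto intro: X_time)

text \<open>The variable \<open>W\<close> depends on the path after \<open>e\<close> and is known through its
  conditional expectation \<open>g (X e)\<close> only. The induction expands the last power of the
  additive functional by \<open>tail_integral_power\<close>; for the times \<open>r\<close> inside the integral the factor
  \<open>b (X r)\<close> belongs to the past of \<open>r\<close>, so only one-dimensional conditional
  distributions are ever used.\<close>

lemma dyson_expectation:
  assumes g: "g \<in> bounded_borel"
    and W: "W \<in> borel_measurable (Q x)" and W_le: "\<And>\<omega>. \<bar>W \<omega>\<bar> \<le> D"
    and W_cond: "\<And>Z C. Z \<in> borel_measurable (past x e) \<Longrightarrow> (\<And>\<omega>. \<bar>Z \<omega>\<bar> \<le> C) \<Longrightarrow>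
        (\<integral>\<omega>. Z \<omega> * W \<omega> \<partial>Q x) = (\<integral>\<omega>. Z \<omega> * g (X e \<omega>) \<partial>Q x)"
    and "0 \<le> s" "s \<le> e" "e \<le> s + 1"
    and Z: "Z \<in> borel_measurable (past x s)" and C: "\<And>\<omega>. \<bar>Z \<omega>\<bar> \<le> C"
  shows "(\<integral>\<omega>. Z \<omega> * (path_integral e \<omega> s ^ j / fact j * W \<omega>) \<partial>Q x)
       = (\<integral>\<omega>. Z \<omega> * dyson P b g j (e - s) (X s \<omega>) \<partial>Q x)"
  using assms(5-)
proof (induction j arbitrary: s Z C)
  case 0
  have e0: "0 \<le> e" using 0 by simp
  have "(\<integral>\<omega>. Z \<omega> * W \<omega> \<partial>Q x) = (\<integral>\<omega>. Z \<omega> * g (X e \<omega>) \<partial>Q x)"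
    using 0 natural_filtration_mono[of s e "{0..}" "Q x" X borel] by (intro W_cond) auto
  also have "\<dots> = (\<integral>\<omega>. Z \<omega> * g (X (s + (e - s)) \<omega>) \<partial>Q x)" by simp
  also have "\<dots> = (\<integral>\<omega>. Z \<omega> * (\<integral>y. g y \<partial>P (e - s) (X s \<omega>)) \<partial>Q x)"
    using 0 e0 by (intro markov_process_from_integral[OF X_markov _ _ _ P_measurable _ _ g]) auto
  finally show ?case using 0 by simp
next
  case (Suc j)
  interpret prob_space "Q x" by (rule prob_Q)
  interpret pair_sigma_finite lborel "Q x" ..
  obtain B where B: "\<And>y. \<bar>g y\<bar> \<le> B" "0 < B" using g by (meson bounded_borelE)
  let ?T = "\<lambda>\<omega> r. path_integral e \<omega> r"
  let ?I = "\<lambda>r y. \<integral>y'. b y' * dyson P b g j (e - r) y' \<partial>P (max 0 (r - s)) y"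
  have e0: "0 \<le> e" and C0: "0 \<le> C" and D0: "0 \<le> D"
    using Suc.prems(1,2) Suc.prems(5)[of undefined] W_le[of undefined] by linarith+
  have ZQ[measurable]: "Z \<in> borel_measurable (Q x)" by (rule filtration_measurable_Q[OF Suc.prems(4)])
  note W[measurable]
  define K where "K r \<omega> = indicator {s<..} r * (path_weight X b e \<omega> r * ?T \<omega> r ^ j / fact j) * (Z \<omega> * W \<omega>)" for r \<omega>
  have int_ind: "integrable lborel (\<lambda>r. indicator {s<..e} r * a)" for a :: real
    using Suc.prems by (intro integrable_mult_left integrable_real_indicator) auto
  have expand: "Z \<omega> * (?T \<omega> s ^ Suc j / fact (Suc j) * W \<omega>) = (\<integral>r. K r \<omega> \<partial>lborel)"
    if "\<omega> \<in> space (Q x)" for \<omega>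
  proof -
    have "?T \<omega> s ^ Suc j / fact (Suc j) = tail_integral (\<lambda>r. path_weight X b e \<omega> r * ?T \<omega> r ^ j) s / fact j"
      unfolding tail_integral_power[OF path_weight_integrable[OF that]] fact_Suc by (simp del: of_nat_Suc)
    also have "\<dots> = (\<integral>r. indicator {s<..} r * (path_weight X b e \<omega> r * ?T \<omega> r ^ j / fact j) \<partial>lborel)"
      by (simp add: tail_integral_def)
    finally show ?thesis unfolding K_def
      by (simp add: mult.commute mult.left_commute mult.assoc)
  qed
  have "(\<integral>\<omega>. Z \<omega> * (?T \<omega> s ^ Suc j / fact (Suc j) * W \<omega>) \<partial>Q x) = (\<integral>\<omega>. (\<integral>r. K r \<omega> \<partial>lborel) \<partial>Q x)"
    by (rule Bochner_Integration.integral_cong[OF refl]) (rule expand)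
  also have "\<dots> = (\<integral>r. (\<integral>\<omega>. K r \<omega> \<partial>Q x) \<partial>lborel)"
  proof (rule Fubini_dominated[of _ "\<lambda>r. indicator {s<..e} r * (A * A ^ j * (C * D))" "\<lambda>_. 1"])
    have [measurable]: "(\<lambda>z. path_weight X b e (snd z) (fst z)) \<in> borel_measurable (lborel \<Otimes>\<^sub>M Q x)"
      "(\<lambda>z. path_integral e (snd z) (fst z)) \<in> borel_measurable (lborel \<Otimes>\<^sub>M Q x)"
      using path_weight_joint[of e x] tail_path_weight_joint[of e x]
      by (simp_all cong: measurable_cong_sets sets_pair_measure_cong)
    have "(\<lambda>z. K (fst z) (snd z)) = (\<lambda>z. if s < fst z then path_weight X b e (snd z) (fst z) * ?T (snd z) (fst z) ^ j / fact j * (Z (snd z) * W (snd z)) else 0)"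
      by (auto simp: K_def fun_eq_iff)
    then show "(\<lambda>(r, \<omega>). K r \<omega>) \<in> borel_measurable (lborel \<Otimes>\<^sub>M Q x)"
      by (simp add: split_beta')
    fix r \<omega>
    show "\<bar>K r \<omega>\<bar> \<le> indicator {s<..e} r * (A * A ^ j * (C * D)) * 1"
    proof (cases "s < r \<and> r \<le> e")
      case True
      have "\<bar>?T \<omega> r\<bar> \<le> A * (e - r)" using True Suc.prems by (intro tail_path_weight_abs_le) auto
      also have "\<dots> \<le> A * 1" using True Suc.prems A0 by (intro mult_left_mono) auto
      finally have T: "\<bar>?T \<omega> r\<bar> ^ j \<le> A ^ j" by (intro power_mono) auto
      have "\<bar>?T \<omega> r\<bar> ^ j / fact j \<le> A ^ j / 1"
        using T A0 by (intro frac_le) (auto simp: fact_ge_1)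
      then have "\<bar>path_weight X b e \<omega> r\<bar> * (\<bar>?T \<omega> r\<bar> ^ j / fact j) * (\<bar>Z \<omega>\<bar> * \<bar>W \<omega>\<bar>) \<le> A * A ^ j * (C * D)"
        using path_weight_abs_le[of e \<omega> r] True Suc.prems A0 C0 D0 W_le
        by (intro mult_mono) (auto simp: indicator_def split: if_splits)
      then show ?thesis using True by (simp add: K_def abs_mult power_abs)
    next
      case False
      then show ?thesis by (auto simp: K_def path_weight_def indicator_def)
    qed
  qed (use int_ind in auto)
  also have "\<dots> = (\<integral>r. (\<integral>\<omega>. indicator {s<..e} r * (Z \<omega> * ?I r (X s \<omega>)) \<partial>Q x) \<partial>lborel)"
  proof (rule Bochner_Integration.integral_cong[OF refl])
    fix r
    show "(\<integral>\<omega>. K r \<omega> \<partial>Q x) = (\<integral>\<omega>. indicator {s<..e} r * (Z \<omega> * ?I r (X s \<omega>)) \<partial>Q x)"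
    proof (cases "s < r \<and> r \<le> e")
      case True
      have r: "0 \<le> r" "0 < r" using True Suc.prems by auto
      let ?\<phi> = "\<lambda>y. b y * dyson P b g j (e - r) y"
      have \<phi>: "?\<phi> \<in> bounded_borel"
        using True Suc.prems by (intro bounded_borel_mult b dyson_section[OF g B(1)]) auto
      have "(\<integral>\<omega>. K r \<omega> \<partial>Q x) = (\<integral>\<omega>. (Z \<omega> * b (X r \<omega>)) * (?T \<omega> r ^ j / fact j * W \<omega>) \<partial>Q x)"
        using True r by (intro Bochner_Integration.integral_cong) (auto simp: K_def path_weight_def)
      also have "\<dots> = (\<integral>\<omega>. (Z \<omega> * b (X r \<omega>)) * dyson P b g j (e - r) (X r \<omega>) \<partial>Q x)"
      proof (rule Suc.IH)
        have "Z \<in> borel_measurable (past x r)"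
          using natural_filtration_mono[of s r "{0..}" "Q x" X borel] True Suc.prems(4) by auto
        moreover have "X r \<in> measurable (past x r) borel"
          using r by (intro measurable_natural_filtration) auto
        ultimately show "(\<lambda>\<omega>. Z \<omega> * b (X r \<omega>)) \<in> borel_measurable (past x r)"
          by measurable
        show "\<bar>Z \<omega> * b (X r \<omega>)\<bar> \<le> C * A" for \<omega>
          using Suc.prems(5) A C0 by (auto simp: abs_mult intro!: mult_mono)
      qed (use True Suc.prems in auto)
      also have "\<dots> = (\<integral>\<omega>. Z \<omega> * ?\<phi> (X (s + (r - s)) \<omega>) \<partial>Q x)" by (simp add: mult.assoc)
      also have "\<dots> = (\<integral>\<omega>. Z \<omega> * (\<integral>y. ?\<phi> y \<partial>P (r - s) (X s \<omega>)) \<partial>Q x)"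
        using True r Suc.prems
        by (intro markov_process_from_integral[OF X_markov _ _ _ P_measurable _ _ \<phi>]) auto
      finally show ?thesis using True by simp
    next
      case False
      then show ?thesis by (auto simp: K_def path_weight_def indicator_def)
    qed
  qed
  also have "\<dots> = (\<integral>\<omega>. (\<integral>r. indicator {s<..e} r * (Z \<omega> * ?I r (X s \<omega>)) \<partial>lborel) \<partial>Q x)"
  proof (rule Fubini_dominated[symmetric, of _ "\<lambda>r. indicator {s<..e} r * (C * (A * (B * A ^ j)))" "\<lambda>_. 1"])
    have [measurable]: "X s \<in> measurable (Q x) borel" using Suc.prems by (intro X_time) auto
    have [measurable]: "(\<lambda>w :: (real \<times> 'w) \<times> 'e. dyson P b g j (e - fst (fst w)) (snd w))
        \<in> borel_measurable ((borel \<Otimes>\<^sub>M Q x) \<Otimes>\<^sub>M borel)"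
      by (rule measurable_compose[OF measurable_Pair dyson_measurable[OF g], simplified]) measurable
    have "(\<lambda>z :: real \<times> 'w. ?I (fst z) (X s (snd z))) \<in> borel_measurable (borel \<Otimes>\<^sub>M Q x)"
      by (rule integral_measurable_parametric_kernel[where N=borel])
        (unfold split_beta', measurable, rule P_joint', measurable)
    then have [measurable]: "(\<lambda>z :: real \<times> 'w. ?I (fst z) (X s (snd z))) \<in> borel_measurable (lborel \<Otimes>\<^sub>M Q x)"
      by (simp cong: measurable_cong_sets sets_pair_measure_cong)
    have "(\<lambda>z. indicator {s<..e} (fst z) * (Z (snd z) * ?I (fst z) (X s (snd z))))
        = (\<lambda>z. if s < fst z \<and> fst z \<le> e then Z (snd z) * ?I (fst z) (X s (snd z)) else 0)"
      by (auto simp: fun_eq_iff)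
    then show "(\<lambda>(r, \<omega>). indicator {s<..e} r * (Z \<omega> * ?I r (X s \<omega>))) \<in> borel_measurable (lborel \<Otimes>\<^sub>M Q x)"
      by (simp add: split_beta')
    fix r \<omega>
    show "\<bar>indicator {s<..e} r * (Z \<omega> * ?I r (X s \<omega>))\<bar> \<le> indicator {s<..e} r * (C * (A * (B * A ^ j))) * 1"
    proof (cases "s < r \<and> r \<le> e")
      case True
      have er: "e - r \<le> 1" using True Suc.prems by simp
      have dj: "\<bar>dyson P b g j (e - r) y\<bar> \<le> B * A ^ j" for y by (rule dyson_section(1)[OF g B(1) er])
      have "\<bar>?I r (X s \<omega>)\<bar> \<le> A * (B * A ^ j)"
      proof (rule prob_kernel_integral_bounded_borel(2))
        show "P (max 0 (r - s)) \<in> measurable borel (prob_algebra borel)" by (rule P_measurable) simp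
        show "(\<lambda>y. b y * dyson P b g j (e - r) y) \<in> bounded_borel"
          by (intro bounded_borel_mult b dyson_section(2)[OF g B(1) er])
        show "\<bar>b y * dyson P b g j (e - r) y\<bar> \<le> A * (B * A ^ j)" for y
          using A dj A0 by (auto simp: abs_mult intro!: mult_mono)
      qed
      then have "\<bar>Z \<omega> * ?I r (X s \<omega>)\<bar> \<le> C * (A * (B * A ^ j))"
        unfolding abs_mult using Suc.prems(5) C0 by (intro mult_mono) auto
      then show ?thesis using True by simp
    qed simp
  qed (use int_ind in auto)
  also have "\<dots> = (\<integral>\<omega>. Z \<omega> * dyson P b g (Suc j) (e - s) (X s \<omega>) \<partial>Q x)"
  proof (rule Bochner_Integration.integral_cong[OF refl])
    fix \<omega>
    have "(\<integral>r. indicator {s<..e} r * (Z \<omega> * ?I r (X s \<omega>)) \<partial>lborel)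
        = Z \<omega> * (\<integral>r. indicator {s<..e} r * ?I r (X s \<omega>) \<partial>lborel)"
      by (subst integral_mult_right_zero[symmetric]) (simp add: mult.left_commute)
    also have "(\<integral>r. indicator {s<..e} r * ?I r (X s \<omega>) \<partial>lborel)
        = (\<integral>r. indicator {s<..e} (s + 1 * r) * ?I (s + 1 * r) (X s \<omega>) \<partial>lborel)"
      by (subst lborel_integral_real_affine[of 1 _ s]) simp_all
    also have "\<dots> = dyson P b g (Suc j) (e - s) (X s \<omega>)"
      unfolding dyson.simps
      by (rule Bochner_Integration.integral_cong[OF refl]) (auto simp: indicator_def algebra_simps)
    finally show "(\<integral>r. indicator {s<..e} r * (Z \<omega> * ?I r (X s \<omega>)) \<partial>lborel)
        = Z \<omega> * dyson P b g (Suc j) (e - s) (X s \<omega>)" .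
  qed
  finally show ?case .
qed

lemma tail_path_weight_abs_le_A:
  assumes "0 \<le> s" "s \<le> e" "e \<le> s + 1"
  shows "\<bar>path_integral e \<omega> s\<bar> \<le> A"
proof -
  have "A * (e - s) \<le> A * 1" using assms A0 by (intro mult_left_mono) auto
  then show ?thesis using tail_path_weight_abs_le[of s e \<omega>] assms by linarith
qed

lemma integrable_bounded_mult:
  fixes Z Y :: "'w \<Rightarrow> real"
  assumes "Z \<in> borel_measurable (Q x)" "Y \<in> borel_measurable (Q x)"
    and "\<And>\<omega>. \<bar>Z \<omega>\<bar> \<le> C" "\<And>\<omega>. \<bar>Y \<omega>\<bar> \<le> D"
  shows "integrable (Q x) (\<lambda>\<omega>. Z \<omega> * Y \<omega>)"
proof -
  interpret prob_space "Q x" by (rule prob_Q)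
  have "0 \<le> C" using assms(3)[of undefined] by linarith
  then show ?thesis using assms
    by (intro integrable_const_bound[of _ "C * D"]) (auto simp: abs_mult intro!: mult_mono)
qed

lemma exp_partial_sum_abs_le:
  fixes t :: real
  assumes "\<bar>t\<bar> \<le> a"
  shows "\<bar>\<Sum>j<N. t ^ j / fact j\<bar> \<le> exp a"
proof -
  have a: "0 \<le> a" using assms by linarith
  have "\<bar>\<Sum>j<N. t ^ j / fact j\<bar> \<le> (\<Sum>j<N. a ^ j / fact j)"
    using assms by (intro order_trans[OF sum_abs] sum_mono)
      (auto simp: abs_mult power_abs intro!: divide_right_mono power_mono)
  also have "\<dots> \<le> exp a"
    using sum_le_suminf[of "\<lambda>j. a ^ j / fact j" "{..<N}"] exp_converges[of a] a
    by (auto simp: sums_iff divide_inverse mult.commute)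
  finally show ?thesis .
qed

lemma exp_weight_series:
  assumes W[measurable]: "W \<in> borel_measurable (Q x)" and D: "\<And>\<omega>. \<bar>W \<omega>\<bar> \<le> D"
    and Z[measurable]: "Z \<in> borel_measurable (Q x)" and C: "\<And>\<omega>. \<bar>Z \<omega>\<bar> \<le> C"
    and s: "0 \<le> s" "s \<le> e" "e \<le> s + 1"
  shows "(\<lambda>N. \<Sum>j<N. \<integral>\<omega>. Z \<omega> * (path_integral e \<omega> s ^ j / fact j * W \<omega>) \<partial>Q x)
     \<longlonglongrightarrow> (\<integral>\<omega>. Z \<omega> * (exp (path_integral e \<omega> s) * W \<omega>) \<partial>Q x)"
    and "\<bar>\<Sum>j<N. \<integral>\<omega>. Z \<omega> * (path_integral e \<omega> s ^ j / fact j * W \<omega>) \<partial>Q x\<bar> \<le> C * (exp A * D)"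
proof -
  interpret prob_space "Q x" by (rule prob_Q)
  let ?T = "\<lambda>\<omega>. path_integral e \<omega> s"
  note [measurable] = tail_path_weight_measurable[of e s x]
  have T: "\<bar>?T \<omega>\<bar> \<le> A" for \<omega> using s by (rule tail_path_weight_abs_le_A)
  have C0: "0 \<le> C" and D0: "0 \<le> D" using C[of undefined] D[of undefined] by linarith+
  have int: "integrable (Q x) (\<lambda>\<omega>. Z \<omega> * (?T \<omega> ^ j / fact j * W \<omega>))" for j
  proof (rule integrable_bounded_mult[OF Z _ C])
    show "\<bar>?T \<omega> ^ j / fact j * W \<omega>\<bar> \<le> A ^ j / fact j * D" for \<omega>
      using T[of \<omega>] D[of \<omega>] A0 D0 by (auto simp: abs_mult power_abs intro!: mult_mono divide_right_mono power_mono)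
  qed measurable
  define Y where "Y N \<omega> = Z \<omega> * ((\<Sum>j<N. ?T \<omega> ^ j / fact j) * W \<omega>)" for N \<omega>
  have sum_eq: "(\<Sum>j<N. \<integral>\<omega>. Z \<omega> * (?T \<omega> ^ j / fact j * W \<omega>) \<partial>Q x) = (\<integral>\<omega>. Y N \<omega> \<partial>Q x)" for N
    unfolding Y_def sum_distrib_right sum_distrib_left
    by (rule Bochner_Integration.integral_sum[symmetric]) (rule int)
  have Yb: "\<bar>Y N \<omega>\<bar> \<le> C * (exp A * D)" for N \<omega>
    unfolding Y_def abs_mult using C D C0 D0 exp_partial_sum_abs_le[OF T[of \<omega>], of N]
    by (intro mult_mono) auto
  have [measurable]: "Y N \<in> borel_measurable (Q x)" for N unfolding Y_def by measurable
  have "(\<lambda>N. \<integral>\<omega>. Y N \<omega> \<partial>Q x) \<longlonglongrightarrow> (\<integral>\<omega>. Z \<omega> * (exp (?T \<omega>) * W \<omega>) \<partial>Q x)"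
  proof (rule integral_dominated_convergence[where w="\<lambda>_. C * (exp A * D)"])
    show "AE \<omega> in Q x. (\<lambda>N. Y N \<omega>) \<longlonglongrightarrow> Z \<omega> * (exp (?T \<omega>) * W \<omega>)"
    proof (rule AE_I2)
      fix \<omega>
      have "(\<lambda>N. \<Sum>j<N. ?T \<omega> ^ j / fact j) \<longlonglongrightarrow> exp (?T \<omega>)"
        using exp_converges[of "?T \<omega>"] by (simp add: sums_def divide_inverse mult.commute)
      then show "(\<lambda>N. Y N \<omega>) \<longlonglongrightarrow> Z \<omega> * (exp (?T \<omega>) * W \<omega>)"
        unfolding Y_def by (intro tendsto_intros)
    qed
  qed (use Yb in auto)
  then show "(\<lambda>N. \<Sum>j<N. \<integral>\<omega>. Z \<omega> * (?T \<omega> ^ j / fact j * W \<omega>) \<partial>Q x)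
     \<longlonglongrightarrow> (\<integral>\<omega>. Z \<omega> * (exp (?T \<omega>) * W \<omega>) \<partial>Q x)"
    unfolding sum_eq .
  have "\<bar>\<integral>\<omega>. Y N \<omega> \<partial>Q x\<bar> \<le> (\<integral>\<omega>. C * (exp A * D) \<partial>Q x)"
    using Yb by (intro abs_integral_le) auto
  then show "\<bar>\<Sum>j<N. \<integral>\<omega>. Z \<omega> * (?T \<omega> ^ j / fact j * W \<omega>) \<partial>Q x\<bar> \<le> C * (exp A * D)"
    unfolding sum_eq by (simp add: prob_space)
qed

text \<open>\<open>Q\<close> is an arbitrary family of laws, so the measurability of \<open>process_op\<close> in the starting
  point is not immediate. It comes from the Dyson series, whose terms are integrals of transition kernels.\<close>

definition process_kernel :: "'e \<Rightarrow> 'e measure" where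
  "process_kernel x =
     distr (density (Q x) (\<lambda>\<omega>. ennreal (exp (path_integral 1 \<omega> 0)))) borel (X 1)"

definition process_op :: "('e \<Rightarrow> real) \<Rightarrow> 'e \<Rightarrow> real" where
  "process_op f x = (\<integral>y. f y \<partial>process_kernel x)"

lemma process_op_eq:
  assumes "f \<in> borel_measurable borel"
  shows "process_op f x = (\<integral>\<omega>. exp (path_integral 1 \<omega> 0) * f (X 1 \<omega>) \<partial>Q x)"
proof -
  note [measurable] = tail_path_weight_measurable[of 1 0 x] X_time[of 1 x, simplified] assms
  show ?thesis unfolding process_op_def process_kernel_def
    by (subst integral_distr) (auto simp: integral_density)
qed

lemma dyson_series:
  assumes g: "g \<in> bounded_borel" and B: "\<And>y. \<bar>g y\<bar> \<le> B"
  shows "(\<lambda>N. \<Sum>j<N. dyson P b g j 1 x) \<longlonglongrightarrow> process_op g x"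
    and "\<bar>\<Sum>j<N. dyson P b g j 1 x\<bar> \<le> exp A * B"
proof -
  have [measurable]: "g \<in> borel_measurable borel" using g by (simp add: bounded_borel_def)
  note [measurable] = X_time[of 1 x, simplified]
  have d: "dyson P b g j 1 x
      = (\<integral>\<omega>. 1 * (path_integral 1 \<omega> 0 ^ j / fact j * g (X 1 \<omega>)) \<partial>Q x)" for j
  proof -
    have "(\<integral>\<omega>. 1 * (path_integral 1 \<omega> 0 ^ j / fact j * g (X 1 \<omega>)) \<partial>Q x)
        = (\<integral>\<omega>. 1 * dyson P b g j (1 - 0) (X 0 \<omega>) \<partial>Q x)"
      using B by (intro dyson_expectation[OF g, where D=B and C=1]) auto
    also have "\<dots> = dyson P b g j 1 x"
      using markov_process_from_start[OF X_markov[of x] _ dyson_section(2)[OF g B, where t=1 and j=j]] by simp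
    finally show ?thesis ..
  qed
  have p: "process_op g x = (\<integral>\<omega>. 1 * (exp (path_integral 1 \<omega> 0) * g (X 1 \<omega>)) \<partial>Q x)"
    by (simp add: process_op_eq)
  show "(\<lambda>N. \<Sum>j<N. dyson P b g j 1 x) \<longlonglongrightarrow> process_op g x"
    unfolding d p using B by (intro exp_weight_series(1)[where D=B and C=1]) auto
  have "\<bar>\<Sum>j<N. dyson P b g j 1 x\<bar> \<le> 1 * (exp A * B)"
    unfolding d using B by (intro exp_weight_series(2)) auto
  then show "\<bar>\<Sum>j<N. dyson P b g j 1 x\<bar> \<le> exp A * B" by simp
qed

lemma positive_operator_process: "positive_operator process_op A"
  and process_kernel_finite: "finite_measure (process_kernel x)"
  and sets_process_kernel: "sets (process_kernel x) = sets borel"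
proof -
  have m1: "exp (- A) \<le> process_op (\<lambda>_. 1) x" "process_op (\<lambda>_. 1) x \<le> exp A" for x
  proof -
    interpret prob_space "Q x" by (rule prob_Q)
    note [measurable] = tail_path_weight_measurable[of 1 0 x]
    have T: "\<bar>path_integral 1 \<omega> 0\<bar> \<le> A" for \<omega> by (rule tail_path_weight_abs_le_A) auto
    then have T': "exp (- A) \<le> exp (path_integral 1 \<omega> 0)"
      "exp (path_integral 1 \<omega> 0) \<le> exp A" for \<omega>
      using T[of \<omega>] unfolding exp_le_cancel_iff abs_le_iff by linarith+
    have i: "integrable (Q x) (\<lambda>\<omega>. exp (path_integral 1 \<omega> 0))"
      using T' by (intro integrable_const_bound[of _ "exp A"]) auto
    have "(\<integral>\<omega>. exp (- A) \<partial>Q x) \<le> (\<integral>\<omega>. exp (path_integral 1 \<omega> 0) \<partial>Q x)"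
      using T' i by (intro integral_mono) auto
    then show "exp (- A) \<le> process_op (\<lambda>_. 1) x" by (simp add: process_op_eq prob_space)
    have "(\<integral>\<omega>. exp (path_integral 1 \<omega> 0) \<partial>Q x) \<le> (\<integral>\<omega>. exp A \<partial>Q x)"
      using T' i by (intro integral_mono) auto
    then show "process_op (\<lambda>_. 1) x \<le> exp A" by (simp add: process_op_eq prob_space)
  qed
  have sets: "sets (process_kernel x) = sets borel" for x by (simp add: process_kernel_def)
  have fin: "finite_measure (process_kernel x)" for x
  proof (rule finite_measureI)
    show "emeasure (process_kernel x) (space (process_kernel x)) \<noteq> \<infinity>"
    proof
      assume "emeasure (process_kernel x) (space (process_kernel x)) = \<infinity>"
      then have "process_op (\<lambda>_. 1) x = 0"
        by (simp add: process_op_def measure_def)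
      with m1(1)[of x] show False by (simp add: not_le[symmetric])
    qed
  qed
  have mass: "measure (process_kernel x) UNIV = process_op (\<lambda>_. 1) x" for x
    using sets_eq_imp_space_eq[OF sets[of x]] by (simp add: process_op_def)
  have "positive_operator (\<lambda>f x. \<integral>y. f y \<partial>process_kernel x) A"
  proof (rule positive_operator_kernel[OF fin sets])
    fix f :: "'e \<Rightarrow> real" assume f: "f \<in> bounded_borel"
    obtain B where B: "\<And>y. \<bar>f y\<bar> \<le> B" using f by (meson bounded_borelE)
    have [measurable]: "dyson P b f j 1 \<in> borel_measurable borel" for j
      by (rule bounded_borel_measurable[OF dyson_section(2)[OF f B]]) simp
    have "(\<lambda>x. process_op f x) \<in> borel_measurable borel"
      by (rule borel_measurable_LIMSEQ_real[OF dyson_series(1)[OF f B]]) measurable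
    then show "(\<lambda>x. \<integral>y. f y \<partial>process_kernel x) \<in> borel_measurable borel"
      by (simp add: process_op_def)
  qed (simp_all add: mass m1)
  then show "positive_operator process_op A" by (simp add: process_op_def[abs_def])
  show "finite_measure (process_kernel x)" "sets (process_kernel x) = sets borel" by (rule fin sets)+
qed

text \<open>The same series represents the mean of the weighted variable given the past of \<open>s\<close>, at the
  position \<open>X s\<close>, and the mean from the starting point \<open>y\<close>, at \<open>y\<close>. This replaces a restart of the process at time \<open>s\<close>.\<close>

lemma process_op_conditional:
  assumes g: "g \<in> bounded_borel"
    and W: "W \<in> borel_measurable (Q x)" and W_le: "\<And>\<omega>. \<bar>W \<omega>\<bar> \<le> D"
    and W_cond: "\<And>Z C. Z \<in> borel_measurable (past x (s + 1)) \<Longrightarrow> (\<And>\<omega>. \<bar>Z \<omega>\<bar> \<le> C) \<Longrightarrow>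
        (\<integral>\<omega>. Z \<omega> * W \<omega> \<partial>Q x) = (\<integral>\<omega>. Z \<omega> * g (X (s + 1) \<omega>) \<partial>Q x)"
    and s: "0 \<le> s"
    and Z: "Z \<in> borel_measurable (past x s)" and C: "\<And>\<omega>. \<bar>Z \<omega>\<bar> \<le> C"
  shows "(\<integral>\<omega>. Z \<omega> * (exp (path_integral (s + 1) \<omega> s) * W \<omega>) \<partial>Q x)
       = (\<integral>\<omega>. Z \<omega> * process_op g (X s \<omega>) \<partial>Q x)"
proof (rule LIMSEQ_unique)
  interpret prob_space "Q x" by (rule prob_Q)
  obtain B where B: "\<And>y. \<bar>g y\<bar> \<le> B" using g by (meson bounded_borelE)
  have [measurable]: "Z \<in> borel_measurable (Q x)" by (rule filtration_measurable_Q[OF Z])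
  have [measurable]: "X s \<in> measurable (Q x) borel" using s by (rule X_time)
  have [measurable]: "dyson P b g j 1 \<in> borel_measurable borel" for j
    by (rule bounded_borel_measurable[OF dyson_section(2)[OF g B]]) simp
  have [measurable]: "process_op g \<in> borel_measurable borel"
    by (rule bounded_borel_measurable[OF positive_operator.closed[OF positive_operator_process g]])
  have C0: "0 \<le> C" using C[of undefined] by linarith
  have d: "(\<integral>\<omega>. Z \<omega> * (path_integral (s + 1) \<omega> s ^ j / fact j * W \<omega>) \<partial>Q x)
      = (\<integral>\<omega>. Z \<omega> * dyson P b g j 1 (X s \<omega>) \<partial>Q x)" for j
  proof -
    have "(\<integral>\<omega>. Z \<omega> * (path_integral (s + 1) \<omega> s ^ j / fact j * W \<omega>) \<partial>Q x)
      = (\<integral>\<omega>. Z \<omega> * dyson P b g j (s + 1 - s) (X s \<omega>) \<partial>Q x)"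
    proof (rule dyson_expectation[OF g W W_le])
      fix Z' :: "'w \<Rightarrow> real" and C'
      assume "Z' \<in> borel_measurable (past x (s + 1))" "\<And>\<omega>. \<bar>Z' \<omega>\<bar> \<le> C'"
      then show "(\<integral>\<omega>. Z' \<omega> * W \<omega> \<partial>Q x) = (\<integral>\<omega>. Z' \<omega> * g (X (s + 1) \<omega>) \<partial>Q x)" by (rule W_cond)
    qed (use s Z C in auto)
    then show ?thesis by simp
  qed
  have sum_eq: "(\<Sum>j<N. \<integral>\<omega>. Z \<omega> * dyson P b g j 1 (X s \<omega>) \<partial>Q x)
      = (\<integral>\<omega>. Z \<omega> * (\<Sum>j<N. dyson P b g j 1 (X s \<omega>)) \<partial>Q x)" for N
    unfolding sum_distrib_left
    by (rule Bochner_Integration.integral_sum[symmetric], rule integrable_bounded_mult[OF _ _ C dyson_section(1)[OF g B]])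
      measurable
  show "(\<lambda>N. \<Sum>j<N. \<integral>\<omega>. Z \<omega> * (path_integral (s + 1) \<omega> s ^ j / fact j * W \<omega>) \<partial>Q x)
      \<longlonglongrightarrow> (\<integral>\<omega>. Z \<omega> * (exp (path_integral (s + 1) \<omega> s) * W \<omega>) \<partial>Q x)"
    using s by (intro exp_weight_series(1)[OF W W_le _ C]) auto
  show "(\<lambda>N. \<Sum>j<N. \<integral>\<omega>. Z \<omega> * (path_integral (s + 1) \<omega> s ^ j / fact j * W \<omega>) \<partial>Q x)
      \<longlonglongrightarrow> (\<integral>\<omega>. Z \<omega> * process_op g (X s \<omega>) \<partial>Q x)"
    unfolding d sum_eq
  proof (rule integral_dominated_convergence[where w="\<lambda>_. C * (exp A * B)"])
    show "AE \<omega> in Q x. (\<lambda>N. Z \<omega> * (\<Sum>j<N. dyson P b g j 1 (X s \<omega>))) \<longlonglongrightarrow> Z \<omega> * process_op g (X s \<omega>)"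
      by (intro AE_I2 tendsto_mult_left dyson_series(1)[OF g B])
    show "AE \<omega> in Q x. norm (Z \<omega> * (\<Sum>j<N. dyson P b g j 1 (X s \<omega>))) \<le> C * (exp A * B)" for N
      using C dyson_series(2)[OF g B] C0 by (auto simp: abs_mult intro!: mult_mono)
  qed auto
qed

lemma tail_path_weight_split:
  assumes "0 \<le> s" "s \<le> e" "e \<le> t" and \<omega>: "\<omega> \<in> space (Q x)"
  shows "path_integral t \<omega> s
       = path_integral e \<omega> s + path_integral t \<omega> e"
proof -
  have i: "integrable lborel (\<lambda>r. indicator {a<..} r * path_weight X b u \<omega> r)" for a u
    by (rule Bochner_Integration.integrable_bound[OF path_weight_integrable[OF \<omega>, of u]])
      (use path_weight_integrable[OF \<omega>, of u] in \<open>auto simp: indicator_def\<close>)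
  have "path_integral e \<omega> s + path_integral t \<omega> e
      = (\<integral>r. indicator {s<..} r * path_weight X b e \<omega> r + indicator {e<..} r * path_weight X b t \<omega> r \<partial>lborel)"
    unfolding tail_integral_def by (rule Bochner_Integration.integral_add[symmetric, OF i i])
  also have "\<dots> = path_integral t \<omega> s"
    unfolding tail_integral_def using assms(1-3)
    by (intro Bochner_Integration.integral_cong) (auto simp: path_weight_def indicator_def)
  finally show ?thesis ..
qed

text \<open>The induction removes unit intervals from the start of the remaining time \<open>{n - j..n}\<close>. The weight of the later
  interval is part of \<open>W\<close>, for which measurability suffices. Proceeding forwards would need the
  weight of the past to be adapted, which joint measurability of the paths does not give.\<close>

lemma process_expectation_conditional:
  assumes g: "g \<in> bounded_borel" and j: "j \<le> n"
    and Z: "Z \<in> borel_measurable (past x (real n - real j))"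
    and C: "\<And>\<omega>. \<bar>Z \<omega>\<bar> \<le> C"
  shows "(\<integral>\<omega>. Z \<omega> * (exp (path_integral (real n) \<omega> (real n - real j)) * g (X (real n) \<omega>)) \<partial>Q x)
       = (\<integral>\<omega>. Z \<omega> * (process_op ^^ j) g (X (real n - real j) \<omega>) \<partial>Q x)"
  using j Z C
proof (induction j arbitrary: Z C)
  case 0
  have "path_integral (real n) \<omega> (real n) = 0" for \<omega>
    using tail_path_weight_abs_le[of "real n" "real n" \<omega>] by simp
  then show ?case by simp
next
  case (Suc j)
  interpret S: positive_operator process_op A by (rule positive_operator_process)
  interpret Sj: positive_operator "process_op ^^ j" "real j * A" by (rule S.positive_operator_funpow)
  obtain B where B: "\<And>y. \<bar>g y\<bar> \<le> B" "0 < B" using g by (meson bounded_borelE)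
  have [measurable]: "g \<in> borel_measurable borel" using g by (simp add: bounded_borel_def)
  define s where "s = real n - real (Suc j)"
  have s: "0 \<le> s" "s + 1 = real n - real j" "s + 1 \<le> real n" using Suc.prems(1) by (auto simp: s_def)
  note [measurable] = tail_path_weight_measurable[of "real n" "s + 1" x] X_time[of "real n" x, simplified]
  define W where "W \<omega> = exp (path_integral (real n) \<omega> (s + 1)) * g (X (real n) \<omega>)" for \<omega>
  have Wm: "W \<in> borel_measurable (Q x)" unfolding W_def by measurable
  have W_le: "\<bar>W \<omega>\<bar> \<le> exp (A * (real n - (s + 1))) * B" for \<omega>
  proof -
    have "path_integral (real n) \<omega> (s + 1) \<le> A * (real n - (s + 1))"
      using tail_path_weight_abs_le[of "s + 1" "real n" \<omega>] s by (simp add: abs_le_iff)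
    then show ?thesis unfolding W_def abs_mult using B by (intro mult_mono) auto
  qed
  have "(\<integral>\<omega>. Z \<omega> * (exp (path_integral (real n) \<omega> s) * g (X (real n) \<omega>)) \<partial>Q x)
      = (\<integral>\<omega>. Z \<omega> * (exp (path_integral (s + 1) \<omega> s) * W \<omega>) \<partial>Q x)"
  proof (rule Bochner_Integration.integral_cong[OF refl])
    fix \<omega> assume "\<omega> \<in> space (Q x)"
    then show "Z \<omega> * (exp (path_integral (real n) \<omega> s) * g (X (real n) \<omega>))
        = Z \<omega> * (exp (path_integral (s + 1) \<omega> s) * W \<omega>)"
      using tail_path_weight_split[of s "s + 1" "real n" \<omega> x] s by (simp add: W_def exp_add)
  qed
  also have "\<dots> = (\<integral>\<omega>. Z \<omega> * process_op ((process_op ^^ j) g) (X s \<omega>) \<partial>Q x)"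
  proof (rule process_op_conditional[OF Sj.closed[OF g] Wm W_le _ s(1)])
    fix Z' :: "'w \<Rightarrow> real" and C'
    assume "Z' \<in> borel_measurable (past x (s + 1))" "\<And>\<omega>. \<bar>Z' \<omega>\<bar> \<le> C'"
    then show "(\<integral>\<omega>. Z' \<omega> * W \<omega> \<partial>Q x) = (\<integral>\<omega>. Z' \<omega> * (process_op ^^ j) g (X (s + 1) \<omega>) \<partial>Q x)"
      using Suc.IH[of Z' C'] Suc.prems(1) unfolding W_def s(2) by simp
  qed (use Suc.prems in \<open>auto simp: s_def\<close>)
  finally show ?case by (simp add: s_def)
qed

theorem process_expectation:
  assumes g: "g \<in> bounded_borel"
  shows "(\<integral>\<omega>. exp (path_integral (real n) \<omega> 0) * g (X (real n) \<omega>) \<partial>Q x) = (process_op ^^ n) g x"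
proof -
  have "(\<integral>\<omega>. 1 * (exp (path_integral (real n) \<omega> (real n - real n)) * g (X (real n) \<omega>)) \<partial>Q x)
       = (\<integral>\<omega>. 1 * (process_op ^^ n) g (X (real n - real n) \<omega>) \<partial>Q x)"
    by (rule process_expectation_conditional[OF g order_refl, where Z="\<lambda>_. 1" and C=1]) auto
  moreover have "(process_op ^^ n) g \<in> bounded_borel"
    by (rule positive_operator.closed[OF positive_operator.positive_operator_funpow[OF positive_operator_process] g])
  ultimately show ?thesis using markov_process_from_start[OF X_markov, of "(process_op ^^ n) g" x] by simp
qed

text \<open>Between \<open>\<lfloor>t\<rfloor>\<close> and \<open>t\<close> the additive functional changes by \<open>A\<close> at most.\<close>

lemma process_expectation_real_time:
  assumes t: "0 \<le> t"
  shows "\<bar>ln (\<integral>\<omega>. exp (path_integral t \<omega> 0) \<partial>Q x) - ln ((process_op ^^ nat \<lfloor>t\<rfloor>) (\<lambda>_. 1) x)\<bar> \<le> A"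
proof -
  interpret prob_space "Q x" by (rule prob_Q)
  define n where "n = nat \<lfloor>t\<rfloor>"
  have n: "real n \<le> t" "t \<le> real n + 1" using t by (auto simp: n_def)
  let ?E = "\<lambda>t \<omega>. exp (path_integral t \<omega> 0)"
  have int: "integrable (Q x) (?E t)" if "0 \<le> t" for t
  proof (rule integrable_const_bound[of _ "exp (A * t)"])
    note [measurable] = tail_path_weight_measurable[of t 0 x]
    show "?E t \<in> borel_measurable (Q x)" by measurable
    show "AE \<omega> in Q x. norm (?E t \<omega>) \<le> exp (A * t)"
      using tail_path_weight_abs_le[of 0 t] that by (auto simp: abs_le_iff)
  qed
  have S: "(process_op ^^ n) (\<lambda>_. 1) x = (\<integral>\<omega>. ?E (real n) \<omega> \<partial>Q x)"
    using process_expectation[where g="\<lambda>_. 1" and n=n and x=x] by simp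
  have diff: "exp (- A) * ?E (real n) \<omega> \<le> ?E t \<omega>" "?E t \<omega> \<le> exp A * ?E (real n) \<omega>" if "\<omega> \<in> space (Q x)" for \<omega>
    using tail_path_weight_split[of 0 "real n" t \<omega> x] that n tail_path_weight_abs_le_A[of "real n" t \<omega>]
    unfolding exp_add[symmetric] by (auto simp: abs_le_iff)
  show ?thesis unfolding n_def[symmetric]
  proof (rule abs_ln_diff_le)
    have "exp (- (real n * A)) \<le> (process_op ^^ n) (\<lambda>_. 1) x"
      by (rule positive_operator.one_lower[OF positive_operator.positive_operator_funpow[OF positive_operator_process]])
    then show "0 < (process_op ^^ n) (\<lambda>_. 1) x" by (meson exp_gt_zero less_le_trans)
    have "(\<integral>\<omega>. exp (- A) * ?E (real n) \<omega> \<partial>Q x) \<le> (\<integral>\<omega>. ?E t \<omega> \<partial>Q x)"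
      using diff int t by (intro integral_mono integrable_mult_right) auto
    then show "exp (- A) * (process_op ^^ n) (\<lambda>_. 1) x \<le> (\<integral>\<omega>. ?E t \<omega> \<partial>Q x)" unfolding S by simp
    have "(\<integral>\<omega>. ?E t \<omega> \<partial>Q x) \<le> (\<integral>\<omega>. exp A * ?E (real n) \<omega> \<partial>Q x)"
      using diff int t by (intro integral_mono integrable_mult_right) auto
    then show "(\<integral>\<omega>. ?E t \<omega> \<partial>Q x) \<le> exp A * (process_op ^^ n) (\<lambda>_. 1) x" unfolding S by simp
  qed
qed

end

section \<open>The functionals of the controlled systems\<close>

locale controlled_chain =
  fixes Pd :: "nat \<Rightarrow> 'a \<Rightarrow> 'e::topological_space \<Rightarrow> 'e measure" and m :: nat
    and Q :: "'e \<Rightarrow> 'w measure" and Y :: "nat \<Rightarrow> 'w \<Rightarrow> 'e"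
    and \<alpha> :: real and c :: "'e \<Rightarrow> 'a \<Rightarrow> real" and v :: "'e \<Rightarrow> 'a" and A :: real
  assumes kernel: "control_kernel Pd m v \<in> measurable borel (prob_algebra borel)"
    and Y_markov: "\<And>x. markov_process_from UNIV (kernel_power (control_kernel Pd m v)) x (Q x) Y"
    and reward: "(\<lambda>x. c x (v x)) \<in> bounded_borel"
    and A: "\<And>x. \<bar>\<alpha> * c x (v x)\<bar> \<le> A"
begin

definition step_op :: "('e \<Rightarrow> real) \<Rightarrow> 'e \<Rightarrow> real" where
  "step_op = weighted_step (1 / 2 ^ m) (\<lambda>x. \<alpha> * c x (v x)) (control_kernel Pd m v)"

definition chain_op :: "('e \<Rightarrow> real) \<Rightarrow> 'e \<Rightarrow> real" where
  "chain_op = step_op ^^ 2 ^ m"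

lemma positive_operator_step: "positive_operator step_op (1 / 2 ^ m * A)"
  unfolding step_op_def
  by (rule positive_operator_weighted_step[OF kernel _ bounded_borel_cmult[OF reward] A]) simp

lemma positive_operator_chain: "positive_operator chain_op A"
  using positive_operator.positive_operator_funpow[OF positive_operator_step, of "2 ^ m"]
  by (simp add: chain_op_def)

lemma reward_sum_expectation:
  assumes "f \<in> bounded_borel"
  shows "(\<integral>\<omega>. exp (\<alpha> * reward_sum c v (1 / 2 ^ m) Y n \<omega>) * f (Y n \<omega>) \<partial>Q x) = (step_op ^^ n) f x"
proof -
  have "\<alpha> * reward_sum c v (1 / 2 ^ m) Y n \<omega> = (\<Sum>i<n. 1 / 2 ^ m * (\<alpha> * c (Y i \<omega>) (v (Y i \<omega>))))" for \<omega>
    unfolding reward_sum_def sum_distrib_left by (rule sum.cong) auto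
  then show ?thesis
    using chain_expectation[OF Y_markov kernel _ bounded_borel_cmult[OF reward] assms, where h="1 / 2 ^ m" and n=n and x=x]
    by (simp add: step_op_def)
qed

lemma Y_measurable: "Y i \<in> measurable (Q x) borel"
  using Y_markov[of x] by (simp add: markov_process_from_def)

lemma reward_sum_measurable: "reward_sum c v h Y n \<in> borel_measurable (Q x)"
proof -
  note [measurable] = bounded_borel_measurable[OF reward] Y_measurable[of _ x]
  have [measurable]: "(\<lambda>\<omega>. c (Y i \<omega>) (v (Y i \<omega>))) \<in> borel_measurable (Q x)" for i
    by (rule measurable_compose[OF Y_measurable bounded_borel_measurable[OF reward]])
  show ?thesis unfolding reward_sum_def[abs_def] by measurable
qed

lemma integral_weighted_disc:
  assumes f: "f \<in> bounded_borel"
  shows "(\<integral>y. f y \<partial>weighted_disc \<alpha> c v m (Q x) Y) = chain_op f x"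
proof -
  note [measurable] = bounded_borel_measurable[OF f] Y_measurable[of _ x] reward_sum_measurable[of _ _ x]
  have "(\<integral>y. f y \<partial>weighted_disc \<alpha> c v m (Q x) Y)
      = (\<integral>\<omega>. exp (\<alpha> * reward_sum c v (1 / 2 ^ m) Y (2 ^ m) \<omega>) * f (Y (2 ^ m) \<omega>) \<partial>Q x)"
    unfolding weighted_disc_def by (subst integral_distr) (auto simp: integral_density)
  then show ?thesis unfolding reward_sum_expectation[OF f] chain_op_def .
qed

lemma finite_weighted_disc: "finite_measure (weighted_disc \<alpha> c v m (Q x) Y)"
proof (rule finite_measureI, rule notI)
  let ?N = "weighted_disc \<alpha> c v m (Q x) Y"
  assume "emeasure ?N (space ?N) = \<infinity>"
  then have "chain_op (\<lambda>_. 1) x = 0"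
    using integral_weighted_disc[of "\<lambda>_. 1" x] by (simp add: measure_def)
  then show False
    using positive_operator.one_lower[OF positive_operator_chain, of x] by (simp add: not_le[symmetric])
qed

lemma mpe_disc_iff: "mpe_disc \<alpha> c v m Q Y l \<longleftrightarrow> eigen_rate \<alpha> chain_op l"
proof -
  have "(\<integral>\<omega>. exp (\<alpha> * (\<Sum>i<2 ^ m. 1 / 2 ^ m * (c (Y i \<omega>) (v (Y i \<omega>)) - l)) + \<alpha> * w (Y (2 ^ m) \<omega>)) \<partial>Q x)
      = exp (- (\<alpha> * l)) * chain_op (\<lambda>y. exp (\<alpha> * w y)) x" if w: "w \<in> bounded_borel" for w x
  proof -
    have "(\<Sum>i<2 ^ m. 1 / 2 ^ m * (c (Y i \<omega>) (v (Y i \<omega>)) - l)) = reward_sum c v (1 / 2 ^ m) Y (2 ^ m) \<omega> - l" for \<omega>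
      by (simp add: reward_sum_def right_diff_distrib sum_subtractf)
    then have "exp (\<alpha> * (\<Sum>i<2 ^ m. 1 / 2 ^ m * (c (Y i \<omega>) (v (Y i \<omega>)) - l)) + \<alpha> * w (Y (2 ^ m) \<omega>))
        = exp (- (\<alpha> * l)) * (exp (\<alpha> * reward_sum c v (1 / 2 ^ m) Y (2 ^ m) \<omega>) * exp (\<alpha> * w (Y (2 ^ m) \<omega>)))" for \<omega>
      unfolding exp_add[symmetric] by (simp only: right_diff_distrib) simp
    then show ?thesis
      using reward_sum_expectation[OF bounded_borel_exp[OF w, of \<alpha>], where n="2 ^ m" and x=x] by (simp add: chain_op_def)
  qed
  then show ?thesis unfolding mpe_disc_def eigen_rate_def by (intro bex_cong) auto
qed

text \<open>Write \<open>n = q * 2 ^ m + r\<close>. The last \<open>r\<close> steps take less than one unit of time and cost a factor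
  between \<open>exp (- A)\<close> and \<open>exp A\<close>; the others form the \<open>q\<close>-th power of \<open>chain_op\<close>.\<close>

lemma I_disc_eq:
  assumes \<alpha>: "\<alpha> \<noteq> 0" and h: "harnack_operator chain_op A k L" and l: "eigen_rate \<alpha> chain_op l"
  shows "I_disc \<alpha> c v (1 / 2 ^ m) (Q x) Y = ereal l"
proof -
  interpret T: positive_operator step_op "1 / 2 ^ m * A" by (rule positive_operator_step)
  define N :: nat where "N = 2 ^ m"
  have N: "0 < N" "real N = 2 ^ m" by (auto simp: N_def)
  let ?a = "\<lambda>n. ln ((step_op ^^ n) (\<lambda>_. 1) x)"
  have A0: "0 \<le> A" using A[of undefined] by linarith
  have bound: "\<bar>?a n - real n * (1 / 2 ^ m) * (\<alpha> * l)\<bar> \<le> A + ln L + \<bar>\<alpha> * l\<bar>" for n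
  proof -
    define q r where "q = n div N" and "r = n mod N"
    have n: "n = q * N + r" and r: "r < N" using N(1) unfolding q_def r_def by simp_all
    interpret R: positive_operator "step_op ^^ r" "real r * (1 / 2 ^ m * A)"
      by (rule T.positive_operator_funpow)
    interpret S: positive_operator "chain_op ^^ q" "real q * A"
      by (rule positive_operator.positive_operator_funpow[OF positive_operator_chain])
    have rA: "real r * (1 / 2 ^ m * A) \<le> A"
    proof -
      have "real r * (1 / 2 ^ m) \<le> 1" using r N by (simp add: field_simps flip: N(2))
      then have "real r * (1 / 2 ^ m) * A \<le> 1 * A" using A0 by (rule mult_right_mono)
      then show ?thesis by simp
    qed
    have pw: "(step_op ^^ n) (\<lambda>_. 1) = (chain_op ^^ q) ((step_op ^^ r) (\<lambda>_. 1))"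
      unfolding n chain_op_def by (simp add: funpow_add funpow_mult N_def mult.commute)
    have Rcl: "(step_op ^^ r) (\<lambda>_. 1) \<in> bounded_borel" by (rule R.closed) simp
    have Rb: "exp (- A) \<le> (step_op ^^ r) (\<lambda>_. 1) y" "(step_op ^^ r) (\<lambda>_. 1) y \<le> exp A" for y
      using R.one_lower[of y] R.one_upper[of y] rA
      by (auto elim!: order_trans[rotated] intro: order_trans)
    have "\<bar>?a n - ln ((chain_op ^^ q) (\<lambda>_. 1) x)\<bar> \<le> A"
      unfolding pw
    proof (rule abs_ln_diff_le)
      show "0 < (chain_op ^^ q) (\<lambda>_. 1) x" by (rule harnack_operator.power_one_pos[OF h])
      have "exp (- A) * (chain_op ^^ q) (\<lambda>_. 1) x = (chain_op ^^ q) (\<lambda>_. exp (- A) * 1) x"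
        by (rule S.scale[symmetric]) simp
      also have "\<dots> \<le> (chain_op ^^ q) ((step_op ^^ r) (\<lambda>_. 1)) x"
        using Rb by (intro S.mono Rcl) auto
      finally show "exp (- A) * (chain_op ^^ q) (\<lambda>_. 1) x \<le> (chain_op ^^ q) ((step_op ^^ r) (\<lambda>_. 1)) x" .
      have "(chain_op ^^ q) ((step_op ^^ r) (\<lambda>_. 1)) x \<le> (chain_op ^^ q) (\<lambda>_. exp A * 1) x"
        using Rb by (intro S.mono Rcl) auto
      also have "\<dots> = exp A * (chain_op ^^ q) (\<lambda>_. 1) x" by (rule S.scale) simp
      finally show "(chain_op ^^ q) ((step_op ^^ r) (\<lambda>_. 1)) x \<le> exp A * (chain_op ^^ q) (\<lambda>_. 1) x" .
    qed
    moreover have "\<bar>ln ((chain_op ^^ q) (\<lambda>_. 1) x) - real q * (\<alpha> * l)\<bar> \<le> ln L"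
      by (rule harnack_operator.eigen_rate_growth[OF h l])
    moreover have "\<bar>real q * (\<alpha> * l) - real n * (1 / 2 ^ m) * (\<alpha> * l)\<bar> \<le> \<bar>\<alpha> * l\<bar>"
    proof -
      have "real n * (1 / 2 ^ m) = real q + real r / real N" unfolding n using N by (simp add: field_simps flip: N(2))
      then have "real q * (\<alpha> * l) - real n * (1 / 2 ^ m) * (\<alpha> * l) = - (real r / real N) * (\<alpha> * l)"
        by (simp add: algebra_simps)
      then have "\<bar>real q * (\<alpha> * l) - real n * (1 / 2 ^ m) * (\<alpha> * l)\<bar> = real r / real N * \<bar>\<alpha> * l\<bar>"
        by (simp add: abs_mult)
      also have "\<dots> \<le> 1 * \<bar>\<alpha> * l\<bar>" using r N by (intro mult_right_mono) auto
      finally show ?thesis by simp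
    qed
    ultimately show ?thesis by linarith
  qed
  have "(\<integral>\<omega>. exp (\<alpha> * reward_sum c v (1 / 2 ^ m) Y n \<omega>) \<partial>Q x) = (step_op ^^ n) (\<lambda>_. 1) x" for n
    using reward_sum_expectation[where f="\<lambda>_. 1" and n=n and x=x] by simp
  moreover have "liminf (\<lambda>n. ereal (1 / \<alpha> * (1 / (real n * (1 / 2 ^ m))) * ?a n)) = ereal l"
  proof (rule Liminf_linear_growth[OF \<alpha>])
    show "filterlim (\<lambda>n. real n * (1 / 2 ^ m)) at_top sequentially"
      by (rule filterlim_at_top_mult_tendsto_pos[OF tendsto_const _ filterlim_real_sequentially]) simp
    show "eventually (\<lambda>n. \<bar>?a n - real n * (1 / 2 ^ m) * (\<alpha> * l)\<bar> \<le> A + ln L + \<bar>\<alpha> * l\<bar>) sequentially"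
      using bound by simp
  qed simp
  ultimately show ?thesis by (simp add: I_disc_def)
qed

end

locale controlled_process =
  fixes P :: "real \<Rightarrow> 'e::topological_space \<Rightarrow> 'e measure" and Q :: "'e \<Rightarrow> 'w measure"
    and X :: "real \<Rightarrow> 'w \<Rightarrow> 'e"
    and \<alpha> :: real and c :: "'e \<Rightarrow> 'a \<Rightarrow> real" and v :: "'e \<Rightarrow> 'a" and A :: real
  assumes P_kernel':
      "(\<lambda>(t, x). P t x) \<in> measurable (restrict_space borel {0..} \<Otimes>\<^sub>M borel) (prob_algebra borel)"
    and X_measurable': "\<And>x. (\<lambda>(t, \<omega>). X t \<omega>) \<in> measurable (restrict_space borel {0..} \<Otimes>\<^sub>M Q x) borel"
    and X_markov': "\<And>x. markov_process_from {0..} P x (Q x) X"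
    and reward: "(\<lambda>x. c x (v x)) \<in> bounded_borel"
    and A': "\<And>x. \<bar>\<alpha> * c x (v x)\<bar> \<le> A"

sublocale controlled_process \<subseteq> weighted_process P Q X "\<lambda>x. \<alpha> * c x (v x)" A
  by unfold_locales (rule P_kernel' X_measurable' X_markov' bounded_borel_cmult reward A')+

context controlled_process
begin

lemma path_reward_measurable:
  assumes "\<omega> \<in> space (Q x)"
  shows "(\<lambda>s. c (X (max 0 s) \<omega>) (v (X (max 0 s) \<omega>))) \<in> borel_measurable borel"
proof -
  have "(\<lambda>s. X (max 0 s) \<omega>) \<in> measurable borel borel"
    using measurable_compose[OF measurable_Pair2'[OF assms] X_joint] by simp
  from measurable_compose[OF this bounded_borel_measurable[OF reward]] show ?thesis .
qed

lemma set_integrable_path_reward: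
  assumes \<omega>: "\<omega> \<in> space (Q x)"
  shows "set_integrable lborel {0..t} (\<lambda>s. c (X s \<omega>) (v (X s \<omega>)))"
  unfolding set_integrable_def
proof -
  note [measurable] = path_reward_measurable[OF \<omega>]
  obtain C where C: "\<And>y. \<bar>c y (v y)\<bar> \<le> C" using reward by (meson bounded_borelE)
  have "integrable lborel (\<lambda>s. indicator {0..t} s * c (X (max 0 s) \<omega>) (v (X (max 0 s) \<omega>)))"
  proof (rule Bochner_Integration.integrable_bound)
    show "integrable lborel (\<lambda>s. indicator {0..t} s * C)"
      by (intro integrable_mult_left integrable_real_indicator; cases "0 \<le> t") auto
  qed (use C in \<open>auto simp: indicator_def intro!: AE_I2 order_trans[OF C abs_ge_self]\<close>)
  also have "(\<lambda>s. indicator {0..t} s * c (X (max 0 s) \<omega>) (v (X (max 0 s) \<omega>)))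
      = (\<lambda>s. indicator {0..t} s *\<^sub>R c (X s \<omega>) (v (X s \<omega>)))"
    by (auto simp: indicator_def fun_eq_iff max_def)
  finally show "integrable lborel (\<lambda>s. indicator {0..t} s *\<^sub>R c (X s \<omega>) (v (X s \<omega>)))" .
qed

lemma reward_integral_eq:
  assumes \<omega>: "\<omega> \<in> space (Q x)"
  shows "\<alpha> * reward_integral c v X t \<omega> = path_integral t \<omega> 0"
proof -
  note [measurable] = path_reward_measurable[OF \<omega>]
  have "\<alpha> * reward_integral c v X t \<omega>
      = (\<integral>s. \<alpha> * (indicator {0..t} s * c (X (max 0 s) \<omega>) (v (X (max 0 s) \<omega>))) \<partial>lborel)"
    unfolding reward_integral_def set_lebesgue_integral_def
    by (subst integral_mult_right_zero)
      (auto intro!: Bochner_Integration.integral_cong simp: indicator_def max_def)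
  also have "\<dots> = (\<integral>s. (if 0 < s \<and> s \<le> t then \<alpha> * c (X (max 0 s) \<omega>) (v (X (max 0 s) \<omega>)) else 0) \<partial>lborel)"
  proof (rule integral_cong_AE)
    show "AE s in lborel. \<alpha> * (indicator {0..t} s * c (X (max 0 s) \<omega>) (v (X (max 0 s) \<omega>)))
        = (if 0 < s \<and> s \<le> t then \<alpha> * c (X (max 0 s) \<omega>) (v (X (max 0 s) \<omega>)) else 0)"
      using AE_lborel_singleton[of "0::real"] by eventually_elim (auto simp: indicator_def)
  qed measurable
  also have "\<dots> = path_integral t \<omega> 0"
    unfolding tail_integral_def path_weight_def
    by (rule Bochner_Integration.integral_cong) (auto simp: indicator_def)
  finally show ?thesis .
qed

lemma weighted_cont_eq: "weighted_cont \<alpha> c v (Q x) X = process_kernel x"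
proof -
  note [measurable] = tail_path_weight_measurable[of 1 0 x]
  have "density (Q x) (\<lambda>\<omega>. ennreal (exp (\<alpha> * reward_integral c v X 1 \<omega>)))
      = density (Q x) (\<lambda>\<omega>. ennreal (exp (path_integral 1 \<omega> 0)))"
  proof (rule density_cong)
    have "(\<lambda>\<omega>. ennreal (exp (\<alpha> * reward_integral c v X 1 \<omega>))) \<in> borel_measurable (Q x) \<longleftrightarrow>
        (\<lambda>\<omega>. ennreal (exp (path_integral 1 \<omega> 0))) \<in> borel_measurable (Q x)"
      by (rule measurable_cong) (simp add: reward_integral_eq)
    then show "(\<lambda>\<omega>. ennreal (exp (\<alpha> * reward_integral c v X 1 \<omega>))) \<in> borel_measurable (Q x)" by simp
  qed (auto intro!: AE_I2 simp: reward_integral_eq)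
  then show ?thesis by (simp add: weighted_cont_def process_kernel_def)
qed

lemma mpe_cont_iff: "mpe_cont \<alpha> c v Q X l \<longleftrightarrow> eigen_rate \<alpha> process_op l"
proof -
  have "(\<integral>\<omega>. exp (\<alpha> * (LINT s:{0..1}|lborel. c (X s \<omega>) (v (X s \<omega>)) - l) + \<alpha> * w (X 1 \<omega>)) \<partial>Q x)
      = exp (- (\<alpha> * l)) * process_op (\<lambda>y. exp (\<alpha> * w y)) x" if w: "w \<in> bounded_borel" for w x
  proof -
    have *: "exp (\<alpha> * (LINT s:{0..1}|lborel. c (X s \<omega>) (v (X s \<omega>)) - l) + \<alpha> * w (X 1 \<omega>))
        = exp (- (\<alpha> * l)) * (exp (path_integral 1 \<omega> 0) * exp (\<alpha> * w (X 1 \<omega>)))"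
      if \<omega>: "\<omega> \<in> space (Q x)" for \<omega>
    proof -
      have "set_integrable lborel {0..1::real} (\<lambda>_. l)" by (simp add: set_integrable_def)
      then have "(LINT s:{0..1}|lborel. c (X s \<omega>) (v (X s \<omega>)) - l)
          = (LINT s:{0..1}|lborel. c (X s \<omega>) (v (X s \<omega>))) - (LINT s:{0..1::real}|lborel. l)"
        by (rule set_integral_diff(2)[OF set_integrable_path_reward[OF \<omega>]])
      also have "(LINT s:{0..1::real}|lborel. l) = l" by (simp add: set_lebesgue_integral_def)
      finally have "\<alpha> * (LINT s:{0..1}|lborel. c (X s \<omega>) (v (X s \<omega>)) - l)
          = path_integral 1 \<omega> 0 - \<alpha> * l"
        using reward_integral_eq[OF \<omega>, of 1] by (simp add: reward_integral_def right_diff_distrib)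
      then show ?thesis unfolding exp_add[symmetric] by simp
    qed
    have "(\<lambda>y. exp (\<alpha> * w y)) \<in> borel_measurable borel"
      by (rule bounded_borel_measurable[OF bounded_borel_exp[OF w]])
    then show ?thesis by (simp add: process_op_eq * cong: Bochner_Integration.integral_cong)
  qed
  then show ?thesis unfolding mpe_cont_def eigen_rate_def by (intro bex_cong) auto
qed

lemma I_cont_eq:
  assumes \<alpha>: "\<alpha> \<noteq> 0" and h: "harnack_operator process_op A k L" and l: "eigen_rate \<alpha> process_op l"
  shows "I_cont \<alpha> c v (Q x) X = ereal l"
proof -
  let ?a = "\<lambda>t. ln (\<integral>\<omega>. exp (\<alpha> * reward_integral c v X t \<omega>) \<partial>Q x)"
  have bound: "\<bar>?a t - t * (\<alpha> * l)\<bar> \<le> A + ln L + \<bar>\<alpha> * l\<bar>" if t: "0 \<le> t" for t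
  proof -
    define n where "n = nat \<lfloor>t\<rfloor>"
    have n: "real n \<le> t" "t \<le> real n + 1" using t by (auto simp: n_def)
    have "?a t = ln (\<integral>\<omega>. exp (path_integral t \<omega> 0) \<partial>Q x)"
      by (simp add: reward_integral_eq cong: Bochner_Integration.integral_cong)
    then have "\<bar>?a t - ln ((process_op ^^ n) (\<lambda>_. 1) x)\<bar> \<le> A"
      using process_expectation_real_time[OF t, of x] by (simp add: n_def)
    moreover have "\<bar>ln ((process_op ^^ n) (\<lambda>_. 1) x) - real n * (\<alpha> * l)\<bar> \<le> ln L"
      by (rule harnack_operator.eigen_rate_growth[OF h l])
    moreover have "\<bar>real n * (\<alpha> * l) - t * (\<alpha> * l)\<bar> \<le> 1 * \<bar>\<alpha> * l\<bar>"
      unfolding left_diff_distrib[symmetric] abs_mult using n by (intro mult_right_mono) auto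
    ultimately show ?thesis by linarith
  qed
  have "Liminf at_top (\<lambda>t. ereal (1 / \<alpha> * (1 / t) * ?a t)) = ereal l"
  proof (rule Liminf_linear_growth[OF \<alpha>])
    show "eventually (\<lambda>t. \<bar>?a t - t * (\<alpha> * l)\<bar> \<le> A + ln L + \<bar>\<alpha> * l\<bar>) at_top"
      using bound by (auto simp: eventually_at_top_linorder)
  qed (auto simp: filterlim_ident)
  then show ?thesis by (simp add: I_cont_def)
qed

end

section \<open>Continuity in the control\<close>

theorem theorem5:
  fixes \<alpha> :: real
    and U :: "'a::topological_space set"
    and \<U> :: "('e::polish_space \<Rightarrow> 'a) set"
    and c :: "'e \<Rightarrow> 'a \<Rightarrow> real"
    and V :: "'e \<Rightarrow> real"
    and Pd :: "nat \<Rightarrow> 'a \<Rightarrow> 'e \<Rightarrow> 'e measure"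
    and Qd :: "nat \<Rightarrow> ('e \<Rightarrow> 'a) \<Rightarrow> 'e \<Rightarrow> 'v measure"
    and Y :: "nat \<Rightarrow> ('e \<Rightarrow> 'a) \<Rightarrow> nat \<Rightarrow> 'v \<Rightarrow> 'e"
    and P :: "('e \<Rightarrow> 'a) \<Rightarrow> real \<Rightarrow> 'e \<Rightarrow> 'e measure"
    and Q :: "('e \<Rightarrow> 'a) \<Rightarrow> 'e \<Rightarrow> 'w measure"
    and X :: "('e \<Rightarrow> 'a) \<Rightarrow> real \<Rightarrow> 'w \<Rightarrow> 'e"
    and k :: nat
    and us :: "nat \<Rightarrow> 'e \<Rightarrow> 'a"
    and u :: "'e \<Rightarrow> 'a"
  assumes alpha: "\<alpha> \<noteq> 0"
    and U_compact: "compact U"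
    and controls: "\<And>v. v \<in> \<U> \<Longrightarrow> v \<in> measurable borel (restrict_space borel U)"
    and c_measurable: "(\<lambda>(x, a). c x a) \<in> borel_measurable (borel \<Otimes>\<^sub>M restrict_space borel U)"
    and c_continuous: "\<And>x. continuous_on U (c x)"
    and c_bounded: "\<exists>C. \<forall>x. \<forall>a\<in>U. \<bar>c x a\<bar> \<le> C"
    and V_measurable: "V \<in> borel_measurable borel"
    and V_ge_1: "\<And>x. V x \<ge> 1"
    \<comment> \<open>discretized chains\<close>
    and Pd_kernel: "\<And>m a. a \<in> U \<Longrightarrow> Pd m a \<in> measurable borel (prob_algebra borel)"
    and Pd_control_kernel:
      "\<And>m v. v \<in> \<U> \<Longrightarrow> control_kernel Pd m v \<in> measurable borel (prob_algebra borel)"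
    and Y_markov:
      "\<And>m v x. v \<in> \<U> \<Longrightarrow>
         markov_process_from UNIV (kernel_power (control_kernel Pd m v)) x (Qd m v x) (Y m v)"
    \<comment> \<open>continuous time processes\<close>
    and P_kernel:
      "\<And>v. v \<in> \<U> \<Longrightarrow>
         (\<lambda>(t, x). P v t x) \<in> measurable (restrict_space borel {0..} \<Otimes>\<^sub>M borel) (prob_algebra borel)"
    and X_measurable:
      "\<And>v x. v \<in> \<U> \<Longrightarrow>
         (\<lambda>(t, \<omega>). X v t \<omega>) \<in> measurable (restrict_space borel {0..} \<Otimes>\<^sub>M Q v x) borel"
    and X_markov: "\<And>v x. v \<in> \<U> \<Longrightarrow> markov_process_from {0..} (P v) x (Q v x) (X v)"
    \<comment> \<open>eConv\<close>
    and eConv: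
      "\<And>v x. v \<in> \<U> \<Longrightarrow>
         (\<lambda>m. variation_norm_diff (weighted_disc \<alpha> c v m (Qd m v x) (Y m v))
                                  (weighted_cont \<alpha> c v (Q v x) (X v))) \<longlonglongrightarrow> 0"
    \<comment> \<open>uUE\<close>
    and uUE: "\<And>v. v \<in> \<U> \<Longrightarrow> Delta Pd v < 1"
    and sup_uUE: "(SUP v\<in>\<U>. Delta Pd v) < 1"
    \<comment> \<open>uEquiv\<close>
    and uEquiv: "\<And>v. v \<in> \<U> \<Longrightarrow> Kbound Pd k v < \<infinity>"
    and sup_uEquiv: "(SUP v\<in>\<U>. Kbound Pd k v) < \<infinity>"
    \<comment> \<open>uCont\<close>
    and uCont:
      "\<And>m vs v x. (\<And>n. vs n \<in> \<U>) \<Longrightarrow> v \<in> \<U> \<Longrightarrow> (\<And>y. (\<lambda>n. vs n y) \<longlonglongrightarrow> v y) \<Longrightarrow>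
         (\<lambda>n. V_norm_diff V (Pd m (vs n x) x) (Pd m (v x) x)) \<longlonglongrightarrow> 0"
    and us: "\<And>n. us n \<in> \<U>"
    and u: "u \<in> \<U>"
    and us_tendsto: "\<And>x. (\<lambda>n. us n x) \<longlonglongrightarrow> u x"
  shows
    "(\<forall>m. (\<forall>v\<in>range us \<union> {u}.
              (\<exists>!l. mpe_disc \<alpha> c v m (Qd m v) (Y m v) l) \<and>
              (\<forall>x. I_disc \<alpha> c v (1 / 2 ^ m) (Qd m v x) (Y m v)
                     = ereal (lambda_disc \<alpha> c v m (Qd m v) (Y m v)))) \<and>
           (\<lambda>n. lambda_disc \<alpha> c (us n) m (Qd m (us n)) (Y m (us n)))
              \<longlonglongrightarrow> lambda_disc \<alpha> c u m (Qd m u) (Y m u)) \<and>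
     ((\<forall>x. (\<lambda>m. SUP n. variation_norm_diff
                  (weighted_disc \<alpha> c (us n) m (Qd m (us n) x) (Y m (us n)))
                  (weighted_cont \<alpha> c (us n) (Q (us n) x) (X (us n)))) \<longlonglongrightarrow> 0) \<longrightarrow>
        (\<forall>v\<in>range us \<union> {u}.
            (\<exists>!l. mpe_cont \<alpha> c v (Q v) (X v) l) \<and>
            (\<forall>x. I_cont \<alpha> c v (Q v x) (X v) = ereal (lambda_cont \<alpha> c v (Q v) (X v)))) \<and>
        (\<lambda>n. lambda_cont \<alpha> c (us n) (Q (us n)) (X (us n))) \<longlonglongrightarrow> lambda_cont \<alpha> c u (Q u) (X u))"
proof -
  obtain C where C: "\<And>x a. a \<in> U \<Longrightarrow> \<bar>c x a\<bar> \<le> C" using c_bounded by blast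
  \<comment> \<open>\<open>A\<close>, \<open>K\<close> and thus the Harnack constant \<open>L\<close> are common to all controls and all \<open>m\<close>\<close>
  define A where "A = \<bar>\<alpha>\<bar> * C"
  define K where "K = enn2real (SUP v\<in>\<U>. Kbound Pd k v)"
  define L where "L = K * exp (2 * real k * A)"
  have in_U: "v x \<in> U" if "v \<in> \<U>" for v x
    using measurable_space[OF controls[OF that], of x] by (simp add: space_restrict_space)
  have reward: "(\<lambda>x. c x (v x)) \<in> bounded_borel" if v: "v \<in> \<U>" for v
  proof (rule bounded_borelI)
    have "(\<lambda>x. (x, v x)) \<in> measurable borel (borel \<Otimes>\<^sub>M restrict_space borel U)"
      using controls[OF v] by measurable
    from measurable_compose[OF this c_measurable] show "(\<lambda>x. c x (v x)) \<in> borel_measurable borel" by simp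
    show "\<bar>c x (v x)\<bar> \<le> C" for x by (rule C[OF in_U[OF v]])
  qed
  have A: "\<bar>\<alpha> * c x (v x)\<bar> \<le> A" if v: "v \<in> \<U>" for v x
    unfolding A_def abs_mult using C[OF in_U[OF v]] by (intro mult_left_mono) auto
  have chain: "controlled_chain Pd m (Qd m v) (Y m v) \<alpha> c v A" if v: "v \<in> \<U>" for m v
    by unfold_locales (intro Pd_control_kernel Y_markov reward A v)+
  have process: "controlled_process (P v) (Q v) (X v) \<alpha> c v A" if v: "v \<in> \<U>" for v
    by unfold_locales (intro P_kernel X_measurable X_markov reward A v)+
  define Sd where "Sd m v = controlled_chain.chain_op Pd m \<alpha> c v" for m v
  define Sc where "Sc v = weighted_process.process_op (Q v) (X v) (\<lambda>x. \<alpha> * c x (v x))" for v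
  define \<nu> where "\<nu> m v x = variation_norm_diff (weighted_disc \<alpha> c v m (Qd m v x) (Y m v)) (weighted_cont \<alpha> c v (Q v x) (X v))"
    for m v x
  have Sd_pos: "positive_operator (Sd m v) A" if "v \<in> \<U>" for m v
    unfolding Sd_def by (rule controlled_chain.positive_operator_chain[OF chain[OF that]])
  have Sc_wp: "weighted_process (P v) (Q v) (X v) (\<lambda>x. \<alpha> * c x (v x)) A" if v: "v \<in> \<U>" for v
    by unfold_locales (intro P_kernel X_measurable X_markov bounded_borel_cmult reward A v)+
  have Sc_pos: "positive_operator (Sc v) A" if "v \<in> \<U>" for v
    unfolding Sc_def by (rule weighted_process.positive_operator_process[OF Sc_wp[OF that]])
  have K: "Kbound Pd k v \<le> ennreal K" "0 \<le> K" if "v \<in> \<U>" for v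
    using sup_uEquiv SUP_upper[OF that, of "Kbound Pd k"] by (auto simp: K_def)
  have Sd_harnack: "harnack_operator (Sd m v) A k L" if v: "v \<in> \<U>" for m v
    unfolding Sd_def controlled_chain.chain_op_def[OF chain[OF v]] controlled_chain.step_op_def[OF chain[OF v]] L_def
    by (rule harnack_operator_weighted_step[OF Pd_control_kernel[OF v] bounded_borel_cmult[OF reward[OF v]] A[OF v] K[OF v]])
  \<comment> \<open>both operators integrate against the weighted measures, so the variation norm bounds the difference\<close>
  have close: "ereal \<bar>Sd m v f x - Sc v f x\<bar> \<le> ereal D * \<nu> m v x"
    if v: "v \<in> \<U>" and f: "f \<in> bounded_borel" and D: "\<And>y. \<bar>f y\<bar> \<le> D" for m v f D x
    unfolding \<nu>_def variation_norm_diff_def Sd_def Sc_def controlled_chain.integral_weighted_disc[OF chain[OF v] f, symmetric]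
      weighted_process.process_op_def[OF Sc_wp[OF v]] controlled_process.weighted_cont_eq[OF process[OF v]]
    by (rule integral_diff_le_V_norm_diff[OF controlled_chain.finite_weighted_disc[OF chain[OF v]]
          weighted_process.process_kernel_finite[OF Sc_wp[OF v]] _ weighted_process.sets_process_kernel[OF Sc_wp[OF v]] _ f D])
      (auto simp: weighted_disc_def)
  have Sd_Sc: "op_converge (\<lambda>m. Sd m v) (Sc v)" if v: "v \<in> \<U>" for v
    by (rule op_converge_perturb[OF Sc_pos[OF v] eConv[OF v, folded \<nu>_def] close[OF v]])
  have Sc_harnack: "harnack_operator (Sc v) A k L" if v: "v \<in> \<U>" for v
    by (rule harnack_operator_limit[OF Sd_Sc[OF v] Sd_harnack[OF v] Sc_pos[OF v]])
  have mpe_d: "mpe_disc \<alpha> c v m (Qd m v) (Y m v) l \<longleftrightarrow> eigen_rate \<alpha> (Sd m v) l" if "v \<in> \<U>" for m v l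
    unfolding Sd_def by (rule controlled_chain.mpe_disc_iff[OF chain[OF that]])
  have mpe_c: "mpe_cont \<alpha> c v (Q v) (X v) l \<longleftrightarrow> eigen_rate \<alpha> (Sc v) l" if "v \<in> \<U>" for v l
    unfolding Sc_def by (rule controlled_process.mpe_cont_iff[OF process[OF that]])
  have ex1_d: "\<exists>!l. mpe_disc \<alpha> c v m (Qd m v) (Y m v) l" if "v \<in> \<U>" for m v
    unfolding mpe_d[OF that] by (rule harnack_operator.ex1_eigen_rate[OF Sd_harnack[OF that] alpha])
  have ex1_c: "\<exists>!l. mpe_cont \<alpha> c v (Q v) (X v) l" if "v \<in> \<U>" for v
    unfolding mpe_c[OF that] by (rule harnack_operator.ex1_eigen_rate[OF Sc_harnack[OF that] alpha])
  have lam_d: "eigen_rate \<alpha> (Sd m v) (lambda_disc \<alpha> c v m (Qd m v) (Y m v))" if "v \<in> \<U>" for m v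
    using theI'[OF ex1_d[OF that]] unfolding lambda_disc_def mpe_d[OF that] .
  have lam_c: "eigen_rate \<alpha> (Sc v) (lambda_cont \<alpha> c v (Q v) (X v))" if "v \<in> \<U>" for v
    using theI'[OF ex1_c[OF that]] unfolding lambda_cont_def mpe_c[OF that] .
  have I_d: "I_disc \<alpha> c v (1 / 2 ^ m) (Qd m v x) (Y m v) = ereal (lambda_disc \<alpha> c v m (Qd m v) (Y m v))"
    if v: "v \<in> \<U>" for m v x
    using Sd_harnack[OF v] lam_d[OF v] unfolding Sd_def by (rule controlled_chain.I_disc_eq[OF chain[OF v] alpha])
  have I_c: "I_cont \<alpha> c v (Q v x) (X v) = ereal (lambda_cont \<alpha> c v (Q v) (X v))"
    if v: "v \<in> \<U>" for v x
    using Sc_harnack[OF v] lam_c[OF v] unfolding Sc_def by (rule controlled_process.I_cont_eq[OF process[OF v] alpha])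
  have ctl: "v \<in> \<U>" if "v \<in> range us \<union> {u}" for v using that us u by auto
  have reward_lim: "(\<lambda>n. \<alpha> * c x (us n x)) \<longlonglongrightarrow> \<alpha> * c x (u x)" for x
    using continuous_on_tendsto_compose[OF c_continuous us_tendsto in_U[OF u], of x] in_U[OF us]
    by (intro tendsto_mult_left) simp
  have Sd_conv: "op_converge (\<lambda>n. Sd m (us n)) (Sd m u)" for m
  proof -
    have "op_converge (\<lambda>n. weighted_step (1 / 2 ^ m) (\<lambda>x. \<alpha> * c x (us n x)) (control_kernel Pd m (us n)))
        (weighted_step (1 / 2 ^ m) (\<lambda>x. \<alpha> * c x (u x)) (control_kernel Pd m u))"
      using uCont[OF us u us_tendsto, of m]
      by (intro op_converge_weighted_step[OF Pd_control_kernel[OF us] Pd_control_kernel[OF u] V_ge_1 _ reward_lim])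
        (simp add: control_kernel_def)
    from op_converge_funpow[OF this, of "1 / 2 ^ m * A" "2 ^ m"] show ?thesis
      using controlled_chain.positive_operator_step[OF chain[OF us]]
      unfolding Sd_def controlled_chain.chain_op_def[OF chain[OF u]] controlled_chain.chain_op_def[OF chain[OF us]]
        controlled_chain.step_op_def[OF chain[OF u]] controlled_chain.step_op_def[OF chain[OF us]] by blast
  qed
  have lim_d: "(\<lambda>n. lambda_disc \<alpha> c (us n) m (Qd m (us n)) (Y m (us n))) \<longlonglongrightarrow> lambda_disc \<alpha> c u m (Qd m u) (Y m u)" for m
    by (rule eigen_rate_tendsto[OF alpha Sd_harnack[OF us] Sd_harnack[OF u] Sd_conv lam_d[OF us] lam_d[OF u]])
  have lim_c: "(\<lambda>n. lambda_cont \<alpha> c (us n) (Q (us n)) (X (us n))) \<longlonglongrightarrow> lambda_cont \<alpha> c u (Q u) (X u)"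
    if unif: "\<forall>x. (\<lambda>m. SUP n. variation_norm_diff
                  (weighted_disc \<alpha> c (us n) m (Qd m (us n) x) (Y m (us n)))
                  (weighted_cont \<alpha> c (us n) (Q (us n) x) (X (us n)))) \<longlonglongrightarrow> 0"
  proof -
    have "op_converge (\<lambda>n. Sc (us n)) (Sc u)"
    proof (rule op_converge_uniform_approximation[OF Sd_conv Sd_Sc[OF u] unif[rule_format, folded \<nu>_def]])
      fix m n f D x assume f: "f \<in> bounded_borel" and D: "\<And>y::'e. \<bar>f y\<bar> \<le> D"
      have "0 \<le> D" using D[of undefined] by linarith
      have "ereal \<bar>Sc (us n) f x - Sd m (us n) f x\<bar> \<le> ereal D * \<nu> m (us n) x"
        using close[OF us f D, of m n x] by (simp add: abs_minus_commute)
      also have "\<dots> \<le> ereal D * (SUP n. \<nu> m (us n) x)"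
        using \<open>0 \<le> D\<close> by (intro ereal_mult_left_mono SUP_upper) auto
      finally show "ereal \<bar>Sc (us n) f x - Sd m (us n) f x\<bar> \<le> ereal D * (SUP n. \<nu> m (us n) x)" .
    qed
    then show ?thesis
      by (rule eigen_rate_tendsto[OF alpha Sc_harnack[OF us] Sc_harnack[OF u] _ lam_c[OF us] lam_c[OF u]])
  qed
  show ?thesis
    by (intro conjI allI ballI impI;
        (rule ex1_d ex1_c I_d I_c, erule ctl | rule lim_d | erule lim_c))
qed

end
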